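(* Assume Hypothesis (H): there is a constant $d\ge1$ such that every language in $\mathsf{P}$ is decided by circuits of size $O(n^d)$. Then there are a polynomial-time generator $g$ (stretching every input of length $n$ to some length $m(n)>n$) and a model $\mathbf{M}$ of $T_{PV}$ such that for every $\mathsf{NP}$ set $A$ (represented as below), $$\mathbf M\models\ \mathrm{rng}(g)\cap A=\emptyset\ \to\ \neg\mathrm{Inf}_A.$$
   Context: $T_{PV}$ is the theory whose language has a $k$-ary function symbol $f_M$ for every polynomial-time clocked machine $M$ with $k$ inputs ($k\ge1$), interpreted on $\mathbb N$ as the function $M$ computes, and whose axioms are all universal sentences of this language true in $\mathbb N$. An $\mathsf{NP}$ set $A$ is represented by a formula $y\in A:\equiv\exists z(|z|\le|y|^c)A_0(y,z)$ with $c\ge1$ a constant and $A_0$ an open formula defining a polynomial-time relation; $\mathrm{Inf}_A$ is the sentence $\forall x\exists y(y>x\wedge y\in A)$, and $\mathrm{rng}(g)\cap A=\emptyset$ is the universal sentence $\forall x\forall z\,\neg(|z|\le|g(x)|^c\wedge A_0(g(x),z))$ with $g$ denoted by its function symbol. *)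

theory Defs
  imports Complex_Main "HOL-Library.Log_Nat" "HOL-Library.Landau_Symbols"
begin

section \<open>Numbers and bit strings\<close>

text \<open>
  The length \<open>|x|\<close> of a number is the length of its binary expansion (\<open>|0| = 0\<close>).  Bit strings
  list the least significant bit first.  Decoding accepts strings with superfluous leading zeros.
\<close>

definition len :: "nat \<Rightarrow> nat"
  where "len x = floorlog 2 x"

definition bits_of :: "nat \<Rightarrow> bool list"
  where "bits_of x = map (bit x) [0..<len x]"

definition num_of :: "bool list \<Rightarrow> nat"
  where "num_of w = horner_sum of_bool 2 w"


section \<open>Polynomial-time clocked Turing machines\<close>

text \<open>
  Deterministic multitape machines with two-way infinite tapes over a finite alphabet of natural
  numbers, where 0 is the blank and 1, 2 stand for the bits 0, 1.  The transition function is the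
  finite partial function \<open>map_of\<close> of the table; a machine halts when no entry applies.  The start
  state is 0.  Tapes \<open>0, \<dots>, k - 1\<close> initially hold the \<open>k\<close> inputs, written from cell 0 on with the
  head on cell 0; tape \<open>k\<close> is the output tape.  The clock stops the computation after
  \<open>n ^ e + e\<close> steps, \<open>n\<close> being the total length of the inputs.
\<close>

datatype move = Left | Stay | Right

record machine =
  inputs :: nat
  tapes :: nat
  table :: "((nat \<times> nat list) \<times> (nat \<times> (nat \<times> move) list)) list"
  clock_exp :: nat

definition clocked_machine :: "machine \<Rightarrow> bool"
  where "clocked_machine M \<longleftrightarrow>
    1 \<le> inputs M \<and> inputs M < tapes M \<and>
    (\<forall>((q, ss), (q', acts)) \<in> set (table M). length ss = tapes M \<and> length acts = tapes M)"

type_synonym tape = "(int \<Rightarrow> nat) \<times> int"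
type_synonym config = "nat \<times> tape list"

fun read :: "tape \<Rightarrow> nat"
  where "read (t, h) = t h"

fun shift :: "move \<Rightarrow> int \<Rightarrow> int"
  where
    "shift Left h = h - 1"
  | "shift Stay h = h"
  | "shift Right h = h + 1"

fun act :: "nat \<times> move \<Rightarrow> tape \<Rightarrow> tape"
  where "act (s, d) (t, h) = (t(h := s), shift d h)"

fun step :: "machine \<Rightarrow> config \<Rightarrow> config"
  where "step M (q, ts) =
    (case map_of (table M) (q, map read ts) of
       None \<Rightarrow> (q, ts)
     | Some (q', acts) \<Rightarrow> (q', map2 act acts ts))"

definition tape_of :: "bool list \<Rightarrow> tape"
  where "tape_of w =
    ((\<lambda>i. if 0 \<le> i \<and> i < int (length w) then (if w ! nat i then 2 else 1) else 0), 0)"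

definition start :: "machine \<Rightarrow> bool list list \<Rightarrow> config"
  where "start M ws = (0, map tape_of ws @ replicate (tapes M - inputs M) (tape_of []))"

definition clock :: "machine \<Rightarrow> bool list list \<Rightarrow> nat"
  where "clock M ws = (let n = sum_list (map length ws) in n ^ clock_exp M + clock_exp M)"

text \<open>The output is the maximal block of bits that starts in cell 0 of the output tape.\<close>

fun contents :: "tape \<Rightarrow> bool list"
  where "contents (t, h) = map (\<lambda>i. t (int i) = 2) [0..<(LEAST i. t (int i) \<notin> {1, 2})]"

definition out_of :: "machine \<Rightarrow> bool list list \<Rightarrow> bool list"
  where "out_of M ws = contents (snd ((step M ^^ clock M ws) (start M ws)) ! inputs M)"

definition fun_of :: "machine \<Rightarrow> nat list \<Rightarrow> nat"
  where "fun_of M xs = num_of (out_of M (map bits_of xs))"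

definition class_P :: "bool list set set"
  where "class_P =
    {L. \<exists>M. clocked_machine M \<and> inputs M = 1 \<and> (\<forall>w. w \<in> L \<longleftrightarrow> out_of M [w] = [True])}"


section \<open>Boolean circuits\<close>

text \<open>
  A circuit is a straight-line program over the basis \<open>\<not>, \<and>, \<or>\<close> with constants; the arguments of
  a gate are positions of earlier gates, and the last gate is the output.  The size is the number
  of gates, input gates included.
\<close>

datatype gate = In_gate nat | Const_gate bool | Not_gate nat | And_gate nat nat | Or_gate nat nat

type_synonym circuit = "gate list"

fun gate_ok :: "nat \<Rightarrow> nat \<Rightarrow> gate \<Rightarrow> bool"
  where
    "gate_ok n i (In_gate a) \<longleftrightarrow> a < n"
  | "gate_ok n i (Const_gate b) \<longleftrightarrow> True"
  | "gate_ok n i (Not_gate a) \<longleftrightarrow> a < i"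
  | "gate_ok n i (And_gate a b) \<longleftrightarrow> a < i \<and> b < i"
  | "gate_ok n i (Or_gate a b) \<longleftrightarrow> a < i \<and> b < i"

definition circuit :: "nat \<Rightarrow> circuit \<Rightarrow> bool"
  where "circuit n C \<longleftrightarrow> C \<noteq> [] \<and> (\<forall>i<length C. gate_ok n i (C ! i))"

fun gate_val :: "bool list \<Rightarrow> bool list \<Rightarrow> gate \<Rightarrow> bool"
  where
    "gate_val w vs (In_gate a) = w ! a"
  | "gate_val w vs (Const_gate b) = b"
  | "gate_val w vs (Not_gate a) = (\<not> vs ! a)"
  | "gate_val w vs (And_gate a b) = (vs ! a \<and> vs ! b)"
  | "gate_val w vs (Or_gate a b) = (vs ! a \<or> vs ! b)"

definition circuit_val :: "circuit \<Rightarrow> bool list \<Rightarrow> bool"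
  where "circuit_val C w = last (foldl (\<lambda>vs g. vs @ [gate_val w vs g]) [] C)"

definition SIZE_O :: "nat \<Rightarrow> bool list set set"
  where "SIZE_O d =
    {L. \<exists>C :: nat \<Rightarrow> circuit.
       (\<forall>n. circuit n (C n) \<and> (\<forall>w. length w = n \<longrightarrow> (circuit_val (C n) w \<longleftrightarrow> w \<in> L))) \<and>
       (\<lambda>n. real (length (C n))) \<in> O(\<lambda>n. real n ^ d)}"

definition hypothesis_H :: bool
  where "hypothesis_H \<longleftrightarrow> (\<exists>d\<ge>1. class_P \<subseteq> SIZE_O d)"


section \<open>First-order logic with equality\<close>

datatype 'f trm = Var nat | Fn 'f "'f trm list"

datatype 'f fm =
    Eq "'f trm" "'f trm"
  | Neg "'f fm"
  | Conj "'f fm" "'f fm"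
  | Disj "'f fm" "'f fm"
  | Imp "'f fm" "'f fm"
  | All nat "'f fm"
  | Ex nat "'f fm"

record ('f, 'u) struct =
  univ :: "'u set"
  interp :: "'f \<Rightarrow> 'u list \<Rightarrow> 'u"

fun tval :: "('f, 'u) struct \<Rightarrow> (nat \<Rightarrow> 'u) \<Rightarrow> 'f trm \<Rightarrow> 'u"
  where
    "tval S e (Var x) = e x"
  | "tval S e (Fn f ts) = interp S f (map (tval S e) ts)"

fun sat :: "('f, 'u) struct \<Rightarrow> (nat \<Rightarrow> 'u) \<Rightarrow> 'f fm \<Rightarrow> bool"
  where
    "sat S e (Eq t u) \<longleftrightarrow> tval S e t = tval S e u"
  | "sat S e (Neg \<phi>) \<longleftrightarrow> \<not> sat S e \<phi>"
  | "sat S e (Conj \<phi> \<psi>) \<longleftrightarrow> sat S e \<phi> \<and> sat S e \<psi>"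
  | "sat S e (Disj \<phi> \<psi>) \<longleftrightarrow> sat S e \<phi> \<or> sat S e \<psi>"
  | "sat S e (Imp \<phi> \<psi>) \<longleftrightarrow> (sat S e \<phi> \<longrightarrow> sat S e \<psi>)"
  | "sat S e (All x \<phi>) \<longleftrightarrow> (\<forall>a\<in>univ S. sat S (e(x := a)) \<phi>)"
  | "sat S e (Ex x \<phi>) \<longleftrightarrow> (\<exists>a\<in>univ S. sat S (e(x := a)) \<phi>)"

definition models :: "('f, 'u) struct \<Rightarrow> 'f fm \<Rightarrow> bool"  (infix \<open>\<Turnstile>\<close> 50)
  where "S \<Turnstile> \<phi> \<longleftrightarrow> (\<forall>e. range e \<subseteq> univ S \<longrightarrow> sat S e \<phi>)"

fun tvars :: "'f trm \<Rightarrow> nat set"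
  where
    "tvars (Var x) = {x}"
  | "tvars (Fn f ts) = (\<Union>t\<in>set ts. tvars t)"

fun fvars :: "'f fm \<Rightarrow> nat set"
  where
    "fvars (Eq t u) = tvars t \<union> tvars u"
  | "fvars (Neg \<phi>) = fvars \<phi>"
  | "fvars (Conj \<phi> \<psi>) = fvars \<phi> \<union> fvars \<psi>"
  | "fvars (Disj \<phi> \<psi>) = fvars \<phi> \<union> fvars \<psi>"
  | "fvars (Imp \<phi> \<psi>) = fvars \<phi> \<union> fvars \<psi>"
  | "fvars (All x \<phi>) = fvars \<phi> - {x}"
  | "fvars (Ex x \<phi>) = fvars \<phi> - {x}"

fun open_fm :: "'f fm \<Rightarrow> bool"
  where
    "open_fm (Eq t u) \<longleftrightarrow> True"
  | "open_fm (Neg \<phi>) \<longleftrightarrow> open_fm \<phi>"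
  | "open_fm (Conj \<phi> \<psi>) \<longleftrightarrow> open_fm \<phi> \<and> open_fm \<psi>"
  | "open_fm (Disj \<phi> \<psi>) \<longleftrightarrow> open_fm \<phi> \<and> open_fm \<psi>"
  | "open_fm (Imp \<phi> \<psi>) \<longleftrightarrow> open_fm \<phi> \<and> open_fm \<psi>"
  | "open_fm (All x \<phi>) \<longleftrightarrow> False"
  | "open_fm (Ex x \<phi>) \<longleftrightarrow> False"

definition universal_sentence :: "'f fm \<Rightarrow> bool"
  where "universal_sentence \<phi> \<longleftrightarrow>
    fvars \<phi> = {} \<and> (\<exists>xs \<psi>. open_fm \<psi> \<and> \<phi> = foldr All xs \<psi>)"

fun tsubst :: "(nat \<Rightarrow> 'f trm) \<Rightarrow> 'f trm \<Rightarrow> 'f trm"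
  where
    "tsubst \<sigma> (Var x) = \<sigma> x"
  | "tsubst \<sigma> (Fn f ts) = Fn f (map (tsubst \<sigma>) ts)"

text \<open>Substitution does not rename bound variables; it is only applied to open formulas.\<close>

fun subst :: "(nat \<Rightarrow> 'f trm) \<Rightarrow> 'f fm \<Rightarrow> 'f fm"
  where
    "subst \<sigma> (Eq t u) = Eq (tsubst \<sigma> t) (tsubst \<sigma> u)"
  | "subst \<sigma> (Neg \<phi>) = Neg (subst \<sigma> \<phi>)"
  | "subst \<sigma> (Conj \<phi> \<psi>) = Conj (subst \<sigma> \<phi>) (subst \<sigma> \<psi>)"
  | "subst \<sigma> (Disj \<phi> \<psi>) = Disj (subst \<sigma> \<phi>) (subst \<sigma> \<psi>)"
  | "subst \<sigma> (Imp \<phi> \<psi>) = Imp (subst \<sigma> \<phi>) (subst \<sigma> \<psi>)"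
  | "subst \<sigma> (All x \<phi>) = All x (subst (\<sigma>(x := Var x)) \<phi>)"
  | "subst \<sigma> (Ex x \<phi>) = Ex x (subst (\<sigma>(x := Var x)) \<phi>)"


section \<open>The theory \<open>T\<^sub>P\<^sub>V\<close>\<close>

text \<open>
  The function symbol \<open>f\<^sub>M\<close> is the clocked machine \<open>M\<close> itself, of arity \<open>inputs M\<close>.  The language
  is countable, so models with universe a set of natural numbers lose no generality
  (Loewenheim-Skolem).
\<close>

fun PV_trm :: "machine trm \<Rightarrow> bool"
  where
    "PV_trm (Var x) \<longleftrightarrow> True"
  | "PV_trm (Fn M ts) \<longleftrightarrow> clocked_machine M \<and> length ts = inputs M \<and> (\<forall>t\<in>set ts. PV_trm t)"

fun PV_fm :: "machine fm \<Rightarrow> bool"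
  where
    "PV_fm (Eq t u) \<longleftrightarrow> PV_trm t \<and> PV_trm u"
  | "PV_fm (Neg \<phi>) \<longleftrightarrow> PV_fm \<phi>"
  | "PV_fm (Conj \<phi> \<psi>) \<longleftrightarrow> PV_fm \<phi> \<and> PV_fm \<psi>"
  | "PV_fm (Disj \<phi> \<psi>) \<longleftrightarrow> PV_fm \<phi> \<and> PV_fm \<psi>"
  | "PV_fm (Imp \<phi> \<psi>) \<longleftrightarrow> PV_fm \<phi> \<and> PV_fm \<psi>"
  | "PV_fm (All x \<phi>) \<longleftrightarrow> PV_fm \<phi>"
  | "PV_fm (Ex x \<phi>) \<longleftrightarrow> PV_fm \<phi>"

definition PV_structure :: "(machine, 'u) struct \<Rightarrow> bool"
  where "PV_structure S \<longleftrightarrow>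
    univ S \<noteq> {} \<and>
    (\<forall>M as. clocked_machine M \<longrightarrow> length as = inputs M \<longrightarrow> set as \<subseteq> univ S \<longrightarrow>
       interp S M as \<in> univ S)"

definition standard_model :: "(machine, nat) struct"
  where "standard_model = \<lparr>univ = UNIV, interp = fun_of\<rparr>"

definition T_PV :: "machine fm set"
  where "T_PV = {\<phi>. PV_fm \<phi> \<and> universal_sentence \<phi> \<and> standard_model \<Turnstile> \<phi>}"

definition T_PV_model :: "(machine, 'u) struct \<Rightarrow> bool"
  where "T_PV_model S \<longleftrightarrow> PV_structure S \<and> (\<forall>\<phi>\<in>T_PV. S \<Turnstile> \<phi>)"

text \<open>
  The language has no relation symbols besides equality.  A polynomial-time relation \<open>R\<close> is
  expressed by \<open>\<chi>\<^sub>R(ts) = 1(ts)\<close>, with symbols for its characteristic function and for the constant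
  function 1.  The choice of the machines computing them is immaterial: the equality of any two
  such choices is a universal sentence true in \<open>\<nat>\<close>.
\<close>

definition char_sym :: "nat \<Rightarrow> (nat list \<Rightarrow> bool) \<Rightarrow> machine"
  where "char_sym k R = (SOME M. clocked_machine M \<and> inputs M = k \<and>
    (\<forall>xs. length xs = k \<longrightarrow> fun_of M xs = of_bool (R xs)))"

definition Rel :: "(nat list \<Rightarrow> bool) \<Rightarrow> machine trm list \<Rightarrow> machine fm"
  where "Rel R ts =
    Eq (Fn (char_sym (length ts) R) ts) (Fn (char_sym (length ts) (\<lambda>_. True)) ts)"

definition Less :: "machine trm \<Rightarrow> machine trm \<Rightarrow> machine fm"
  where "Less t u = Rel (\<lambda>xs. xs ! 0 < xs ! 1) [t, u]"

text \<open>\<open>Len_le_pow c t u\<close> is the formula \<open>|t| \<le> |u| ^ c\<close>.\<close>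

definition Len_le_pow :: "nat \<Rightarrow> machine trm \<Rightarrow> machine trm \<Rightarrow> machine fm"
  where "Len_le_pow c t u = Rel (\<lambda>xs. len (xs ! 0) \<le> len (xs ! 1) ^ c) [t, u]"


section \<open>\<open>NP\<close> sets and generators\<close>

text \<open>
  The variables \<open>x, y, z\<close> are \<open>Var 0\<close>, \<open>Var 1\<close>, \<open>Var 2\<close>.  A representation of an \<open>NP\<close> set is a
  pair \<open>(c, A\<^sub>0)\<close>; every open formula of the language defines a polynomial-time relation.
\<close>

type_synonym np_set = "nat \<times> machine fm"

fun NP_set :: "np_set \<Rightarrow> bool"
  where "NP_set (c, A0) \<longleftrightarrow> 1 \<le> c \<and> PV_fm A0 \<and> open_fm A0 \<and> fvars A0 \<subseteq> {1, 2}"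

fun Mem :: "np_set \<Rightarrow> machine fm"
  where "Mem (c, A0) = Ex 2 (Conj (Len_le_pow c (Var 2) (Var 1)) A0)"

definition Inf_fm :: "np_set \<Rightarrow> machine fm"
  where "Inf_fm A = All 0 (Ex 1 (Conj (Less (Var 0) (Var 1)) (Mem A)))"

fun Rng_disjoint :: "machine \<Rightarrow> np_set \<Rightarrow> machine fm"
  where "Rng_disjoint g (c, A0) =
    (let gx = Fn g [Var 0] in
       All 0 (All 2 (Neg (Conj (Len_le_pow c (Var 2) gx) (subst (Var(1 := gx)) A0)))))"

definition generator :: "machine \<Rightarrow> bool"
  where "generator g \<longleftrightarrow> clocked_machine g \<and> inputs g = 1 \<and>
    (\<exists>m :: nat \<Rightarrow> nat. (\<forall>n. n < m n) \<and> (\<forall>x. len (fun_of g [x]) = m (len x)))"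

end

theory Submission
  imports Defs "HOL-Library.Countable_Set" "HOL-Library.Diagonal_Subsequence"
begin

text \<open>
  The generator \<open>g\<close> reads its input \<open>x\<close> of length \<open>N\<close> as a straight-line program on a bit memory,
  runs it \<open>N\<close> times in a row on the same memory, outputs one bit per round and finally a \<open>1\<close>.  A
  program that keeps a counter \<open>i\<close> in the memory and evaluates a circuit at \<open>i\<close> thus makes \<open>g\<close>
  output the truth table of the circuit.  If \<open>y = t(2 ^ n)\<close> for a term \<open>t\<close>, then the bits of \<open>y\<close> are
  decided, given \<open>i\<close> in \<open>n\<close> bits, by a polynomial-time machine, hence under (H) by circuits of size
  \<open>O(n ^ d)\<close>; so \<open>y\<close> lies in the range of \<open>g\<close> as soon as \<open>|y| > n ^ (2 d + 1)\<close> and \<open>n\<close> is large.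

  The universe of the model consists of the functions \<open>n \<mapsto> t(2 ^ n)\<close> given by terms \<open>t\<close>, modulo
  eventual equality along a subsequence \<open>r\<close> that decides all equations between such functions (a
  diagonal argument; no ultrafilter is needed since there are only countably many terms).  An open
  formula holds in it iff it eventually holds in \<open>\<nat>\<close> along \<open>r\<close>.  If \<open>Inf\<^sub>A\<close> held in the model, some
  \<open>t(2 ^ n)\<close> longer than \<open>n ^ (2 d + 1)\<close> would be in \<open>A\<close> for almost all \<open>n\<close> in \<open>r\<close>, so the range of \<open>g\<close>
  would meet \<open>A\<close> in \<open>\<nat>\<close>, and then also in the model because every number is the value of a term.
\<close>

section \<open>Stack programs and their compilation to Turing machines\<close>

text \<open>The exponent 2 d + 1 comes from the length of the code. Addressing a memory cell costs a
  walk proportional to its address, so a circuit with s gates on n inputs becomes code of order (n +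
  s)^2 bits. For s = O(n^d) this is O(n^(2 d)); one more factor n absorbs the constant, which
  depends on the term. The exponent does not, because (H) gives one d for all of P. This uniformity
  is essential: the x in Inf_A is fixed before y, and y may come from any term.

  The argument 2^n keeps |y| polynomial in n, hence eventually at most 2^n, so that n bits address
  every bit of y.

  The preimage of y under g comes from circuits, not from a uniform algorithm, so it need not be the
  value of a term and the model need not contain it. Therefore one index n is singled out, and the
  two numbers refuting disjointness there enter the model as constants.

  Machines are concrete objects, so every polynomial-time claim asks for one. The stack language
  supplies them; its largest program simulates a given clocked machine, since the value of a term is
  a composition of machines.\<close>

datatype prog =
    Skip
  | Push nat nat
  | Pop nat
  | Emit bool
  | Seq prog prog  (infixr \<open>;;\<close> 60)
  | Switch nat "nat \<Rightarrow> prog"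
  | While nat "nat \<Rightarrow> bool" prog

fun peek :: "nat list \<Rightarrow> nat"
  where
    "peek [] = 0"
  | "peek (a # w) = a"

text \<open>
  A stack occupies a tape that is blank elsewhere, with the head on the top element; hence an empty
  stack shows the blank 0 and only nonzero symbols may be pushed.  In \<open>run p s t s' os\<close>, the number
  \<open>t\<close> is an upper bound for the running time of the compiled program, \<open>s\<close> and \<open>s'\<close> are the contents
  of the stacks, and \<open>os\<close> is the word appended to the output tape.
\<close>

inductive run :: "prog \<Rightarrow> (nat \<Rightarrow> nat list) \<Rightarrow> nat \<Rightarrow> (nat \<Rightarrow> nat list) \<Rightarrow> bool list \<Rightarrow> bool"
  where
    Skip: "run Skip s t s []"
  | Push: "2 \<le> t \<Longrightarrow> run (Push i a) s t (s(i := a # s i)) []"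
  | Pop: "1 \<le> t \<Longrightarrow> run (Pop i) s t (s(i := tl (s i))) []"
  | Emit: "1 \<le> t \<Longrightarrow> run (Emit b) s t s [b]"
  | Seq: "run p s t1 s1 o1 \<Longrightarrow> run q s1 t2 s2 o2 \<Longrightarrow> t1 + t2 \<le> t \<Longrightarrow> run (p ;; q) s t s2 (o1 @ o2)"
  | Switch: "run (f (peek (s i))) s t1 s1 o1 \<Longrightarrow> t1 + 2 \<le> t \<Longrightarrow> run (Switch i f) s t s1 o1"
  | While_False: "\<not> P (peek (s i)) \<Longrightarrow> 1 \<le> t \<Longrightarrow> run (While i P p) s t s []"
  | While_True: "P (peek (s i)) \<Longrightarrow> run p s t1 s1 o1 \<Longrightarrow> run (While i P p) s1 t2 s2 o2 \<Longrightarrow>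
      t1 + t2 + 2 \<le> t \<Longrightarrow> run (While i P p) s t s2 (o1 @ o2)"

text \<open>\<open>k\<close> is the index of the output tape, \<open>K\<close> the number of tapes,
  \<open>S\<close> the size of the alphabet. Only \<open>Emit\<close> writes to the output tape, so
  no stack may live there. The branches of \<open>Switch\<close> are indexed by all numbers, but
  only those below \<open>S\<close> are compiled, which keeps the table finite.\<close>

primrec wf_prog :: "nat \<Rightarrow> nat \<Rightarrow> nat \<Rightarrow> prog \<Rightarrow> bool"
  where
    "wf_prog k K S Skip \<longleftrightarrow> True"
  | "wf_prog k K S (Push i a) \<longleftrightarrow> i < K \<and> i \<noteq> k \<and> 0 < a \<and> a < S"
  | "wf_prog k K S (Pop i) \<longleftrightarrow> i < K \<and> i \<noteq> k"
  | "wf_prog k K S (Emit b) \<longleftrightarrow> True"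
  | "wf_prog k K S (p ;; q) \<longleftrightarrow> wf_prog k K S p \<and> wf_prog k K S q"
  | "wf_prog k K S (Switch i f) \<longleftrightarrow> i < K \<and> i \<noteq> k \<and> (\<forall>a<S. wf_prog k K S (f a))"
  | "wf_prog k K S (While i P p) \<longleftrightarrow> i < K \<and> i \<noteq> k \<and> wf_prog k K S p"

text \<open>An instruction looks at one tape only and maps the scanned symbol to the symbol written,
  the move and the next state. States are positions in the instruction list.\<close>

type_synonym instr = "nat \<times> (nat \<Rightarrow> (nat \<times> move) \<times> nat)"

primrec code_size :: "nat \<Rightarrow> prog \<Rightarrow> nat"
  where
    "code_size S Skip = 0"
  | "code_size S (Push i a) = 2"
  | "code_size S (Pop i) = 1"
  | "code_size S (Emit b) = 1"
  | "code_size S (p ;; q) = code_size S p + code_size S q"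
  | "code_size S (Switch i f) = 1 + (\<Sum>a<S. code_size S (f a) + 1)"
  | "code_size S (While i P p) = code_size S p + 2"

definition goto :: "nat \<Rightarrow> (nat \<Rightarrow> nat) \<Rightarrow> instr"
  where "goto i f = (i, \<lambda>a. ((a, Stay), f a))"

definition bit_sym :: "bool \<Rightarrow> nat"
  where "bit_sym b = (if b then 2 else 1)"

text \<open>The argument \<open>q\<close> is the address of the first instruction, needed for
  absolute jumps; control leaves at the address just behind the code. Stacks grow to the left, and a
  machine writes before it moves, so \<open>Push\<close> takes two instructions. \<open>Pop\<close>
  on an empty stack writes a blank on a blank and moves, in accordance with
  \<open>tl [] = []\<close>.\<close>

primrec compile :: "nat \<Rightarrow> nat \<Rightarrow> prog \<Rightarrow> nat \<Rightarrow> instr list"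
  where
    "compile k S Skip = (\<lambda>q. [])"
  | "compile k S (Push i a) = (\<lambda>q. [(i, \<lambda>r. ((r, Left), q + 1)), (i, \<lambda>r. ((a, Stay), q + 2))])"
  | "compile k S (Pop i) = (\<lambda>q. [(i, \<lambda>r. ((0, Right), q + 1))])"
  | "compile k S (Emit b) = (\<lambda>q. [(k, \<lambda>r. ((bit_sym b, Right), q + 1))])"
  | "compile k S (p ;; p') = (\<lambda>q. compile k S p q @ compile k S p' (q + code_size S p))"
  | "compile k S (Switch i f) = (\<lambda>q.
       goto i (\<lambda>a. q + 1 + (\<Sum>r<a. code_size S (f r) + 1)) #
       concat (map (\<lambda>a. compile k S (f a) (q + 1 + (\<Sum>r<a. code_size S (f r) + 1)) @
         [goto i (\<lambda>_. q + 1 + (\<Sum>r<S. code_size S (f r) + 1))]) [0..<S]))"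
  | "compile k S (While i P p) = (\<lambda>q.
       goto i (\<lambda>a. if P a then q + 1 else q + code_size S p + 2) #
       compile k S p (q + 1) @ [goto i (\<lambda>_. q)])"

lemma length_compile: "length (compile k S p q) = code_size S p"
proof (induction p arbitrary: q)
  case (Switch i f)
  then show ?case
    by (simp add: length_concat o_def interv_sum_list_conv_sum_set_nat atLeast0LessThan)
qed auto

definition tm_entry :: "nat \<Rightarrow> instr list \<Rightarrow> nat \<times> nat list \<Rightarrow> nat \<times> (nat \<times> move) list"
  where "tm_entry K code = (\<lambda>(q, ss). case code ! q of (i, \<delta>) \<Rightarrow>
    (snd (\<delta> (ss ! i)), map (\<lambda>j. if j = i then fst (\<delta> (ss ! i)) else (ss ! j, Stay)) [0..<K]))"

text \<open>The table lists all states inside the code with all symbol vectors over the alphabet.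
  The state \<open>length code\<close> has no entry: this is how the machine halts.\<close>

definition tm_of :: "nat \<Rightarrow> nat \<Rightarrow> nat \<Rightarrow> instr list \<Rightarrow> nat \<Rightarrow> machine"
  where "tm_of k K S code e = \<lparr>inputs = k, tapes = K,
    table = map (\<lambda>x. (x, tm_entry K code x))
      (List.product [0..<length code] (List.n_lists K [0..<S])),
    clock_exp = e\<rparr>"

lemma clocked_machine_tm_of: "1 \<le> k \<Longrightarrow> k < K \<Longrightarrow> clocked_machine (tm_of k K S code e)"
  by (auto simp: clocked_machine_def tm_of_def tm_entry_def set_n_lists split: prod.splits)

lemma act_read_Stay: "act (read \<tau>, Stay) \<tau> = \<tau>"
  by (cases \<tau>) auto

lemma step_tm_of:
  assumes "q < length code" and "code ! q = (i, \<delta>)" and "i < K" and "length ts = K"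
    and "\<forall>j<K. read (ts ! j) < S"
  shows "step (tm_of k K S code e) (q, ts) =
    (snd (\<delta> (read (ts ! i))), ts[i := act (fst (\<delta> (read (ts ! i)))) (ts ! i)])"
proof -
  have mem: "(q, map read ts) \<in> set (List.product [0..<length code] (List.n_lists K [0..<S]))"
    using assms by (fastforce simp: set_n_lists in_set_conv_nth simp del: read.simps)
  have "map_of (table (tm_of k K S code e)) (q, map read ts) =
      Some (tm_entry K code (q, map read ts))"
    using mem by (simp add: tm_of_def map_of_map_restrict restrict_map_def)
  moreover have "tm_entry K code (q, map read ts) =
      (snd (\<delta> (read (ts ! i))),
       map (\<lambda>j. if j = i then fst (\<delta> (read (ts ! i))) else (read (ts ! j), Stay)) [0..<K])"
    using assms by (auto simp: tm_entry_def)
  moreover have "map2 act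
      (map (\<lambda>j. if j = i then fst (\<delta> (read (ts ! i))) else (read (ts ! j), Stay)) [0..<K]) ts =
      ts[i := act (fst (\<delta> (read (ts ! i)))) (ts ! i)]"
    using assms by (auto simp: list_eq_iff_nth_eq act_read_Stay nth_list_update)
  ultimately show ?thesis by simp
qed

section \<open>Tapes as stacks, and correctness of the compiler\<close>

definition block :: "int \<Rightarrow> nat list \<Rightarrow> int \<Rightarrow> nat"
  where "block h w j = (if h \<le> j \<and> j < h + int (length w) then w ! nat (j - h) else 0)"

text \<open>A stack may drift along its two-way infinite tape, so its position \<open>h\<close> is
  left open. The output tape is pinned to cell 0, where \<open>contents\<close> starts
  reading.\<close>

definition implements :: "nat \<Rightarrow> nat \<Rightarrow> nat \<Rightarrow> (nat \<Rightarrow> nat list) \<Rightarrow> bool list \<Rightarrow> tape list \<Rightarrow> bool"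
  where "implements k K S s out ts \<longleftrightarrow> length ts = K \<and>
    (\<forall>i<K. i \<noteq> k \<longrightarrow> set (s i) \<subseteq> {0<..<S} \<and> (\<exists>h. ts ! i = (block h (s i), h))) \<and>
    ts ! k = (block 0 (map bit_sym out), int (length out))"

lemma block_at: "block h w h = peek w"
  by (cases w) (auto simp: block_def)

lemma block_push: "(block h w)(h - 1 := a) = block (h - 1) (a # w)"
  by (auto simp: block_def fun_eq_iff nth_Cons split: nat.splits)
    (metis Suc_nat_eq_nat_zadd1 add_diff_cancel_left' diff_add_cancel diff_ge_0_iff_ge diff_diff_eq2 diff_add_eq nat.inject)+

lemma block_pop: "(block h w)(h := 0) = block (h + 1) (tl w)"
proof (cases w)
  case (Cons a v)
  then show ?thesis
    using block_push[of "h + 1" v a] by (auto simp: fun_eq_iff block_def split: if_splits)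
qed (auto simp: block_def fun_eq_iff)

lemma block_emit: "(block 0 w)(int (length w) := a) = block 0 (w @ [a])"
  by (auto simp: block_def fun_eq_iff nth_append)

lemma implements_read:
  assumes "implements k K S s out ts" and "2 < S"
  shows "\<forall>j<K. read (ts ! j) < S"
proof (intro allI impI)
  fix j assume "j < K"
  show "read (ts ! j) < S"
  proof (cases "j = k")
    case True
    with assms show ?thesis by (auto simp: implements_def block_def)
  next
    case False
    with assms \<open>j < K\<close> obtain h where "ts ! j = (block h (s j), h)" "set (s j) \<subseteq> {0<..<S}"
      by (auto simp: implements_def)
    with \<open>2 < S\<close> show ?thesis by (cases "s j") (auto simp: block_at)
  qed
qed

definition code_at :: "instr list \<Rightarrow> nat \<Rightarrow> instr list \<Rightarrow> bool"
  where "code_at code q c \<longleftrightarrow> (\<exists>xs ys. code = xs @ c @ ys \<and> length xs = q)"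

lemma code_at_Cons: "code_at code q (x # c) \<longleftrightarrow> q < length code \<and> code ! q = x \<and> code_at code (Suc q) c"
proof
  assume "code_at code q (x # c)"
  then obtain xs ys where "code = xs @ x # c @ ys" "length xs = q"
    by (auto simp: code_at_def)
  then have "code = (xs @ [x]) @ c @ ys" "length (xs @ [x]) = Suc q" "q < length code" "code ! q = x"
    by auto
  then show "q < length code \<and> code ! q = x \<and> code_at code (Suc q) c"
    unfolding code_at_def by blast
next
  assume *: "q < length code \<and> code ! q = x \<and> code_at code (Suc q) c"
  then obtain xs ys where "code = xs @ c @ ys" "length xs = Suc q"
    by (auto simp: code_at_def)
  moreover from this obtain zs z where "xs = zs @ [z]"
    by (cases xs rule: rev_cases) auto
  ultimately have "code = zs @ (x # c) @ ys" "length zs = q"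
    using * by auto
  then show "code_at code q (x # c)"
    unfolding code_at_def by blast
qed

lemma code_at_append:
  "code_at code q (c @ c') \<Longrightarrow> code_at code q c \<and> code_at code (q + length c) c'"
  unfolding code_at_def by (metis append.assoc length_append)

lemma code_at_Switch:
  assumes "code_at code q (compile k S (Switch i f) q)" and "a < S"
  shows "code_at code (q + 1 + (\<Sum>r<a. code_size S (f r) + 1))
    (compile k S (f a) (q + 1 + (\<Sum>r<a. code_size S (f r) + 1)) @
      [goto i (\<lambda>_. q + code_size S (Switch i f))])"
proof -
  define c where "c = (\<lambda>a. compile k S (f a) (q + 1 + (\<Sum>r<a. code_size S (f r) + 1)) @
         [goto i (\<lambda>_. q + 1 + (\<Sum>r<S. code_size S (f r) + 1))])"
  have "[0..<S] = [0..<a] @ a # [Suc a..<S]"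
    using \<open>a < S\<close> by (metis less_imp_add_positive upt_add_eq_append upt_conv_Cons zero_le less_imp_le_nat le_add_diff_inverse)
  then have "concat (map c [0..<S]) = concat (map c [0..<a]) @ c a @ concat (map c [Suc a..<S])"
    by simp
  then have "code_at code (Suc q) (concat (map c [0..<a]) @ c a @ concat (map c [Suc a..<S]))"
    using assms by (simp add: code_at_Cons c_def)
  moreover have "length (concat (map c [0..<a])) = (\<Sum>r<a. code_size S (f r) + 1)"
    by (simp add: length_concat o_def c_def length_compile interv_sum_list_conv_sum_set_nat atLeast0LessThan)
  ultimately have "code_at code (Suc q + (\<Sum>r<a. code_size S (f r) + 1)) (c a)"
    using code_at_append[of code "Suc q"] code_at_append[of code _ "c a"] by metis
  then show ?thesis
    by (simp add: c_def)
qed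

lemma implements_update:
  assumes "implements k K S s out ts" "i < K" "i \<noteq> k" "set w \<subseteq> {0<..<S}"
  shows "implements k K S (s(i := w)) out (ts[i := (block h w, h)])"
  using assms by (auto simp: implements_def nth_list_update)

lemma implements_goto:
  assumes "implements k K S s out ts" "2 < S" "i < K" "q < length code" "code ! q = goto i f"
    "i \<noteq> k"
  shows "step (tm_of k K S code e) (q, ts) = (f (peek (s i)), ts)"
proof -
  from assms obtain h where h: "ts ! i = (block h (s i), h)" "length ts = K"
    by (auto simp: implements_def)
  then have "act (read (ts ! i), Stay) (ts ! i) = ts ! i"
    by (simp add: act_read_Stay del: act.simps read.simps)
  then show ?thesis
    using assms h step_tm_of[of q code i "\<lambda>a. ((a, Stay), f a)" K ts S k e] implements_read[OF assms(1,2)]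
    by (simp add: goto_def block_at list_update_same_conv)
qed

lemma funpow_reach: "(f ^^ m) x = y \<Longrightarrow> (f ^^ n) y = z \<Longrightarrow> (f ^^ (n + m)) x = z"
  by (simp add: funpow_add)

lemma funpow_between: "f x = y \<Longrightarrow> (f ^^ n) y = z \<Longrightarrow> f z = w \<Longrightarrow> (f ^^ (1 + (n + 1))) x = w"
  by (simp add: funpow_swap1)

text \<open>The induction is on the derivation of \<open>run\<close>, not on the program: each
  further round of a loop has a smaller derivation although its text is the same.\<close>

lemma run_compile:
  assumes "run p s t s' os" and "wf_prog k K S p" and "2 < S" and "k < K"
    and "code_at code q (compile k S p q)" and "implements k K S s out ts"
  shows "\<exists>n\<le>t. \<exists>ts'. (step (tm_of k K S code e) ^^ n) (q, ts) = (q + code_size S p, ts') \<and>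
    implements k K S s' (out @ os) ts'"
  using assms
proof (induction arbitrary: q out ts rule: run.induct)
  case (Skip s t)
  then show ?case by (auto intro!: exI[of _ 0])
next
  case (Push t i a s)
  let ?st = "step (tm_of k K S code e)"
  from Push.prems obtain h where h: "ts ! i = (block h (s i), h)" and K: "length ts = K" "i < K" "i \<noteq> k"
    and sub: "set (s i) \<subseteq> {0<..<S}"
    by (auto simp: implements_def)
  have code: "q < length code" "code ! q = (i, \<lambda>r. ((r, Left), q + 1))"
    "Suc q < length code" "code ! Suc q = (i, \<lambda>r. ((a, Stay), q + 2))"
    using Push.prems by (auto simp: code_at_Cons)
  have rd: "\<forall>j<K. read (ts ! j) < S"
    using implements_read Push.prems by blast
  define ts1 where "ts1 = ts[i := (block h (s i), h - 1)]"
  have 1: "?st (q, ts) = (Suc q, ts1)"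
    using step_tm_of[OF code(1,2) K(2,1) rd] h by (simp add: ts1_def)
  have "\<forall>j<K. read (ts1 ! j) < S"
    using rd K \<open>2 < S\<close> by (auto simp: ts1_def nth_list_update block_def)
  then have 2: "?st (Suc q, ts1) = (q + 2, ts[i := (block (h - 1) (a # s i), h - 1)])"
    using step_tm_of[OF code(3,4) K(2)] K by (simp add: ts1_def block_push)
  have "(?st ^^ 2) (q, ts) = (q + 2, ts[i := (block (h - 1) (a # s i), h - 1)])"
    using 1 2 by (simp add: numeral_2_eq_2)
  moreover have "implements k K S (s(i := a # s i)) out (ts[i := (block (h - 1) (a # s i), h - 1)])"
    using Push.prems K sub by (intro implements_update) auto
  ultimately show ?case using Push.hyps unfolding code_size.simps append_Nil2 by blast
next
  case (Pop t i s)
  let ?st = "step (tm_of k K S code e)"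
  from Pop.prems obtain h where h: "ts ! i = (block h (s i), h)" and K: "length ts = K" "i < K" "i \<noteq> k"
    and sub: "set (s i) \<subseteq> {0<..<S}"
    by (auto simp: implements_def)
  have code: "q < length code" "code ! q = (i, \<lambda>r. ((0, Right), q + 1))"
    using Pop.prems by (auto simp: code_at_Cons)
  have rd: "\<forall>j<K. read (ts ! j) < S"
    using implements_read Pop.prems by blast
  have "(?st ^^ 1) (q, ts) = (q + 1, ts[i := (block (h + 1) (tl (s i)), h + 1)])"
    using step_tm_of[OF code(1,2) K(2,1) rd] h by (simp add: block_pop)
  moreover have "implements k K S (s(i := tl (s i))) out (ts[i := (block (h + 1) (tl (s i)), h + 1)])"
    using Pop.prems K sub by (intro implements_update) (cases "s i"; auto)+
  ultimately show ?case using Pop.hyps unfolding code_size.simps append_Nil2 by blast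
next
  case (Emit t b s)
  let ?st = "step (tm_of k K S code e)"
  from Emit.prems have K: "length ts = K" "ts ! k = (block 0 (map bit_sym out), int (length out))"
    by (auto simp: implements_def)
  have code: "q < length code" "code ! q = (k, \<lambda>r. ((bit_sym b, Right), q + 1))"
    using Emit.prems by (auto simp: code_at_Cons)
  have rd: "\<forall>j<K. read (ts ! j) < S"
    using implements_read Emit.prems by blast
  have "(?st ^^ 1) (q, ts) =
      (q + 1, ts[k := (block 0 (map bit_sym (out @ [b])), int (length (out @ [b])))])"
    using step_tm_of[OF code(1,2) \<open>k < K\<close> K(1) rd] K block_emit[of "map bit_sym out"]
    by (simp add: add.commute)
  moreover have "implements k K S s (out @ [b])
      (ts[k := (block 0 (map bit_sym (out @ [b])), int (length (out @ [b])))])"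
    using Emit.prems K by (auto simp: implements_def nth_list_update)
  ultimately show ?case using Emit.hyps by (auto simp del: funpow.simps intro!: exI[of _ 1])
next
  case (Seq p s t1 s1 o1 p' t2 s2 o2 t)
  let ?st = "step (tm_of k K S code e)"
  from Seq.prems have code: "code_at code q (compile k S p q)"
    "code_at code (q + code_size S p) (compile k S p' (q + code_size S p))"
    using code_at_append[of code q "compile k S p q"] by (simp_all add: length_compile)
  from Seq.IH(1)[OF _ Seq.prems(2,3) code(1) Seq.prems(5)] Seq.prems(1) obtain n1 ts1 where
    1: "n1 \<le> t1" "(?st ^^ n1) (q, ts) = (q + code_size S p, ts1)" "implements k K S s1 (out @ o1) ts1"
    by auto
  from Seq.IH(2)[OF _ Seq.prems(2,3) code(2) 1(3)] Seq.prems(1) obtain n2 ts2 where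
    2: "n2 \<le> t2" "(?st ^^ n2) (q + code_size S p, ts1) = (q + code_size S p + code_size S p', ts2)"
      "implements k K S s2 ((out @ o1) @ o2) ts2"
    by auto
  have "(?st ^^ (n2 + n1)) (q, ts) = (q + code_size S (p ;; p'), ts2)"
    using funpow_reach[OF 1(2) 2(2)] by (simp add: add.assoc)
  moreover have "n2 + n1 \<le> t" using 1(1) 2(1) Seq.hyps by linarith
  ultimately show ?case using 2(3) by (auto simp del: funpow.simps)
next
  case (Switch f s i t1 s1 o1 t)
  let ?st = "step (tm_of k K S code e)"
  define a where "a = peek (s i)"
  define q1 where "q1 = q + 1 + (\<Sum>r<a. code_size S (f r) + 1)"
  have i: "i < K" "i \<noteq> k" and "set (s i) \<subseteq> {0<..<S}"
    using Switch.prems by (auto simp: implements_def)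
  then have "a < S" using \<open>2 < S\<close> by (cases "s i") (auto simp: a_def)
  from code_at_Switch[OF Switch.prems(4) this, folded q1_def]
  have "code_at code q1 (compile k S (f a) q1) \<and>
      code_at code (q1 + code_size S (f a)) [goto i (\<lambda>_. q + code_size S (Switch i f))]"
    using code_at_append[of code q1 "compile k S (f a) q1"] unfolding length_compile by blast
  then have code: "code_at code q1 (compile k S (f a) q1)"
    "q1 + code_size S (f a) < length code"
    "code ! (q1 + code_size S (f a)) = goto i (\<lambda>_. q + code_size S (Switch i f))"
    by (simp_all only: code_at_Cons)
  have 0: "?st (q, ts) = (q1, ts)"
    using implements_goto[OF Switch.prems(5,2) i(1) _ _ i(2)] Switch.prems(4)
    by (auto simp: code_at_Cons q1_def a_def)
  from Switch.IH[folded a_def, OF _ Switch.prems(2,3) code(1) Switch.prems(5)] Switch.prems(1) \<open>a < S\<close> obtain n ts1 where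
    1: "n \<le> t1" "(?st ^^ n) (q1, ts) = (q1 + code_size S (f a), ts1)" "implements k K S s1 (out @ o1) ts1"
    by auto
  have 2: "?st (q1 + code_size S (f a), ts1) = (q + code_size S (Switch i f), ts1)"
    using implements_goto[OF 1(3) Switch.prems(2) i(1) code(2,3) i(2)] by simp
  have "(?st ^^ (1 + (n + 1))) (q, ts) = (q + code_size S (Switch i f), ts1)"
    by (rule funpow_between[OF 0 1(2) 2])
  then show ?case using 1 Switch.hyps by (intro exI[of _ "1 + (n + 1)"]) auto
next
  case (While_False P s i t p)
  then have "step (tm_of k K S code e) (q, ts) = (q + code_size S (While i P p), ts)"
    using implements_goto[OF While_False.prems(5,2)] by (auto simp: code_at_Cons)
  with While_False show ?case by (auto intro!: exI[of _ 1])
next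
  case (While_True P s i p t1 s1 o1 t2 s2 o2 t)
  let ?st = "step (tm_of k K S code e)"
  have i: "i < K" "i \<noteq> k" using While_True.prems by auto
  have code: "code_at code (q + 1) (compile k S p (q + 1))"
    "q + 1 + code_size S p < length code" "code ! (q + 1 + code_size S p) = goto i (\<lambda>_. q)"
    using While_True.prems(4) code_at_append[of code "Suc q" "compile k S p (Suc q)" "[goto i (\<lambda>_. q)]"]
    by (simp_all add: length_compile code_at_Cons)
  have 0: "?st (q, ts) = (q + 1, ts)"
    using implements_goto[OF While_True.prems(5,2) i(1) _ _ i(2)] While_True.prems(4) While_True.hyps(1)
    by (auto simp: code_at_Cons)
  from While_True.IH(1)[OF _ While_True.prems(2,3) code(1) While_True.prems(5)] While_True.prems(1) obtain n1 ts1 where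
    1: "n1 \<le> t1" "(?st ^^ n1) (q + 1, ts) = (q + 1 + code_size S p, ts1)" "implements k K S s1 (out @ o1) ts1"
    by auto
  have 2: "?st (q + 1 + code_size S p, ts1) = (q, ts1)"
    using implements_goto[OF 1(3) While_True.prems(2) i(1) code(2,3) i(2)] by simp
  \<comment> \<open>The jump at the end of the body has restored address \<open>q\<close>, so the
    remaining rounds run on the same code.\<close>
  from While_True.IH(2)[OF While_True.prems(1-4) 1(3)] obtain n2 ts2 where
    3: "n2 \<le> t2" "(?st ^^ n2) (q, ts1) = (q + code_size S (While i P p), ts2)"
      "implements k K S s2 ((out @ o1) @ o2) ts2"
    by auto
  have "(?st ^^ (1 + (n1 + 1))) (q, ts) = (q, ts1)"
    by (rule funpow_between[OF 0 1(2) 2])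
  then have "(?st ^^ (n2 + (1 + (n1 + 1)))) (q, ts) = (q + code_size S (While i P p), ts2)"
    using 3(2) by (rule funpow_reach)
  then show ?case using 1 3 While_True.hyps by (intro exI[of _ "n2 + (1 + (n1 + 1))"]) auto
qed

section \<open>From stack programs to clocked machines\<close>

definition word_syms :: "bool list \<Rightarrow> nat list"
  where "word_syms w = map bit_sym w"

definition init :: "bool list list \<Rightarrow> nat \<Rightarrow> nat list"
  where "init ws i = (if i < length ws then word_syms (ws ! i) else [])"

lemma tape_of_block: "tape_of w = (block 0 (word_syms w), 0)"
  by (auto simp: tape_of_def block_def word_syms_def bit_sym_def fun_eq_iff)

lemma set_word_syms: "set (word_syms w) \<subseteq> {1, 2}"
  by (auto simp: word_syms_def bit_sym_def)

lemma contents_block: "contents (block 0 (map bit_sym w), h) = w"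
proof -
  have in_iff: "block 0 (map bit_sym w) (int i) \<in> {1, 2} \<longleftrightarrow> i < length w" for i
    by (simp add: block_def bit_sym_def)
  have "(LEAST i. block 0 (map bit_sym w) (int i) \<notin> {1, 2}) = length w"
    unfolding in_iff by (rule Least_equality) simp_all
  then have "contents (block 0 (map bit_sym w), h) =
      map (\<lambda>i. block 0 (map bit_sym w) (int i) = 2) [0..<length w]"
    by (simp only: contents.simps)
  also have "\<dots> = w"
    by (rule nth_equalityI) (simp_all add: block_def bit_sym_def)
  finally show ?thesis .
qed

text \<open>The polynomials \<open>n ^ e + e\<close> of the clocks are cofinal among all polynomial bounds.\<close>

definition poly_bounded :: "(nat \<Rightarrow> nat) \<Rightarrow> bool"
  where "poly_bounded f \<longleftrightarrow> (\<exists>e. \<forall>n. f n \<le> n ^ e + e)"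

definition computes ::
    "nat \<Rightarrow> (bool list list \<Rightarrow> bool) \<Rightarrow> machine \<Rightarrow> (bool list list \<Rightarrow> bool list) \<Rightarrow> bool"
  where "computes k Q M F \<longleftrightarrow> clocked_machine M \<and> inputs M = k \<and>
    (\<forall>ws. length ws = k \<longrightarrow> Q ws \<longrightarrow> out_of M ws = F ws)"

lemma computes_prog:
  assumes "wf_prog k K S p" and "2 < S" and "1 \<le> k" and "k < K" and "poly_bounded \<tau>"
    and run: "\<And>ws. length ws = k \<Longrightarrow> Q ws \<Longrightarrow> \<exists>s'. run p (init ws) (\<tau> (sum_list (map length ws))) s' (F ws)"
  shows "\<exists>M. computes k Q M F"
proof -
  obtain e where e: "\<And>n. \<tau> n \<le> n ^ e + e"
    using \<open>poly_bounded \<tau>\<close> by (auto simp: poly_bounded_def)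
  define code where "code = compile k S p 0"
  define M where "M = tm_of k K S code e"
  have "out_of M ws = F ws" if ws: "length ws = k" "Q ws" for ws
  proof -
    let ?n = "sum_list (map length ws)"
    note run = run[OF ws] and ws = ws(1)
    from run obtain s' where r: "run p (init ws) (\<tau> ?n) s' (F ws)" by blast
    let ?ts = "snd (start M ws)"
    have st: "start M ws = (0, ?ts)" by (simp add: start_def)
    have "code_at code 0 (compile k S p 0)"
      by (auto simp: code_at_def code_def)
    moreover have "implements k K S (init ws) [] ?ts"
      unfolding implements_def
    proof (intro conjI allI impI)
      fix i assume "i < K" "i \<noteq> k"
      show "set (init ws i) \<subseteq> {0<..<S}"
        using set_word_syms[of "ws ! i"] \<open>2 < S\<close> by (auto simp: init_def)
      show "\<exists>h. ?ts ! i = (block h (init ws i), h)"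
        using \<open>i < K\<close> ws
        by (auto simp: start_def M_def tm_of_def nth_append init_def tape_of_block word_syms_def)
    qed (use ws \<open>k < K\<close> in \<open>auto simp: start_def M_def tm_of_def nth_append tape_of_block word_syms_def\<close>)
    ultimately obtain n ts' where n: "n \<le> \<tau> ?n" "(step M ^^ n) (0, ?ts) = (code_size S p, ts')"
      "implements k K S s' (F ws) ts'"
      using run_compile[OF r assms(1,2,4), of code 0 "[]" ?ts e] by (auto simp: M_def)
    \<comment> \<open>The state behind the code is a halting state, so the rest of the clock changes
      nothing; an upper bound for the running time is enough.\<close>
    have "map_of (table M) (code_size S p, map read ts') = None"
      by (auto simp: M_def tm_of_def map_of_eq_None_iff code_def length_compile)
    then have halt: "step M (code_size S p, ts') = (code_size S p, ts')" by simp
    have fixed: "(step M ^^ m) (code_size S p, ts') = (code_size S p, ts')" for m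
      by (induction m) (auto simp: halt simp del: step.simps)
    have "n \<le> clock M ws"
      using n(1) e[of ?n] by (simp add: clock_def M_def tm_of_def Let_def)
    then have "(step M ^^ clock M ws) (start M ws) = (code_size S p, ts')"
      using funpow_reach[OF n(2) fixed, of "clock M ws - n"] st by simp
    then show ?thesis
      using n(3) by (simp add: out_of_def M_def tm_of_def implements_def contents_block del: contents.simps)
  qed
  moreover have "clocked_machine M" "inputs M = k"
    using clocked_machine_tm_of assms(3,4) by (auto simp: M_def) (simp add: tm_of_def)
  ultimately show ?thesis
    by (auto simp: computes_def)
qed

section \<open>Polynomial bounds, binary notation and basic programs\<close>

lemma n_le_two_power: "(n::nat) \<le> 2 ^ n"
  using less_exp[of n] by linarith

lemma poly_bounded_mono: "poly_bounded g \<Longrightarrow> (\<And>n. f n \<le> g n) \<Longrightarrow> poly_bounded f"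
  unfolding poly_bounded_def by (meson order.trans)

lemma poly_bounded_id: "poly_bounded (\<lambda>n. n)"
  unfolding poly_bounded_def by (rule exI[of _ 1]) auto

lemma poly_bounded_const: "poly_bounded (\<lambda>n. c)"
  unfolding poly_bounded_def by (rule exI[of _ c]) auto

text \<open>For \<open>n < 2\<close> powers do not grow and the additive term of
  \<open>n ^ e + e\<close> does the work; for larger \<open>n\<close> a factor 2 is paid for by one
  more exponent.\<close>

lemma poly_bounded_add:
  assumes "poly_bounded f" and "poly_bounded g"
  shows "poly_bounded (\<lambda>n. f n + g n)"
proof -
  obtain a b where a: "\<And>n. f n \<le> n ^ a + a" and b: "\<And>n. g n \<le> n ^ b + b"
    using assms by (auto simp: poly_bounded_def)
  have "f n + g n \<le> n ^ (a + b + 2) + (a + b + 2)" for n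
  proof (cases "n < 2")
    case True
    then consider "n = 0" | "n = 1" by linarith
    then show ?thesis
      using a[of n] b[of n] by cases (auto simp: power_0_left split: if_splits)
  next
    case False
    then have "n ^ a \<le> n ^ (a + b + 1)" "n ^ b \<le> n ^ (a + b + 1)"
      by (intro power_increasing; linarith)+
    moreover have "2 * n ^ (a + b + 1) \<le> n ^ (a + b + 2)"
      using False by auto
    ultimately show ?thesis using a[of n] b[of n] by linarith
  qed
  then show ?thesis unfolding poly_bounded_def by blast
qed

lemma poly_bounded_mult:
  assumes "poly_bounded f" and "poly_bounded g"
  shows "poly_bounded (\<lambda>n. f n * g n)"
proof -
  obtain a b where a: "\<And>n. f n \<le> n ^ a + a" and b: "\<And>n. g n \<le> n ^ b + b"
    using assms by (auto simp: poly_bounded_def)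
  \<comment> \<open>The product \<open>(a + 2) * (b + 2)\<close> dominates both
    \<open>(a + 1) * (b + 1)\<close>, the bound for \<open>n < 2\<close>, and the exponent
    \<open>a + b + 2\<close> arising for larger \<open>n\<close>.\<close>
  have "f n * g n \<le> n ^ ((a + 2) * (b + 2)) + (a + 2) * (b + 2)" for n
  proof (cases "n < 2")
    case True
    then have "n ^ a \<le> 1" "n ^ b \<le> 1" by (intro power_le_one; linarith)+
    then have "f n * g n \<le> (a + 1) * (b + 1)"
      using a[of n] b[of n] by (intro mult_le_mono) auto
    then show ?thesis by simp
  next
    case False
    have *: "n ^ c + c \<le> n ^ (c + 1)" for c
    proof -
      have "c \<le> 2 ^ c" by (rule n_le_two_power)
      also have "\<dots> \<le> n ^ c" using False by (intro power_mono) auto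
      finally have "n ^ c + c \<le> 2 * n ^ c" by simp
      also have "\<dots> \<le> n ^ (c + 1)" using False by simp
      finally show ?thesis .
    qed
    have "f n * g n \<le> n ^ (a + 1) * n ^ (b + 1)"
      using a[of n] b[of n] *[of a] *[of b] by (intro mult_le_mono) linarith+
    also have "\<dots> = n ^ (a + b + 2)" by (simp add: power_add)
    also have "\<dots> \<le> n ^ ((a + 2) * (b + 2))"
      using False by (intro power_increasing) auto
    finally show ?thesis by simp
  qed
  then show ?thesis unfolding poly_bounded_def by blast
qed

lemma poly_bounded_power:
  assumes "poly_bounded f" shows "poly_bounded (\<lambda>n. f n ^ c)"
  by (induction c) (auto intro: poly_bounded_const poly_bounded_mult assms)

lemma poly_bounded_Suc: "poly_bounded f \<Longrightarrow> poly_bounded (\<lambda>n. Suc (f n))"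
  using poly_bounded_add[OF _ poly_bounded_const[of 1]] by simp

lemma poly_bounded_compose:
  assumes "poly_bounded f" and "poly_bounded g"
  shows "poly_bounded (\<lambda>n. f (g n))"
proof -
  obtain a where a: "\<And>n. f n \<le> n ^ a + a"
    using assms by (auto simp: poly_bounded_def)
  have "poly_bounded (\<lambda>n. g n ^ a + a)"
    by (intro poly_bounded_add poly_bounded_power poly_bounded_const assms)
  then show ?thesis by (rule poly_bounded_mono) (rule a)
qed

lemmas poly_bounded_intros = poly_bounded_id poly_bounded_const poly_bounded_add
  poly_bounded_mult poly_bounded_power poly_bounded_Suc

text \<open>Composition needs a monotone time bound: of the arguments of an outer function only
  upper bounds for the lengths are known.\<close>

lemma poly_bounded_mono_bound:
  assumes "poly_bounded f"
  obtains g where "poly_bounded g" "mono g" "\<And>n. f n \<le> g n"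
proof -
  obtain e where "\<And>n. f n \<le> n ^ e + e"
    using assms by (auto simp: poly_bounded_def)
  moreover have "poly_bounded (\<lambda>n. n ^ e + e)"
    by (intro poly_bounded_intros)
  ultimately show ?thesis
    by (intro that[of "\<lambda>n. n ^ e + e"]) (auto intro!: monoI power_mono)
qed

section \<open>Binary notation\<close>

lemma num_of_Nil [simp]: "num_of [] = 0"
  and num_of_Cons [simp]: "num_of (b # w) = of_bool b + 2 * num_of w"
  by (simp_all add: num_of_def)

lemma bits_of_0 [simp]: "bits_of 0 = []"
  by (simp add: bits_of_def len_def floorlog_def)

lemma bits_of_pos: "0 < x \<Longrightarrow> bits_of x = odd x # bits_of (x div 2)"
proof -
  assume "0 < x"
  then have "len x = Suc (len (x div 2))"
    unfolding len_def by (subst compute_floorlog) auto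
  then show ?thesis
    unfolding bits_of_def by (simp only: map_upt_Suc) (simp add: bit_0 bit_Suc)
qed

lemma length_bits_of [simp]: "length (bits_of x) = len x"
  by (simp add: bits_of_def)

lemma num_of_bits_of [simp]: "num_of (bits_of x) = x"
proof (induction x rule: less_induct)
  case (less x)
  show ?case
  proof (cases "x = 0")
    case False
    then have "num_of (bits_of x) = of_bool (odd x) + 2 * (x div 2)"
      using less by (simp add: bits_of_pos)
    then show ?thesis by (auto simp: of_bool_def)
  qed simp
qed

lemma num_of_eq_0_iff: "num_of w = 0 \<longleftrightarrow> True \<notin> set w"
  by (induction w) auto

lemma bits_of_num_of: "w = [] \<or> last w \<Longrightarrow> bits_of (num_of w) = w"
proof (induction w)
  case (Cons b w)
  have "0 < num_of (b # w)"
    using Cons.prems last_in_set[of "b # w"] num_of_eq_0_iff[of "b # w"] by (metis gr0I list.distinct(1))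
  then have "bits_of (num_of (b # w)) = b # bits_of (num_of w)"
    by (subst bits_of_pos) (auto simp: of_bool_def)
  moreover have "w = [] \<or> last w" using Cons.prems by (auto split: if_splits)
  ultimately show ?case using Cons.IH by simp
qed simp

lemma last_bits_of: "bits_of x = [] \<or> last (bits_of x)"
proof (induction x rule: less_induct)
  case (less x)
  show ?case
  proof (cases "x = 0")
    case False
    show ?thesis
    proof (cases "x div 2 = 0")
      case True
      with False have "x = 1" by linarith
      then show ?thesis by (simp add: bits_of_pos)
    next
      case nz: False
      then have "bits_of (x div 2) \<noteq> []" using bits_of_pos[of "x div 2"] by simp
      then show ?thesis using False nz less[of "x div 2"] by (auto simp: bits_of_pos)
    qed
  qed simp
qed

lemma len_num_of: "last w \<Longrightarrow> w \<noteq> [] \<Longrightarrow> len (num_of w) = length w"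
  by (metis bits_of_num_of length_bits_of)

lemma len_mono: "x \<le> y \<Longrightarrow> len x \<le> len y"
  unfolding len_def by (rule floorlog_mono)

lemma bits_of_two_power: "bits_of (2 ^ n) = replicate n False @ [True]"
proof -
  have "num_of (replicate n False @ [True]) = 2 ^ n" by (induction n) auto
  then show ?thesis by (metis bits_of_num_of last_snoc)
qed

definition strip :: "bool list \<Rightarrow> bool list"
  where "strip w = rev (dropWhile Not (rev w))"

lemma strip_eq: "strip w = bits_of (num_of w)"
proof (induction w rule: rev_induct)
  case (snoc b w)
  show ?case
  proof (cases b)
    case True
    then show ?thesis by (simp add: strip_def bits_of_num_of)
  next
    case False
    have "num_of (w @ [False]) = num_of w" by (induction w) auto
    then show ?thesis using snoc False by (simp add: strip_def)
  qed
qed (simp add: strip_def)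

section \<open>Symbolic execution of loop-free programs, and loops with a known number of
  rounds\<close>

primrec straight :: "prog \<Rightarrow> bool"
  where
    "straight Skip \<longleftrightarrow> True"
  | "straight (Push i a) \<longleftrightarrow> True"
  | "straight (Pop i) \<longleftrightarrow> True"
  | "straight (Emit b) \<longleftrightarrow> True"
  | "straight (p ;; q) \<longleftrightarrow> straight p \<and> straight q"
  | "straight (Switch i f) \<longleftrightarrow> (\<forall>a. straight (f a))"
  | "straight (While i P p) \<longleftrightarrow> False"

text \<open>For loop-free programs the final stacks, the output and the cost are found by
  simplification; this is what \<open>run_straight\<close> exploits. The clauses for
  \<open>While\<close> are placeholders.\<close>

primrec effect :: "prog \<Rightarrow> (nat \<Rightarrow> nat list) \<Rightarrow> nat \<Rightarrow> nat list"
  where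
    "effect Skip = (\<lambda>s. s)"
  | "effect (Push i a) = (\<lambda>s. s(i := a # s i))"
  | "effect (Pop i) = (\<lambda>s. s(i := tl (s i)))"
  | "effect (Emit b) = (\<lambda>s. s)"
  | "effect (p ;; q) = (\<lambda>s. effect q (effect p s))"
  | "effect (Switch i f) = (\<lambda>s. effect (f (peek (s i))) s)"
  | "effect (While i P p) = (\<lambda>s. s)"

primrec emitted :: "prog \<Rightarrow> (nat \<Rightarrow> nat list) \<Rightarrow> bool list"
  where
    "emitted Skip = (\<lambda>s. [])"
  | "emitted (Push i a) = (\<lambda>s. [])"
  | "emitted (Pop i) = (\<lambda>s. [])"
  | "emitted (Emit b) = (\<lambda>s. [b])"
  | "emitted (p ;; q) = (\<lambda>s. emitted p s @ emitted q (effect p s))"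
  | "emitted (Switch i f) = (\<lambda>s. emitted (f (peek (s i))) s)"
  | "emitted (While i P p) = (\<lambda>s. [])"

primrec cost :: "prog \<Rightarrow> (nat \<Rightarrow> nat list) \<Rightarrow> nat"
  where
    "cost Skip = (\<lambda>s. 0)"
  | "cost (Push i a) = (\<lambda>s. 2)"
  | "cost (Pop i) = (\<lambda>s. 1)"
  | "cost (Emit b) = (\<lambda>s. 1)"
  | "cost (p ;; q) = (\<lambda>s. cost p s + cost q (effect p s))"
  | "cost (Switch i f) = (\<lambda>s. cost (f (peek (s i))) s + 2)"
  | "cost (While i P p) = (\<lambda>s. 0)"

lemma run_straight_exact: "straight p \<Longrightarrow> run p s (cost p s) (effect p s) (emitted p s)"
proof (induction p arbitrary: s)
  case (Switch i f)
  then show ?case by (auto intro!: run.Switch)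
next
  case (Seq p q)
  then show ?case by (auto intro!: run.Seq)
qed (auto intro: run.intros)

lemma run_mono: "run p s t s' os \<Longrightarrow> t \<le> t' \<Longrightarrow> run p s t' s' os"
proof (induction arbitrary: t' rule: run.induct)
  case (Switch f s i t1 s1 o1 t)
  then show ?case by (meson order.trans run.Switch order.refl)
next
  case (While_True P s i p t1 s1 o1 t2 s2 o2 t)
  then show ?case by (meson order.trans run.While_True order.refl)
next
  case (Seq p s t1 s1 o1 q t2 s2 o2 t)
  then show ?case by (meson order.trans run.Seq order.refl)
qed (auto intro: run.intros)

lemma run_straight:
  "straight p \<Longrightarrow> cost p s \<le> t \<Longrightarrow> effect p s = s' \<Longrightarrow> emitted p s = os \<Longrightarrow> run p s t s' os"
  using run_straight_exact run_mono by blast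

lemma run_SeqI:
  "run p s t1 s1 o1 \<Longrightarrow> run q s1 t2 s' o2 \<Longrightarrow> t1 + t2 \<le> t \<Longrightarrow> os = o1 @ o2 \<Longrightarrow> run (p ;; q) s t s' os"
  by (auto intro: run.Seq)

text \<open>The state after \<open>k\<close> rounds is \<open>\<sigma> k\<close>. Each round pays 2
  steps for the test and the jump back, and the failing test costs the final step. The induction is
  on the number of rounds still to come.\<close>

lemma run_While_iterate:
  assumes "\<And>k. k < n \<Longrightarrow> P (peek (\<sigma> k i)) \<and> run p (\<sigma> k) c (\<sigma> (Suc k)) (out k)"
    and "\<not> P (peek (\<sigma> n i))" and "n * (c + 2) + 1 \<le> t" and "os = concat (map out [0..<n])"
    and "s = \<sigma> 0" and "s' = \<sigma> n"
  shows "run (While i P p) s t s' os"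
proof -
  have "run (While i P p) (\<sigma> (n - m)) (m * (c + 2) + 1) (\<sigma> n) (concat (map out [n - m..<n]))"
    if "m \<le> n" for m
    using that
  proof (induction m)
    case 0
    then show ?case using assms(2) by (auto intro: run.intros)
  next
    case (Suc m)
    then have m: "Suc (n - Suc m) = n - m" "n - Suc m < n" by auto
    have "[n - Suc m..<n] = (n - Suc m) # [n - m..<n]"
      using m by (simp add: upt_conv_Cons)
    then show ?case
      using Suc assms(1)[OF m(2)] m by (auto intro!: run.While_True)
  qed
  from this[of n] show ?thesis
    using assms(3-6) by (auto intro: run_mono)
qed

abbreviation Loop :: "nat \<Rightarrow> prog \<Rightarrow> prog"
  where "Loop i p \<equiv> While i (\<lambda>a. a \<noteq> 0) p"

text \<open>Moving reverses a stack, so two moves through a scratch stack keep the order. The branch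
  for 0 is never entered inside the loop; it is there because \<open>wf_prog\<close> inspects every
  branch and forbids pushing 0.\<close>

definition move_prog :: "nat \<Rightarrow> nat \<Rightarrow> prog"
  where "move_prog i j = Loop i (Switch i (\<lambda>a. if a = 0 then Skip else Pop i ;; Push j a))"

lemma drop_nth: "k < length w \<Longrightarrow> drop k w = w ! k # drop (Suc k) w"
  by (simp add: Cons_nth_drop_Suc)

lemma nth_neq_0: "0 \<notin> set w \<Longrightarrow> k < length w \<Longrightarrow> w ! k \<noteq> (0::nat)"
  by (metis nth_mem)

lemma run_move:
  assumes "0 \<notin> set (s i)" and "i \<noteq> j" and "length (s i) * 7 + 1 \<le> t"
    and "s' = s(i := [], j := rev (s i) @ s j)"
  shows "run (move_prog i j) s t s' []"
  unfolding move_prog_def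
proof (rule run_While_iterate[where n = "length (s i)" and c = 5 and out = "\<lambda>_. []"
      and \<sigma> = "\<lambda>k. s(i := drop k (s i), j := rev (take k (s i)) @ s j)"])
  fix k assume "k < length (s i)"
  then show "peek ((s(i := drop k (s i), j := rev (take k (s i)) @ s j)) i) \<noteq> 0 \<and>
    run (Switch i (\<lambda>a. if a = 0 then Skip else Pop i ;; Push j a)) (s(i := drop k (s i), j := rev (take k (s i)) @ s j)) 5
      (s(i := drop (Suc k) (s i), j := rev (take (Suc k) (s i)) @ s j)) []"
    using assms
    by (auto simp: drop_nth nth_neq_0 take_Suc_conv_app_nth fun_eq_iff intro!: run_straight)
qed (use assms in \<open>auto simp: concat_eq_Nil_conv\<close>)

lemma wf_move_prog: "i < K \<Longrightarrow> j < K \<Longrightarrow> i \<noteq> k \<Longrightarrow> j \<noteq> k \<Longrightarrow> wf_prog k K S (move_prog i j)"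
  by (simp add: move_prog_def)

lemma zero_notin_word_syms [simp]: "0 \<notin> set (word_syms w)"
  using set_word_syms[of w] by auto

lemma length_word_syms [simp]: "length (word_syms w) = length w"
  by (simp add: word_syms_def)

lemma word_syms_simps [simp]: "word_syms [] = []" "word_syms (b # w) = bit_sym b # word_syms w"
  by (simp_all add: word_syms_def)

lemma bit_sym_simps [simp]: "bit_sym b \<noteq> 0" "0 < bit_sym b" "bit_sym b = 2 \<longleftrightarrow> b" "bit_sym b = 1 \<longleftrightarrow> \<not> b"
   "bit_sym b = Suc 0 \<longleftrightarrow> \<not> b"
  by (auto simp: bit_sym_def)

section \<open>Machines for constants, the order, and comparing and multiplying lengths\<close>

definition computes_num :: "nat \<Rightarrow> machine \<Rightarrow> (nat list \<Rightarrow> nat) \<Rightarrow> bool"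
  where "computes_num k M f \<longleftrightarrow> clocked_machine M \<and> inputs M = k \<and>
    (\<forall>xs. length xs = k \<longrightarrow> fun_of M xs = f xs)"

lemma computes_num_of_computes:
  assumes "computes k Q M F" and "\<And>xs. Q (map bits_of xs)"
    and "\<And>xs. length xs = k \<Longrightarrow> num_of (F (map bits_of xs)) = f xs"
  shows "computes_num k M f"
  using assms by (auto simp: computes_num_def computes_def fun_of_def)

definition emit_all :: "bool list \<Rightarrow> prog"
  where "emit_all w = foldr (\<lambda>b p. Emit b ;; p) w Skip"

lemma run_emit_all: "length w \<le> t \<Longrightarrow> run (emit_all w) s t s w"
proof (induction w arbitrary: t)
  case (Cons b w)
  then have "run (Emit b ;; emit_all w) s t s ([b] @ w)"
    by (intro run.Seq[where ?t1.0 = 1 and ?t2.0 = "t - 1"]) (auto intro: run.intros)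
  then show ?case by (simp add: emit_all_def)
qed (auto simp: emit_all_def intro: run.Skip)

lemma wf_emit_all: "wf_prog k K S (emit_all w)"
  by (induction w) (auto simp: emit_all_def)

lemma computes_const: "1 \<le> k \<Longrightarrow> \<exists>M. computes_num k M (\<lambda>_. c)"
proof -
  assume "1 \<le> k"
  then have "\<exists>M. computes k (\<lambda>_. True) M (\<lambda>_. bits_of c)"
    by (intro computes_prog[where K = "Suc k" and S = 3 and p = "emit_all (bits_of c)" and \<tau> = "\<lambda>_. len c"])
      (auto intro!: poly_bounded_const wf_emit_all run_emit_all exI)
  then show ?thesis using computes_num_of_computes by fastforce
qed

lemma length_2_conv: "length xs = 2 \<longleftrightarrow> (\<exists>a b. xs = [a, b])"
  by (cases xs; cases "tl xs") auto

text \<open>The flag \<open>f\<close> is the verdict on the low-order bits read so far; a differing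
  bit met later weighs more and overrides it.\<close>

fun less_word :: "bool \<Rightarrow> bool list \<Rightarrow> bool list \<Rightarrow> bool"
  where
    "less_word f [] [] = f"
  | "less_word f [] (b # v) = less_word (f \<or> b) [] v"
  | "less_word f (a # u) [] = less_word (f \<and> \<not> a) u []"
  | "less_word f (a # u) (b # v) = less_word (if a = b then f else b) u v"

lemma less_word_iff: "less_word f u v \<longleftrightarrow> num_of u < num_of v \<or> num_of u = num_of v \<and> f"
  by (induction f u v rule: less_word.induct) (auto simp: of_bool_def split: if_splits)

definition flag :: "bool \<Rightarrow> nat list"
  where "flag b = (if b then [2] else [])"

text \<open>The first phase lasts as long as the first number has bits; an exhausted second number
  shows 0, which counts as the bit 0. What is left of the second number is the business of
  \<open>less_loop2\<close>.\<close>

definition less_loop1 :: prog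
  where "less_loop1 = Loop 0 (Switch 0 (\<lambda>a. Switch 1 (\<lambda>b. Pop 0 ;; Pop 1 ;;
    (if (a = 2) = (b = 2) then Skip else if b = 2 then Pop 3 ;; Push 3 2 else Pop 3))))"

definition less_loop2 :: prog
  where "less_loop2 = Loop 1 (Switch 1 (\<lambda>b. Pop 1 ;; (if b = 2 then Pop 3 ;; Push 3 2 else Skip)))"

lemma run_less_loop2:
  "s 0 = [] \<Longrightarrow> s 1 = word_syms v \<Longrightarrow> s 3 = flag f \<Longrightarrow>
    run less_loop2 s (length v * 8 + 1) (s(1 := [], 3 := flag (less_word f [] v))) []"
proof (induction v arbitrary: s f)
  case Nil
  then show ?case
    unfolding less_loop2_def by (subst fun_upd_triv[symmetric]) (auto simp: fun_upd_idem intro: run.While_False)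
next
  case (Cons b v)
  let ?s1 = "s(1 := word_syms v, 3 := flag (f \<or> b))"
  have "run less_loop2 s (length (b # v) * 8 + 1) (?s1(1 := [], 3 := flag (less_word (f \<or> b) [] v))) ([] @ [])"
    unfolding less_loop2_def
  proof (rule run.While_True)
    show "run (Switch 1 (\<lambda>b. Pop 1 ;; (if b = 2 then Pop 3 ;; Push 3 2 else Skip))) s 6 ?s1 []"
      using Cons.prems by (intro run_straight) (auto simp: fun_eq_iff flag_def)
    show "run (While 1 (\<lambda>a. a \<noteq> 0) (Switch 1 (\<lambda>b. Pop 1 ;; (if b = 2 then Pop 3 ;; Push 3 2 else Skip)))) ?s1
     (length v * 8 + 1) (?s1(1 := [], 3 := flag (less_word (f \<or> b) [] v))) []"
      by (rule Cons.IH[unfolded less_loop2_def]) (use Cons.prems in auto)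
  qed (use Cons.prems in auto)
  moreover have "?s1(1 := [], 3 := flag (less_word (f \<or> b) [] v)) = s(1 := [], 3 := flag (less_word f [] (b # v)))"
    by (auto simp: fun_eq_iff)
  ultimately show ?case by (simp only: append_Nil)
qed

lemma run_less_loop1:
  "s 0 = word_syms u \<Longrightarrow> s 1 = word_syms v \<Longrightarrow> s 3 = flag f \<Longrightarrow>
    \<exists>s' v' f'. run less_loop1 s (length u * 11 + 1) s' [] \<and> s' 0 = [] \<and> s' 1 = word_syms v' \<and>
      s' 3 = flag f' \<and> length v' \<le> length v \<and> less_word f' [] v' = less_word f u v"
proof (induction u arbitrary: s f v)
  case Nil
  then show ?case
    unfolding less_loop1_def by (force intro: run.While_False)
next
  case (Cons a u)
  let ?v = "tl v" and ?b = "v \<noteq> [] \<and> hd v"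
  let ?f = "if a = ?b then f else ?b"
  let ?s1 = "s(0 := word_syms u, 1 := word_syms ?v, 3 := flag ?f)"
  obtain s' v' f' where IH: "run less_loop1 ?s1 (length u * 11 + 1) s' []" "s' 0 = []" "s' 1 = word_syms v'"
    "s' 3 = flag f'" "length v' \<le> length ?v" "less_word f' [] v' = less_word ?f u ?v"
    using Cons.IH[of ?s1 ?v ?f, OF refl[THEN trans] refl[THEN trans] refl[THEN trans]]
    by (force simp del: fun_upd_apply simp: fun_upd_same fun_upd_other)
  have "run less_loop1 s (length (a # u) * 11 + 1) s' ([] @ [])"
    unfolding less_loop1_def
  proof (rule run.While_True)
    show "run (Switch 0 (\<lambda>a. Switch 1 (\<lambda>b. Pop 0 ;; Pop 1 ;;
        (if (a = 2) = (b = 2) then Skip else if b = 2 then Pop 3 ;; Push 3 2 else Pop 3)))) s 9 ?s1 []"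
      using Cons.prems by (intro run_straight; cases v) (auto simp: fun_eq_iff flag_def)
    show "run (While 0 (\<lambda>a. a \<noteq> 0) (Switch 0 (\<lambda>a. Switch 1 (\<lambda>b. Pop 0 ;; Pop 1 ;;
        (if (a = 2) = (b = 2) then Skip else if b = 2 then Pop 3 ;; Push 3 2 else Pop 3))))) ?s1
      (length u * 11 + 1) s' []"
      using IH(1) unfolding less_loop1_def .
  qed (use Cons.prems in auto)
  moreover have "less_word ?f u ?v = less_word f (a # u) v"
    by (cases v) (auto simp del: less_word.simps simp: less_word.simps)
  ultimately show ?case using IH by (intro exI[of _ s'] exI[of _ v'] exI[of _ f']) auto
qed

lemma computes_less: "\<exists>M. computes_num 2 M (\<lambda>xs. of_bool (xs ! 0 < xs ! 1))"
proof -
  let ?p = "less_loop1 ;; less_loop2 ;; Switch 3 (\<lambda>c. if c = 2 then Emit True else Skip)"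
  let ?F = "\<lambda>ws. if less_word False (ws ! 0) (ws ! 1) then [True] else []"
  have "\<exists>M. computes 2 (\<lambda>_. True) M ?F"
  proof (rule computes_prog[where K = 4 and S = 3 and p = ?p and \<tau> = "\<lambda>n. n * 19 + 5"])
    show "wf_prog 2 4 3 ?p" by (auto simp: less_loop1_def less_loop2_def)
    show "poly_bounded (\<lambda>n. n * 19 + 5)" by (intro poly_bounded_intros)
    fix ws :: "bool list list" assume "length ws = 2"
    then obtain u v where ws: "ws = [u, v]" by (auto simp: length_2_conv)
    obtain s1 v' f' where 1: "run less_loop1 (init ws) (length u * 11 + 1) s1 []" "s1 0 = []"
      "s1 1 = word_syms v'" "s1 3 = flag f'" "length v' \<le> length v"
      "less_word f' [] v' = less_word False u v"
      using run_less_loop1[of "init ws" u v False] by (auto simp: ws init_def flag_def)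
    let ?s2 = "s1(1 := [], 3 := flag (less_word f' [] v'))"
    have 2: "run less_loop2 s1 (length v' * 8 + 1) ?s2 []"
      using run_less_loop2 1 by blast
    have 3: "run (Switch 3 (\<lambda>c. if c = 2 then Emit True else Skip)) ?s2 3 ?s2 (?F ws)"
      using 1 by (intro run_straight) (auto simp: flag_def ws)
    show "\<exists>s'. run ?p (init ws) (sum_list (map length ws) * 19 + 5) s' (?F ws)"
      by (rule exI, rule run_SeqI[OF 1(1) run_SeqI[OF 2 3]]) (use 1(5) in \<open>auto simp: ws\<close>)
  qed auto
  then show ?thesis
    by (elim ex_forward, elim computes_num_of_computes) (auto simp: less_word_iff length_2_conv)
qed

text \<open>Both words are popped in parallel. Every bit of the first word met after the second is
  exhausted leaves a mark on stack 3, and the output is 1 iff there is no mark.\<close>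

lemma computes_len_le: "\<exists>M. computes_num 2 M (\<lambda>xs. of_bool (len (xs ! 0) \<le> len (xs ! 1)))"
proof -
  let ?b = "Switch 1 (\<lambda>b. Pop 0 ;; (if b = 0 then Push 3 1 else Pop 1))"
  let ?p = "Loop 0 ?b ;; Switch 3 (\<lambda>c. if c = 0 then Emit True else Skip)"
  let ?F = "\<lambda>ws. if length (ws ! 0) \<le> length (ws ! 1) then [True] else []"
  have "\<exists>M. computes 2 (\<lambda>_. True) M ?F"
  proof (rule computes_prog[where K = 4 and S = 3 and p = ?p and \<tau> = "\<lambda>n. n * 7 + 4"])
    show "poly_bounded (\<lambda>n. n * 7 + 4)" by (intro poly_bounded_intros)
    fix ws :: "bool list list" assume "length ws = 2"
    then obtain u v where ws: "ws = [u, v]" by (auto simp: length_2_conv)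
    let ?\<sigma> = "\<lambda>k. (init ws)(0 := drop k (word_syms u), 1 := drop k (word_syms v),
      3 := replicate (k - length v) 1)"
    have 1: "run (Loop 0 ?b) (init ws) (length u * 7 + 1) (?\<sigma> (length u)) []"
    proof (rule run_While_iterate[where n = "length u" and c = 5 and out = "\<lambda>_. []" and \<sigma> = ?\<sigma>])
      fix k assume k: "k < length u"
      then have u: "drop k (word_syms u) = word_syms u ! k # drop (Suc k) (word_syms u)"
        "word_syms u ! k \<noteq> 0"
        by (auto simp: drop_nth nth_neq_0)
      show "peek (?\<sigma> k 0) \<noteq> 0 \<and> run ?b (?\<sigma> k) 5 (?\<sigma> (Suc k)) []"
      proof (cases "k < length v")
        case True
        then have "drop k (word_syms v) = word_syms v ! k # drop (Suc k) (word_syms v)"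
          "word_syms v ! k \<noteq> 0"
          by (auto simp: drop_nth nth_neq_0)
        then show ?thesis
          using u True by (auto simp: fun_eq_iff Suc_diff_le intro!: run_straight)
      next
        case False
        then show ?thesis
          using u by (auto simp: fun_eq_iff Suc_diff_le intro!: run_straight)
      qed
    qed (auto simp: concat_eq_Nil_conv ws init_def fun_eq_iff)
    have 2: "run (Switch 3 (\<lambda>c. if c = 0 then Emit True else Skip)) (?\<sigma> (length u)) 3 (?\<sigma> (length u)) (?F ws)"
      by (cases "length u - length v"; intro run_straight) (auto simp: ws)
    show "\<exists>s'. run ?p (init ws) (sum_list (map length ws) * 7 + 4) s' (?F ws)"
      by (rule exI, rule run_SeqI[OF 1 2]) (auto simp: ws)
  qed auto
  then show ?thesis
    by (elim ex_forward, elim computes_num_of_computes) (auto simp: length_2_conv)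
qed

text \<open>A number consisting of ones whose length is the product of two lengths. Its iteration
  yields lengths that are powers of a length, both for the bounds \<open>|t| \<le> |u| ^ c\<close>
  and for the number that forces elements of \<open>A\<close> to be long.\<close>

lemma computes_len_mult:
  "\<exists>M. computes_num 2 M (\<lambda>xs. num_of (replicate (len (xs ! 0) * len (xs ! 1)) True))"
proof -
  let ?b1 = "Pop 1 ;; Push 3 1 ;; Emit True"
  let ?b = "Pop 0 ;; Loop 1 ?b1 ;; move_prog 3 1"
  let ?p = "Loop 0 ?b"
  let ?F = "\<lambda>ws. replicate (length (ws ! 0) * length (ws ! 1)) True"
  have "\<exists>M. computes 2 (\<lambda>_. True) M ?F"
  proof (rule computes_prog[where K = 4 and S = 3 and p = ?p and \<tau> = "\<lambda>n. n * (n * 13 + 5) + 1"])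
    show "poly_bounded (\<lambda>n. n * (n * 13 + 5) + 1)" by (intro poly_bounded_intros)
    show "wf_prog 2 4 3 ?p" by (auto intro: wf_move_prog)
    fix ws :: "bool list list" assume "length ws = 2"
    then obtain u v where ws: "ws = [u, v]" by (auto simp: length_2_conv)
    let ?m = "length v" and ?n = "length u + length v"
    \<comment> \<open>From the first round on, stack 1 holds ones instead of the bits of
      \<open>v\<close>: only its height matters.\<close>
    define \<sigma> where "\<sigma> k = (init ws)(0 := drop k (word_syms u), 1 := if k = 0 then word_syms v else replicate ?m 1)"
      for k
    have len1: "length (\<sigma> k 1) = ?m" "0 \<notin> set (\<sigma> k 1)" "\<sigma> k 3 = []" for k
      by (auto simp: \<sigma>_def ws init_def)
    have inner: "run (Loop 1 ?b1) s (?m * 6 + 1) (s(1 := [], 3 := replicate ?m 1)) (replicate ?m True)"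
      if s: "length (s 1) = ?m" "0 \<notin> set (s 1)" "s 3 = []" for s
    proof (rule run_While_iterate[where n = ?m and c = 4 and out = "\<lambda>_. [True]"
          and \<sigma> = "\<lambda>k. s(1 := drop k (s 1), 3 := replicate k 1)"])
      fix k assume "k < ?m"
      then show "peek ((s(1 := drop k (s 1), 3 := replicate k 1)) 1) \<noteq> 0 \<and>
        run ?b1 (s(1 := drop k (s 1), 3 := replicate k 1)) 4
          (s(1 := drop (Suc k) (s 1), 3 := replicate (Suc k) 1)) [True]"
        using s by (auto simp: drop_nth nth_neq_0 fun_eq_iff intro!: run_straight)
    next
      show "replicate ?m True = concat (map (\<lambda>_. [True]) [0..<?m])"
        by (simp add: map_replicate_const)
    qed (use s in \<open>auto simp: fun_eq_iff\<close>)
    have step: "run ?b (\<sigma> k) (?m * 13 + 3) (\<sigma> (Suc k)) (replicate ?m True)" if k: "k < length u" for k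
    proof -
      let ?s1 = "(\<sigma> k)(0 := drop (Suc k) (word_syms u))"
      have 1: "run (Pop 0) (\<sigma> k) 1 ?s1 []"
        using k by (intro run_straight) (auto simp: \<sigma>_def drop_nth)
      have 2: "run (Loop 1 ?b1) ?s1 (?m * 6 + 1) (?s1(1 := [], 3 := replicate ?m 1)) (replicate ?m True)"
        using len1[of k] by (intro inner) auto
      have 3: "run (move_prog 3 1) (?s1(1 := [], 3 := replicate ?m 1)) (?m * 7 + 1) (\<sigma> (Suc k)) []"
        by (rule run_move) (auto simp: \<sigma>_def fun_eq_iff ws init_def)
      show ?thesis by (rule run_SeqI[OF 1 run_SeqI[OF 2 3]]) auto
    qed
    have "run ?p (init ws) (length u * (?m * 13 + 5) + 1) (\<sigma> (length u)) (?F ws)"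
    proof (rule run_While_iterate[where n = "length u" and \<sigma> = \<sigma> and c = "?m * 13 + 3"
          and out = "\<lambda>_. replicate ?m True"])
      have "concat (map (\<lambda>_. replicate m True) [0..<n]) = replicate (n * m) True" for m n
        by (induction n) (auto simp: replicate_add[symmetric] add.commute simp del: replicate_add)
      then show "?F ws = concat (map (\<lambda>_. replicate ?m True) [0..<length u])" by (simp add: ws)
      show "peek (\<sigma> k 0) \<noteq> 0 \<and> run ?b (\<sigma> k) (?m * 13 + 3) (\<sigma> (Suc k)) (replicate ?m True)"
        if "k < length u" for k
        using that step by (auto simp: \<sigma>_def drop_nth nth_neq_0)
    qed (auto simp: \<sigma>_def ws init_def fun_eq_iff)
    moreover have "length u * (?m * 13 + 5) + 1 \<le> ?n * (?n * 13 + 5) + 1"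
      by (intro add_mono mult_mono) auto
    ultimately show "\<exists>s'. run ?p (init ws) (sum_list (map length ws) * (sum_list (map length ws) * 13 + 5) + 1) s' (?F ws)"
      by (auto simp: ws intro: run_mono)
  qed auto
  then show ?thesis
    by (elim ex_forward, elim computes_num_of_computes) (auto simp: length_2_conv)
qed

section \<open>Simulating a machine on stacks\<close>

text \<open>
  A simulated tape is kept as two stacks, left and right of its head.  Symbols are shifted so that
  blanks can be pushed, and they carry a mark for cell 0, from where the output is read off.
\<close>

definition enc :: "nat \<Rightarrow> bool \<Rightarrow> nat"
  where "enc a f = Suc (2 * a + of_bool f)"

definition dec :: "nat \<Rightarrow> nat"
  where "dec c = (c - 1) div 2"

definition marked :: "nat \<Rightarrow> bool"
  where "marked c \<longleftrightarrow> c \<noteq> 0 \<and> even c"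

lemma enc_simps [simp]: "enc a f \<noteq> 0" "0 < enc a f" "dec (enc a f) = a" "marked (enc a f) = f"
  "dec 0 = 0" "\<not> marked 0"
  by (auto simp: enc_def dec_def marked_def)

definition cell :: "(int \<Rightarrow> nat) \<Rightarrow> int \<Rightarrow> nat"
  where "cell t i = enc (t i) (i = 0)"

text \<open>The stored window from \<open>lo\<close> to \<open>hi\<close> always contains cell 0, so
  the marked symbol is present on one of the two stacks. The head may stand just right of the
  window; then the right stack is empty and shows an unmarked blank.\<close>

fun zipper :: "tape \<Rightarrow> nat list \<Rightarrow> nat list \<Rightarrow> bool"
  where "zipper (t, h) L R \<longleftrightarrow> (\<exists>lo hi. lo \<le> 0 \<and> 0 \<le> hi \<and> lo \<le> h \<and> h \<le> hi + 1 \<and>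
    (\<forall>i. i < lo \<or> hi < i \<longrightarrow> t i = 0) \<and>
    L = map (cell t) (rev [lo..h - 1]) \<and> R = map (cell t) [h..hi])"

lemma zipperI:
  "lo \<le> 0 \<Longrightarrow> 0 \<le> hi \<Longrightarrow> lo \<le> h \<Longrightarrow> h \<le> hi + 1 \<Longrightarrow> (\<And>i. i < lo \<or> hi < i \<Longrightarrow> t i = 0) \<Longrightarrow>
    L = map (cell t) (rev [lo..h - 1]) \<Longrightarrow> R = map (cell t) [h..hi] \<Longrightarrow> zipper (t, h) L R"
  by auto

lemma zipper_peek:
  assumes "zipper (t, h) L R" shows "dec (peek R) = t h" "marked (peek R) \<longleftrightarrow> h = 0"
proof -
  from assms obtain lo hi where *: "lo \<le> 0" "0 \<le> hi" "h \<le> hi + 1" "\<forall>i. i < lo \<or> hi < i \<longrightarrow> t i = 0"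
    "R = map (cell t) [h..hi]" by auto
  have "dec (peek R) = t h \<and> (marked (peek R) \<longleftrightarrow> h = 0)"
    using * by (cases "h \<le> hi") (auto simp: upto_rec1 cell_def)
  then show "dec (peek R) = t h" "marked (peek R) \<longleftrightarrow> h = 0" by auto
qed

lemma zipper_nonzero: "zipper \<tau> L R \<Longrightarrow> 0 \<notin> set L \<and> 0 \<notin> set R"
  by (cases \<tau>) (auto simp: cell_def enc_def)

lemma zipper_write:
  assumes "zipper (t, h) L R"
  shows "zipper (t(h := a), h) L (enc a (marked (peek R)) # tl R)"
proof -
  from assms obtain lo hi where *: "lo \<le> 0" "0 \<le> hi" "lo \<le> h" "h \<le> hi + 1"
    "\<forall>i. i < lo \<or> hi < i \<longrightarrow> t i = 0" "L = map (cell t) (rev [lo..h - 1])" "R = map (cell t) [h..hi]"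
    by auto
  have m: "marked (peek R) \<longleftrightarrow> h = 0" using zipper_peek[OF assms] by simp
  let ?hi = "max hi h"
  have "enc a (marked (peek R)) # tl R = map (cell (t(h := a))) [h..?hi]"
  proof (cases "h \<le> hi")
    case True
    then show ?thesis using * m by (auto simp: upto_rec1[of h hi] cell_def max_def)
  next
    case False
    then show ?thesis using * m by (auto simp: cell_def max_def)
  qed
  moreover have "L = map (cell (t(h := a))) (rev [lo..h - 1])"
    using * by (auto simp: cell_def)
  ultimately show ?thesis
    using * by (intro zipperI[of lo ?hi]) auto
qed

lemma zipper_right:
  assumes "zipper (t, h) L (c # R)" shows "zipper (t, h + 1) (c # L) R"
proof -
  from assms obtain lo hi where *: "lo \<le> 0" "0 \<le> hi" "lo \<le> h" "h \<le> hi + 1"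
    "\<forall>i. i < lo \<or> hi < i \<longrightarrow> t i = 0" "L = map (cell t) (rev [lo..h - 1])" "c # R = map (cell t) [h..hi]"
    by auto
  have "h \<le> hi" using *(7) by (cases "h \<le> hi") auto
  then have "c = cell t h" "R = map (cell t) [h + 1..hi]"
    using *(7) by (auto simp: upto_rec1[of h hi])
  then show ?thesis
    using * \<open>h \<le> hi\<close> by (intro zipperI[of lo hi]) (auto simp: upto_rec2[of lo h])
qed

text \<open>The symbol 1 is \<open>enc 0 False\<close>, a fresh blank that extends the window to the
  left.\<close>

lemma zipper_left:
  assumes "zipper (t, h) L R"
  shows "zipper (t, h - 1) (tl L) ((if L = [] then 1 else hd L) # R)"
proof -
  from assms obtain lo hi where *: "lo \<le> 0" "0 \<le> hi" "lo \<le> h" "h \<le> hi + 1"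
    "\<forall>i. i < lo \<or> hi < i \<longrightarrow> t i = 0" "L = map (cell t) (rev [lo..h - 1])" "R = map (cell t) [h..hi]"
    by auto
  show ?thesis
  proof (cases "lo \<le> h - 1")
    case True
    then have "L = cell t (h - 1) # map (cell t) (rev [lo..h - 1 - 1])"
      using *(6) by (simp add: upto_rec2[of lo "h - 1"])
    moreover have "[h - 1..hi] = (h - 1) # [h..hi]"
      using * by (simp add: upto_rec1[of "h - 1" hi])
    ultimately show ?thesis
      using * True by (intro zipperI[of lo hi]) auto
  next
    case False
    then have "h = lo" using * by simp
    moreover have "cell t (lo - 1) = 1" using * by (auto simp: cell_def enc_def)
    moreover have "[lo - 1..hi] = (lo - 1) # [lo..hi]"
      using * by (simp add: upto_rec1[of "lo - 1" hi])
    ultimately show ?thesis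
      using * by (intro zipperI[of "lo - 1" hi]) auto
  qed
qed

fun act_left :: "nat \<times> move \<Rightarrow> nat list \<Rightarrow> nat list \<Rightarrow> nat list"
  where
    "act_left (a, Stay) L R = L"
  | "act_left (a, Right) L R = enc a (marked (peek R)) # L"
  | "act_left (a, Left) L R = tl L"

fun act_right :: "nat \<times> move \<Rightarrow> nat list \<Rightarrow> nat list \<Rightarrow> nat list"
  where
    "act_right (a, Stay) L R = enc a (marked (peek R)) # tl R"
  | "act_right (a, Right) L R = tl R"
  | "act_right (a, Left) L R = (if L = [] then 1 else hd L) # enc a (marked (peek R)) # tl R"

lemma zipper_act:
  assumes "zipper \<tau> L R" shows "zipper (act x \<tau>) (act_left x L R) (act_right x L R)"
proof -
  obtain a d t h where x: "x = (a, d)" "\<tau> = (t, h)" by (metis surj_pair)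
  note w = zipper_write[OF assms[unfolded x], of a]
  show ?thesis
    unfolding x using w zipper_right[OF w] zipper_left[OF w]
    by (cases d) (simp_all del: zipper.simps)
qed

text \<open>The stored window grows by a constant per step, so the clock bounds its size and hence
  the time for clearing the stacks at the end.\<close>

lemma length_act_lists:
  "length (act_left x L R) + length (act_right x L R) \<le> length L + length R + 2"
  by (cases "snd x"; cases x; cases L; cases R) auto

section \<open>Simulating one step, and then as many as the clock allows\<close>

definition tape_prog :: "nat \<Rightarrow> nat \<Rightarrow> nat \<times> move \<Rightarrow> prog"
  where "tape_prog l r x = Switch r (\<lambda>c. Pop r ;;
    (case x of
       (a, Stay) \<Rightarrow> Push r (enc a (marked c))
     | (a, Right) \<Rightarrow> Push l (enc a (marked c))
     | (a, Left) \<Rightarrow> Push r (enc a (marked c)) ;; Switch l (\<lambda>c. Pop l ;; Push r (if c = 0 then 1 else c))))"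

lemma run_tape_prog:
  assumes "l \<noteq> r" and "0 \<notin> set (s l)"
  shows "run (tape_prog l r x) s 10 (s(l := act_left x (s l) (s r), r := act_right x (s l) (s r))) []"
proof -
  obtain a d where "x = (a, d)" by (metis surj_pair)
  then show ?thesis
    using assms unfolding tape_prog_def
    by (cases d; cases "s l"; intro run_straight) (auto simp: fun_eq_iff)
qed

primrec acts_prog :: "nat \<Rightarrow> nat \<Rightarrow> (nat \<times> move) list \<Rightarrow> prog"
  where
    "acts_prog b j [] = Skip"
  | "acts_prog b j (x # xs) = tape_prog (b + 6 + 2 * j) (b + 7 + 2 * j) x ;; acts_prog b (Suc j) xs"

lemma run_acts_prog:
  assumes "\<And>k. j \<le> k \<Longrightarrow> k < j + length xs \<Longrightarrow> 0 \<notin> set (s (b + 6 + 2 * k))"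
  shows "\<exists>s'. run (acts_prog b j xs) s (length xs * 10) s' [] \<and>
    (\<forall>i. i < b + 6 + 2 * j \<or> b + 6 + 2 * (j + length xs) \<le> i \<longrightarrow> s' i = s i) \<and>
    (\<forall>k<length xs.
      s' (b + 6 + 2 * (j + k)) = act_left (xs ! k) (s (b + 6 + 2 * (j + k))) (s (b + 7 + 2 * (j + k))) \<and>
      s' (b + 7 + 2 * (j + k)) = act_right (xs ! k) (s (b + 6 + 2 * (j + k))) (s (b + 7 + 2 * (j + k))))"
  using assms
proof (induction xs arbitrary: j s)
  case Nil
  then show ?case by (auto intro: run.Skip)
next
  case (Cons x xs)
  let ?l = "b + 6 + 2 * j" and ?r = "b + 7 + 2 * j"
  let ?s1 = "s(?l := act_left x (s ?l) (s ?r), ?r := act_right x (s ?l) (s ?r))"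
  have 1: "run (tape_prog ?l ?r x) s 10 ?s1 []"
    using Cons.prems[of j] by (intro run_tape_prog) auto
  have "0 \<notin> set (?s1 (b + 6 + 2 * k))" if "Suc j \<le> k" "k < Suc j + length xs" for k
  proof -
    have "b + 6 + 2 * k \<noteq> ?l" "b + 6 + 2 * k \<noteq> ?r" using that by simp_all
    then show ?thesis using Cons.prems[of k] that by simp
  qed
  from Cons.IH[of "Suc j" ?s1, OF this] obtain s' where
    2: "run (acts_prog b (Suc j) xs) ?s1 (length xs * 10) s' []"
    and out: "\<And>i. i < b + 6 + 2 * Suc j \<or> b + 6 + 2 * (Suc j + length xs) \<le> i \<Longrightarrow> s' i = ?s1 i"
    and ins: "\<And>k. k < length xs \<Longrightarrow>
      s' (b + 6 + 2 * (Suc j + k)) = act_left (xs ! k) (?s1 (b + 6 + 2 * (Suc j + k))) (?s1 (b + 7 + 2 * (Suc j + k))) \<and>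
      s' (b + 7 + 2 * (Suc j + k)) = act_right (xs ! k) (?s1 (b + 6 + 2 * (Suc j + k))) (?s1 (b + 7 + 2 * (Suc j + k)))"
    by blast
  show ?case
  proof (intro exI conjI allI impI)
    show "run (acts_prog b j (x # xs)) s (length (x # xs) * 10) s' []"
      unfolding acts_prog.simps by (rule run_SeqI[OF 1 2]) auto
    show "s' i = s i" if "i < b + 6 + 2 * j \<or> b + 6 + 2 * (j + length (x # xs)) \<le> i" for i
      using out[of i] that by auto
    show "s' (b + 6 + 2 * (j + k)) = act_left ((x # xs) ! k) (s (b + 6 + 2 * (j + k))) (s (b + 7 + 2 * (j + k)))"
      "s' (b + 7 + 2 * (j + k)) = act_right ((x # xs) ! k) (s (b + 6 + 2 * (j + k))) (s (b + 7 + 2 * (j + k)))"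
      if "k < length (x # xs)" for k
    proof (atomize(full), cases k)
      case 0
      then show "s' (b + 6 + 2 * (j + k)) = act_left ((x # xs) ! k) (s (b + 6 + 2 * (j + k))) (s (b + 7 + 2 * (j + k))) \<and>
        s' (b + 7 + 2 * (j + k)) = act_right ((x # xs) ! k) (s (b + 6 + 2 * (j + k))) (s (b + 7 + 2 * (j + k)))"
        using out[of ?l] out[of ?r] by simp
    next
      case (Suc m)
      have "b + 6 + 2 * (Suc j + m) \<noteq> ?l" "b + 6 + 2 * (Suc j + m) \<noteq> ?r"
        "b + 7 + 2 * (Suc j + m) \<noteq> ?l" "b + 7 + 2 * (Suc j + m) \<noteq> ?r" by simp_all
      then have "?s1 (b + 6 + 2 * (Suc j + m)) = s (b + 6 + 2 * (Suc j + m))"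
        "?s1 (b + 7 + 2 * (Suc j + m)) = s (b + 7 + 2 * (Suc j + m))" by simp_all
      then show "s' (b + 6 + 2 * (j + k)) = act_left ((x # xs) ! k) (s (b + 6 + 2 * (j + k))) (s (b + 7 + 2 * (j + k))) \<and>
        s' (b + 7 + 2 * (j + k)) = act_right ((x # xs) ! k) (s (b + 6 + 2 * (j + k))) (s (b + 7 + 2 * (j + k)))"
        using ins[of m] that Suc by (simp del: fun_upd_apply)
    qed
  qed
qed

text \<open>The scanned symbols are collected in the control: the continuation \<open>f\<close>
  receives them as a list, so looking up the table of the simulated machine happens when the program
  is built.\<close>

primrec read_prog :: "nat \<Rightarrow> nat \<Rightarrow> nat \<Rightarrow> nat list \<Rightarrow> (nat list \<Rightarrow> prog) \<Rightarrow> prog"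
  where
    "read_prog b j 0 ss f = f ss"
  | "read_prog b j (Suc m) ss f = Switch (b + 7 + 2 * j) (\<lambda>c. read_prog b (Suc j) m (ss @ [dec c]) f)"

lemma run_read_prog:
  assumes "run (f (ss @ map (\<lambda>k. dec (peek (s (b + 7 + 2 * k)))) [j..<j + m])) s t s' os"
  shows "run (read_prog b j m ss f) s (t + 2 * m) s' os"
  using assms
proof (induction m arbitrary: j ss)
  case (Suc m)
  have "run (read_prog b (Suc j) m (ss @ [dec (peek (s (b + 7 + 2 * j)))]) f) s (t + 2 * m) s' os"
    using Suc.prems by (intro Suc.IH) (simp add: upt_conv_Cons del: upt_Suc)
  then show ?case by (auto intro!: run.Switch)
qed auto

text \<open>The state is stored as its successor because 0 cannot be pushed. A missing table entry
  becomes \<open>Skip\<close>, just as \<open>step\<close> leaves a halted configuration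
  alone.\<close>

definition step_prog :: "machine \<Rightarrow> nat \<Rightarrow> prog"
  where "step_prog M b = Switch (b + 5) (\<lambda>c. read_prog b 0 (tapes M) [] (\<lambda>ss.
    case map_of (table M) (c - 1, ss) of
      None \<Rightarrow> Skip
    | Some (q', xs) \<Rightarrow> Pop (b + 5) ;; Push (b + 5) (Suc q') ;; acts_prog b 0 xs))"

text \<open>
  Stacks of a simulation, relative to a base \<open>b\<close>: the result \<open>b\<close>, scratch \<open>b + 1\<close>, the remaining
  clock in unary \<open>b + 2\<close>, the total input length in unary \<open>b + 3\<close>, scratch \<open>b + 4\<close>, the state
  \<open>b + 5\<close>, the halves \<open>b + 6 + 2 * j\<close> and \<open>b + 7 + 2 * j\<close> of tape \<open>j\<close>.  The inputs are passed on the
  right halves.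
\<close>

definition simulates :: "machine \<Rightarrow> nat \<Rightarrow> (nat \<Rightarrow> nat list) \<Rightarrow> nat \<Rightarrow> nat \<Rightarrow> (nat \<Rightarrow> nat list) \<Rightarrow> config \<Rightarrow> bool"
  where "simulates M b s0 B c s C \<longleftrightarrow>
    (\<forall>i<b. s i = s0 i) \<and> s b = [] \<and> s (b + 1) = [] \<and> s (b + 2) = replicate c 1 \<and>
    s (b + 3) = [] \<and> s (b + 4) = [] \<and> s (b + 5) = [Suc (fst C)] \<and> length (snd C) = tapes M \<and>
    (\<forall>j<tapes M. zipper (snd C ! j) (s (b + 6 + 2 * j)) (s (b + 7 + 2 * j)) \<and>
      length (s (b + 6 + 2 * j)) + length (s (b + 7 + 2 * j)) \<le> B) \<and>
    (\<forall>i\<ge>b + 6 + 2 * tapes M. s i = [])"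

lemma simulates_step:
  assumes "clocked_machine M" and sim: "simulates M b s0 B c s C"
  shows "\<exists>s'. run (step_prog M b) s (12 * tapes M + 5) s' [] \<and> simulates M b s0 (B + 2) c s' (step M C)"
proof -
  obtain q ts where C: "C = (q, ts)" by (metis surj_pair)
  have len: "length ts = tapes M" using sim by (auto simp: simulates_def C)
  have zip: "zipper (ts ! j) (s (b + 6 + 2 * j)) (s (b + 7 + 2 * j))"
    "length (s (b + 6 + 2 * j)) + length (s (b + 7 + 2 * j)) \<le> B" if "j < tapes M" for j
    using sim that by (auto simp: simulates_def C)
  have read: "map (\<lambda>k. dec (peek (s (b + 7 + 2 * k)))) [0..<tapes M] = map read ts"
  proof (rule nth_equalityI)
    fix j assume "j < length (map (\<lambda>k. dec (peek (s (b + 7 + 2 * k)))) [0..<tapes M])"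
    then have "j < tapes M" by simp
    then show "map (\<lambda>k. dec (peek (s (b + 7 + 2 * k)))) [0..<tapes M] ! j = map read ts ! j"
      using zip(1)[of j] len zipper_peek(1)[of "fst (ts ! j)" "snd (ts ! j)"]
      by (cases "ts ! j") (simp del: zipper.simps)
  qed (simp add: len)
  have Q: "s (b + 5) = [Suc q]" using sim by (auto simp: simulates_def C)
  let ?f = "\<lambda>ss. case map_of (table M) (q, ss) of
      None \<Rightarrow> Skip
    | Some (q', xs) \<Rightarrow> Pop (b + 5) ;; Push (b + 5) (Suc q') ;; acts_prog b 0 xs"
  have "\<exists>s'. run (?f (map read ts)) s (10 * tapes M + 3) s' [] \<and> simulates M b s0 (B + 2) c s' (step M C)"
  proof (cases "map_of (table M) (q, map read ts)")
    case None
    moreover have "simulates M b s0 (B + 2) c s C"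
      using sim unfolding simulates_def by (auto simp del: zipper.simps intro: le_SucI)
    ultimately show ?thesis by (auto simp: C intro: run.Skip)
  next
    case (Some y)
    obtain q' xs where y: "y = (q', xs)" by (metis surj_pair)
    have lenx: "length xs = tapes M"
      using \<open>clocked_machine M\<close> map_of_SomeD[OF Some] by (auto simp: clocked_machine_def y)
    let ?s1 = "s(b + 5 := [Suc q'])"
    have 1: "run (Pop (b + 5)) s 1 (s(b + 5 := [])) []"
      by (rule run_straight) (auto simp: Q)
    have 2: "run (Push (b + 5) (Suc q')) (s(b + 5 := [])) 2 ?s1 []"
      by (rule run_straight) auto
    have "0 \<notin> set (?s1 (b + 6 + 2 * k))" if "k < 0 + length xs" for k
      using zipper_nonzero[OF zip(1)[of k]] that lenx by simp
    from run_acts_prog[of 0 xs ?s1 b, OF this, unfolded add_0 mult_0_right add_0_right] obtain s' where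
      3: "run (acts_prog b 0 xs) ?s1 (length xs * 10) s' []"
      and out: "\<And>i. i < b + 6 \<or> b + 6 + 2 * length xs \<le> i \<Longrightarrow> s' i = ?s1 i"
      and ins: "\<And>k. k < length xs \<Longrightarrow>
        s' (b + 6 + 2 * k) = act_left (xs ! k) (?s1 (b + 6 + 2 * k)) (?s1 (b + 7 + 2 * k)) \<and>
        s' (b + 7 + 2 * k) = act_right (xs ! k) (?s1 (b + 6 + 2 * k)) (?s1 (b + 7 + 2 * k))"
      by blast
    have "run (?f (map read ts)) s (10 * tapes M + 3) s' []"
      unfolding Some y option.case prod.case by (rule run_SeqI[OF 1 run_SeqI[OF 2 3]]) (auto simp: lenx)
    moreover have "simulates M b s0 (B + 2) c s' (step M C)"
    proof -
      have st: "step M C = (q', map2 act xs ts)" by (simp add: C Some y)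
      have "zipper (map2 act xs ts ! j) (s' (b + 6 + 2 * j)) (s' (b + 7 + 2 * j)) \<and>
          length (s' (b + 6 + 2 * j)) + length (s' (b + 7 + 2 * j)) \<le> B + 2" if j: "j < tapes M" for j
        using ins[of j] zipper_act[OF zip(1)[OF j], of "xs ! j"] zip(2)[OF j] j lenx len
          length_act_lists[of "xs ! j" "s (b + 6 + 2 * j)" "s (b + 7 + 2 * j)"]
        by (simp del: zipper.simps)
      moreover have "s' b = s b" "s' (b + 1) = s (b + 1)" "s' (b + 2) = s (b + 2)" "s' (b + 3) = s (b + 3)"
        "s' (b + 4) = s (b + 4)" "s' (b + 5) = [Suc q']"
        using out[of b] out[of "b + 1"] out[of "b + 2"] out[of "b + 3"] out[of "b + 4"] out[of "b + 5"]
        by simp_all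
      moreover have "\<forall>i<b. s' i = s i" "\<forall>i\<ge>b + 6 + 2 * tapes M. s' i = s i"
        using out lenx by auto
      ultimately show ?thesis
        using sim[unfolded simulates_def C] lenx len
        unfolding st simulates_def by (simp del: zipper.simps)
    qed
    ultimately show ?thesis by blast
  qed
  then obtain s' where s': "run (?f (map read ts)) s (10 * tapes M + 3) s' []"
    "simulates M b s0 (B + 2) c s' (step M C)" by blast
  have "run (read_prog b 0 (tapes M) [] ?f) s (10 * tapes M + 3 + 2 * tapes M) s' []"
    using s'(1) by (intro run_read_prog) (simp add: read)
  then have "run (step_prog M b) s (12 * tapes M + 5) s' []"
    unfolding step_prog_def by (intro run.Switch) (auto simp: Q)
  with s'(2) show ?thesis by blast
qed

lemma simulates_loop:
  assumes "clocked_machine M" and "simulates M b s0 B c s C"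
  shows "\<exists>s'. run (Loop (b + 2) (Pop (b + 2) ;; step_prog M b)) s (c * (12 * tapes M + 8) + 1) s' [] \<and>
    simulates M b s0 (B + 2 * c) 0 s' ((step M ^^ c) C)"
  using assms(2)
proof (induction c arbitrary: s B C)
  case 0
  then have "run (Loop (b + 2) (Pop (b + 2) ;; step_prog M b)) s 1 s []"
    by (intro run.While_False) (auto simp: simulates_def)
  with 0 show ?case by auto
next
  case (Suc c)
  have c: "s (b + 2) = replicate (Suc c) 1" using Suc.prems by (auto simp: simulates_def)
  let ?s1 = "s(b + 2 := replicate c 1)"
  have 1: "run (Pop (b + 2)) s 1 ?s1 []" using c by (intro run_straight) simp_all
  have "simulates M b s0 B c ?s1 C" using Suc.prems unfolding simulates_def by simp
  from simulates_step[OF assms(1) this] obtain s2 where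
    2: "run (step_prog M b) ?s1 (12 * tapes M + 5) s2 []" "simulates M b s0 (B + 2) c s2 (step M C)"
    by blast
  have body: "run (Pop (b + 2) ;; step_prog M b) s (12 * tapes M + 6) s2 []"
    by (rule run_SeqI[OF 1 2(1)]) auto
  from Suc.IH[OF 2(2)] obtain s3 where
    3: "run (Loop (b + 2) (Pop (b + 2) ;; step_prog M b)) s2 (c * (12 * tapes M + 8) + 1) s3 []"
      "simulates M b s0 (B + 2 + 2 * c) 0 s3 ((step M ^^ c) (step M C))" by blast
  have "run (Loop (b + 2) (Pop (b + 2) ;; step_prog M b)) s (Suc c * (12 * tapes M + 8) + 1) s3 ([] @ [])"
    by (rule run.While_True[OF _ body 3(1)]) (use c in simp_all)
  moreover have "simulates M b s0 (B + 2 * Suc c) 0 s3 ((step M ^^ Suc c) C)"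
    using 3(2) by (simp add: funpow_swap1)
  ultimately show ?case by auto
qed

text \<open>The first assumption makes the loop stop, either at the blank shown by the empty stack
  or at a symbol that is present. The second case serves the search for the mark of cell 0, which
  the blank 0 does not end.\<close>

lemma run_pop_while:
  assumes "\<not> P 0 \<or> (\<exists>a\<in>set (s i). \<not> P a)" and "length (s i) * 3 + 1 \<le> t"
    and "s' = s(i := dropWhile P (s i))"
  shows "run (While i P (Pop i)) s t s' []"
proof -
  have "run (While i P (Pop i)) s (length w * 3 + 1) (s(i := dropWhile P w)) []"
    if "\<not> P 0 \<or> (\<exists>a\<in>set w. \<not> P a)" "s i = w" for w s
    using that
  proof (induction w arbitrary: s)
    case Nil
    then show ?case by (auto simp: fun_upd_idem intro: run.While_False)
  next
    case (Cons a w)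
    show ?case
    proof (cases "P a")
      case True
      have 1: "run (Pop i) s 1 (s(i := w)) []" using Cons.prems by (intro run_straight) auto
      have "run (While i P (Pop i)) (s(i := w)) (length w * 3 + 1) ((s(i := w))(i := dropWhile P w)) []"
        using Cons.prems True by (intro Cons.IH) auto
      then have 2: "run (While i P (Pop i)) (s(i := w)) (length w * 3 + 1) (s(i := dropWhile P (a # w))) []"
        using True by (simp only: dropWhile.simps if_True fun_upd_upd)
      show ?thesis
        by (rule run.While_True[OF _ 1 2, unfolded append_Nil]) (use True Cons.prems in auto)
    next
      case False
      then show ?thesis using Cons.prems by (auto simp: fun_upd_idem intro: run.While_False)
    qed
  qed
  from this[of "s i" s] show ?thesis using assms by (auto intro: run_mono)
qed

lemma run_transfer:
  assumes "\<not> P 0" and "i \<noteq> j" and "length (s i) * 7 + 1 \<le> t"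
    and "s' = s(i := dropWhile P (s i), j := rev (map f (takeWhile P (s i))) @ s j)"
  shows "run (While i P (Switch i (\<lambda>a. Pop i ;; Push j (f a)))) s t s' []"
proof -
  let ?p = "Switch i (\<lambda>a. Pop i ;; Push j (f a))"
  have "run (While i P ?p) s (length w * 7 + 1) (s(i := dropWhile P w, j := rev (map f (takeWhile P w)) @ s j)) []"
    if "s i = w" for w s
    using that
  proof (induction w arbitrary: s)
    case Nil
    then show ?case using assms by (auto simp: fun_upd_idem intro: run.While_False)
  next
    case (Cons a w)
    show ?case
    proof (cases "P a")
      case True
      let ?s1 = "s(i := w, j := f a # s j)"
      have 1: "run ?p s 5 ?s1 []"
        using Cons.prems assms by (intro run_straight) auto
      have 2: "run (While i P ?p) ?s1 (length w * 7 + 1)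
          (?s1(i := dropWhile P w, j := rev (map f (takeWhile P w)) @ ?s1 j)) []"
        using assms by (intro Cons.IH) auto
      have "?s1(i := dropWhile P w, j := rev (map f (takeWhile P w)) @ ?s1 j) =
          s(i := dropWhile P (a # w), j := rev (map f (takeWhile P (a # w))) @ s j)"
        using True assms by (auto simp: fun_eq_iff)
      note 2 = 2[unfolded this]
      show ?thesis
        by (rule run.While_True[OF _ 1 2, unfolded append_Nil]) (use True Cons.prems in auto)
    next
      case False
      then show ?thesis using Cons.prems assms by (auto simp: fun_upd_idem intro: run.While_False)
    qed
  qed
  from this[OF refl] show ?thesis using assms by (auto intro: run_mono)
qed

section \<open>Loading the inputs and winding up the clock\<close>

definition load_list :: "bool list \<Rightarrow> nat list"
  where "load_list w = (case w of [] \<Rightarrow> [enc 0 True]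
    | b # v \<Rightarrow> enc (bit_sym b) True # map (\<lambda>b. enc (bit_sym b) False) v)"

lemma zipper_load_list: "zipper (tape_of w) [] (load_list w)"
proof (cases w)
  case Nil
  have "load_list w = map (cell (\<lambda>_. 0)) [0..0]"
    by (simp add: Nil load_list_def cell_def)
  then show ?thesis
    unfolding tape_of_def by (intro zipperI[of 0 0]) (auto simp: Nil cell_def)
next
  case (Cons b v)
  let ?t = "fst (tape_of w)"
  have "load_list w = map (cell ?t) [0..int (length v)]"
  proof (rule nth_equalityI)
    fix i assume "i < length (load_list w)"
    then have "i \<le> length v" by (simp add: Cons load_list_def)
    then show "load_list w ! i = map (cell ?t) [0..int (length v)] ! i"
      by (cases i) (auto simp: Cons load_list_def tape_of_def cell_def bit_sym_def nth_upto nat_add_distrib)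
  qed (simp add: Cons load_list_def)
  then show ?thesis
    unfolding tape_of_def by (intro zipperI[of 0 "int (length v)"]) (auto simp: Cons cell_def)
qed

lemma length_load_list: "length (load_list w) \<le> Suc (length w)"
  by (cases w) (auto simp: load_list_def)

text \<open>The word goes to scratch while its length is counted in unary, comes back encoded and in
  the original order, and its top symbol is marked as cell 0; an empty word becomes a marked blank.
  The case distinctions map every symbol to a legal one, as \<open>wf_prog\<close> demands of all
  branches.\<close>

definition load_prog :: "nat \<Rightarrow> nat \<Rightarrow> prog"
  where "load_prog b j = (let r = b + 7 + 2 * j in
    Loop r (Switch r (\<lambda>a. if a = 0 then Skip else Pop r ;; Push (b + 1) a ;; Push (b + 3) 1)) ;;
    Loop (b + 1) (Switch (b + 1) (\<lambda>a. Pop (b + 1) ;; Push r (enc (if a = 2 then 2 else 1) False))) ;;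
    Switch r (\<lambda>a. Pop r ;; Push r (enc (if a = 0 then 0 else if a = enc 2 False then 2 else 1) True)))"

lemma run_load_prog:
  assumes r: "r = b + 7 + 2 * j" and "s r = word_syms w" and "s (b + 1) = []"
  shows "run (load_prog b j) s (length w * 16 + 7)
    (s(r := load_list w, b + 3 := replicate (length w) 1 @ s (b + 3))) []"
proof -
  let ?W = "word_syms w"
  let ?\<sigma> = "\<lambda>k. s(r := drop k ?W, b + 1 := rev (take k ?W), b + 3 := replicate k 1 @ s (b + 3))"
  have neq: "r \<noteq> b + 1" "r \<noteq> b + 3" "r \<noteq> Suc b" using r by auto
  have 1: "run (Loop r (Switch r (\<lambda>a. if a = 0 then Skip else Pop r ;; Push (b + 1) a ;; Push (b + 3) 1))) s (length w * 9 + 1) (?\<sigma> (length w)) []"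
  proof (rule run_While_iterate[where n = "length w" and c = 7 and out = "\<lambda>_. []" and \<sigma> = ?\<sigma>])
    fix k assume k: "k < length w"
    then have "drop k ?W = ?W ! k # drop (Suc k) ?W" "?W ! k \<noteq> 0" "take (Suc k) ?W = take k ?W @ [?W ! k]"
      by (auto simp: drop_nth nth_neq_0 take_Suc_conv_app_nth)
    then show "peek (?\<sigma> k r) \<noteq> 0 \<and> run (Switch r (\<lambda>a. if a = 0 then Skip else Pop r ;; Push (b + 1) a ;; Push (b + 3) 1)) (?\<sigma> k) 7 (?\<sigma> (Suc k)) []"
      using neq by (auto simp: fun_eq_iff intro!: run_straight)
  qed (use assms neq in \<open>auto simp: fun_eq_iff\<close>)
  let ?s2 = "s(r := map (\<lambda>b. enc (bit_sym b) False) w, b + 3 := replicate (length w) 1 @ s (b + 3))"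
  have W: "dropWhile ((<) 0) (rev ?W) = []" "takeWhile ((<) 0) (rev ?W) = rev ?W"
    using zero_notin_word_syms[of w] by (auto simp: takeWhile_eq_all_conv simp del: zero_notin_word_syms intro: gr0I)
  have "map (\<lambda>a. enc (if a = 2 then 2 else 1) False) ?W = map (\<lambda>b. enc (bit_sym b) False) w"
    by (simp add: word_syms_def bit_sym_def)
  then have 2: "run (Loop (b + 1) (Switch (b + 1) (\<lambda>a. Pop (b + 1) ;; Push r (enc (if a = 2 then 2 else 1) False)))) (?\<sigma> (length w)) (length w * 7 + 1) ?s2 []"
    using neq assms by (intro run_transfer) (simp_all add: W fun_eq_iff rev_map[symmetric])
  have 3: "run (Switch r (\<lambda>a. Pop r ;; Push r (enc (if a = 0 then 0 else if a = enc 2 False then 2 else 1) True))) ?s2 5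
      (s(r := load_list w, b + 3 := replicate (length w) 1 @ s (b + 3))) []"
    using neq by (cases w; intro run_straight) (auto simp: fun_eq_iff load_list_def bit_sym_def enc_def)
  show ?thesis
    unfolding load_prog_def Let_def r[symmetric] by (rule run_SeqI[OF 1 run_SeqI[OF 2 3]]) auto
qed

primrec load_all :: "nat \<Rightarrow> nat \<Rightarrow> prog"
  where
    "load_all b 0 = Skip"
  | "load_all b (Suc m) = load_all b m ;; load_prog b m"

lemma run_load_all:
  assumes "\<And>j. j < m \<Longrightarrow> s (b + 7 + 2 * j) = word_syms (W j)" and "s (b + 1) = []" and "s (b + 3) = []"
  shows "\<exists>s'. run (load_all b m) s ((\<Sum>j<m. length (W j)) * 16 + 7 * m) s' [] \<and>
    (\<forall>j<m. s' (b + 7 + 2 * j) = load_list (W j)) \<and>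
    s' (b + 3) = replicate (\<Sum>j<m. length (W j)) 1 \<and>
    (\<forall>i. i \<noteq> b + 3 \<and> (\<forall>j<m. i \<noteq> b + 7 + 2 * j) \<longrightarrow> s' i = s i)"
  using assms(1)
proof (induction m)
  case 0
  then show ?case using assms by (auto intro: run.Skip)
next
  case (Suc m)
  then obtain s1 where 1: "run (load_all b m) s ((\<Sum>j<m. length (W j)) * 16 + 7 * m) s1 []"
    and R: "\<And>j. j < m \<Longrightarrow> s1 (b + 7 + 2 * j) = load_list (W j)"
    and N: "s1 (b + 3) = replicate (\<Sum>j<m. length (W j)) 1"
    and oth: "\<And>i. i \<noteq> b + 3 \<Longrightarrow> (\<And>j. j < m \<Longrightarrow> i \<noteq> b + 7 + 2 * j) \<Longrightarrow> s1 i = s i"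
    by auto
  let ?r = "b + 7 + 2 * m"
  have "s1 ?r = word_syms (W m)" using Suc.prems oth[of ?r] by auto
  moreover have "s1 (b + 1) = []" using oth[of "b + 1"] assms by auto
  ultimately have 2: "run (load_prog b m) s1 (length (W m) * 16 + 7)
      (s1(?r := load_list (W m), b + 3 := replicate (length (W m)) 1 @ s1 (b + 3))) []"
    by (intro run_load_prog) auto
  show ?case
  proof (intro exI conjI allI impI)
    show "run (load_all b (Suc m)) s ((\<Sum>j<Suc m. length (W j)) * 16 + 7 * Suc m)
      (s1(?r := load_list (W m), b + 3 := replicate (length (W m)) 1 @ s1 (b + 3))) []"
      unfolding load_all.simps by (rule run_SeqI[OF 1 2]) auto
  qed (use R N oth in \<open>auto simp: less_Suc_eq replicate_add[symmetric] add.commute\<close>)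
qed

definition mul_prog :: "nat \<Rightarrow> prog"
  where "mul_prog b = Loop (b + 2) (Pop (b + 2) ;;
      Loop (b + 3) (Pop (b + 3) ;; Push (b + 1) 1 ;; Push (b + 4) 1) ;; move_prog (b + 1) (b + 3)) ;;
    move_prog (b + 4) (b + 2)"

lemma run_mul_prog:
  assumes "s (b + 2) = replicate c 1" "s (b + 3) = replicate n 1" "s (b + 1) = []" "s (b + 4) = []"
  shows "run (mul_prog b) s (c * (21 * n + 5) + 2) (s(b + 2 := replicate (c * n) 1)) []"
proof -
  let ?in = "Loop (b + 3) (Pop (b + 3) ;; Push (b + 1) 1 ;; Push (b + 4) 1)"
  let ?body = "Pop (b + 2) ;; ?in ;; move_prog (b + 1) (b + 3)"
  let ?\<sigma> = "\<lambda>k. s(b + 2 := replicate (c - k) 1, b + 4 := replicate (k * n) 1)"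
  have body: "run ?body (?\<sigma> k) (14 * n + 3) (?\<sigma> (Suc k)) []" if k: "k < c" for k
  proof -
    let ?s1 = "s(b + 2 := replicate (c - Suc k) 1, b + 4 := replicate (k * n) 1)"
    let ?\<rho> = "\<lambda>m. s(b + 2 := replicate (c - Suc k) 1, b + 3 := replicate (n - m) 1,
      b + 1 := replicate m 1, b + 4 := replicate (k * n + m) 1)"
    have 1: "run (Pop (b + 2)) (?\<sigma> k) 1 ?s1 []"
      using k by (intro run_straight) (auto simp: fun_eq_iff)
    have 2: "run ?in ?s1 (n * 7 + 1) (?\<rho> n) []"
    proof (rule run_While_iterate[where n = n and c = 5 and out = "\<lambda>_. []" and \<sigma> = ?\<rho>])
      fix m assume "m < n"
      then have "n - m = Suc (n - Suc m)" by simp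
      then show "peek (?\<rho> m (b + 3)) \<noteq> 0 \<and>
          run (Pop (b + 3) ;; Push (b + 1) 1 ;; Push (b + 4) 1) (?\<rho> m) 5 (?\<rho> (Suc m)) []"
        by (auto simp: fun_eq_iff intro!: run_straight)
    qed (use assms in \<open>auto simp: fun_eq_iff\<close>)
    have 3: "run (move_prog (b + 1) (b + 3)) (?\<rho> n) (n * 7 + 1) (?\<sigma> (Suc k)) []"
      using assms by (intro run_move) (auto simp: fun_eq_iff add.commute)
    show ?thesis by (rule run_SeqI[OF 1 run_SeqI[OF 2 3]]) auto
  qed
  have 1: "run (Loop (b + 2) ?body) s (c * (14 * n + 5) + 1) (?\<sigma> c) []"
  proof (rule run_While_iterate[where n = c and c = "14 * n + 3" and out = "\<lambda>_. []" and \<sigma> = ?\<sigma>])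
    fix k assume k: "k < c"
    then have "peek (?\<sigma> k (b + 2)) \<noteq> 0" by (cases "c - k") auto
    with body[OF k] show "peek (?\<sigma> k (b + 2)) \<noteq> 0 \<and> run ?body (?\<sigma> k) (14 * n + 3) (?\<sigma> (Suc k)) []"
      by blast
  qed (use assms in \<open>auto simp: fun_eq_iff\<close>)
  have 2: "run (move_prog (b + 4) (b + 2)) (?\<sigma> c) (c * n * 7 + 1) (s(b + 2 := replicate (c * n) 1)) []"
    using assms by (intro run_move) (auto simp: fun_eq_iff)
  show ?thesis
    unfolding mul_prog_def by (rule run_SeqI[OF 1 2]) (auto simp: algebra_simps)
qed

text \<open>The clock is wound up in unary, which is affordable because its value is polynomial; the
  simulation then pops one symbol per simulated step.\<close>

primrec pow_prog :: "nat \<Rightarrow> nat \<Rightarrow> prog"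
  where
    "pow_prog b 0 = Push (b + 2) 1"
  | "pow_prog b (Suc e) = pow_prog b e ;; mul_prog b"

lemma run_pow_prog:
  assumes "s (b + 2) = []" "s (b + 3) = replicate n 1" "s (b + 1) = []" "s (b + 4) = []"
  shows "run (pow_prog b e) s (2 + (\<Sum>i<e. n ^ i * (21 * n + 5) + 2)) (s(b + 2 := replicate (n ^ e) 1)) []"
proof (induction e)
  case 0
  then show ?case using assms by (auto intro!: run_straight)
next
  case (Suc e)
  have "run (mul_prog b) (s(b + 2 := replicate (n ^ e) 1)) (n ^ e * (21 * n + 5) + 2)
      ((s(b + 2 := replicate (n ^ e) 1))(b + 2 := replicate (n ^ e * n) 1)) []"
    using assms by (intro run_mul_prog) auto
  then have 2: "run (mul_prog b) (s(b + 2 := replicate (n ^ e) 1)) (n ^ e * (21 * n + 5) + 2)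
      (s(b + 2 := replicate (n ^ Suc e) 1)) []"
    by (simp only: fun_upd_upd power_Suc2)
  show ?case unfolding pow_prog.simps by (rule run_SeqI[OF Suc 2]) auto
qed

primrec push_ones :: "nat \<Rightarrow> nat \<Rightarrow> prog"
  where
    "push_ones i 0 = Skip"
  | "push_ones i (Suc m) = push_ones i m ;; Push i 1"

lemma run_push_ones: "run (push_ones i m) s (2 * m) (s(i := replicate m 1 @ s i)) []"
proof (induction m)
  case 0
  then show ?case by (auto intro: run.Skip)
next
  case (Suc m)
  have 2: "run (Push i 1) (s(i := replicate m 1 @ s i)) 2 (s(i := replicate (Suc m) 1 @ s i)) []"
    by (rule run_straight) auto
  show ?case unfolding push_ones.simps by (rule run_SeqI[OF Suc 2]) auto
qed

definition init_prog :: "machine \<Rightarrow> nat \<Rightarrow> prog"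
  where "init_prog M b = load_all b (tapes M) ;; pow_prog b (clock_exp M) ;;
    push_ones (b + 2) (clock_exp M) ;; Loop (b + 3) (Pop (b + 3)) ;; Push (b + 5) 1"

definition init_time :: "machine \<Rightarrow> nat \<Rightarrow> nat"
  where "init_time M n = n * 16 + 7 * tapes M + (2 + (\<Sum>i<clock_exp M. n ^ i * (21 * n + 5) + 2)) +
    2 * clock_exp M + (n * 3 + 1) + 2"

lemma run_init_prog:
  assumes "clocked_machine M" and ws: "length ws = inputs M"
    and inp: "\<And>j. j < inputs M \<Longrightarrow> s (b + 7 + 2 * j) = word_syms (ws ! j)"
    and emp: "\<And>i. b \<le> i \<Longrightarrow> (\<And>j. j < inputs M \<Longrightarrow> i \<noteq> b + 7 + 2 * j) \<Longrightarrow> s i = []"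
    and n: "n = sum_list (map length ws)"
  shows "\<exists>s'. run (init_prog M b) s (init_time M n) s' [] \<and>
    simulates M b s (n + 1) (clock M ws) s' (start M ws)"
proof -
  \<comment> \<open>Work tapes and the output tape are loaded as if they held the empty word: each
    of them needs its marked cell 0 as well.\<close>
  define W where "W j = (if j < inputs M then ws ! j else [])" for j
  have k: "inputs M < tapes M" using assms(1) by (auto simp: clocked_machine_def)
  have len_le: "length (W j) \<le> n" for j
    using ws by (auto simp: W_def n intro!: member_le_sum_list)
  have sumW: "(\<Sum>j<tapes M. length (W j)) = n"
  proof -
    have "(\<Sum>j<tapes M. length (W j)) = (\<Sum>j<inputs M. length (W j))"
      using k by (intro sum.mono_neutral_right) (auto simp: W_def)
    also have "\<dots> = n"
      using ws by (simp add: n sum_list_sum_nth W_def atLeast0LessThan)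
    finally show ?thesis .
  qed
  have "s (b + 7 + 2 * j) = word_syms (W j)" for j
    using inp[of j] emp[of "b + 7 + 2 * j"] by (auto simp: W_def)
  moreover have "s (b + 1) = []" "s (b + 3) = []"
    using emp[of "b + 1"] emp[of "b + 3"] by auto
  ultimately obtain s1 where
    1: "run (load_all b (tapes M)) s (n * 16 + 7 * tapes M) s1 []"
    and R: "\<And>j. j < tapes M \<Longrightarrow> s1 (b + 7 + 2 * j) = load_list (W j)"
    and N: "s1 (b + 3) = replicate n 1"
    and oth: "\<And>i. i \<noteq> b + 3 \<Longrightarrow> (\<And>j. j < tapes M \<Longrightarrow> i \<noteq> b + 7 + 2 * j) \<Longrightarrow> s1 i = s i"
    using run_load_all[of "tapes M" s b W] unfolding sumW by metis
  have e1: "s1 i = []" if "b \<le> i" "i \<noteq> b + 3" "\<And>j. j < tapes M \<Longrightarrow> i \<noteq> b + 7 + 2 * j" for i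
    using oth[OF that(2,3)] emp[OF that(1)] that(3) k by simp
  let ?e = "clock_exp M"
  let ?s2 = "s1(b + 2 := replicate (n ^ ?e) 1)"
  let ?s3 = "?s2(b + 2 := replicate ?e 1 @ ?s2 (b + 2))"
  let ?s4 = "?s3(b + 3 := [])"
  let ?s5 = "?s4(b + 5 := [1])"
  have 2: "run (pow_prog b ?e) s1 (2 + (\<Sum>i<?e. n ^ i * (21 * n + 5) + 2)) ?s2 []"
    using N by (intro run_pow_prog e1) auto
  have 3: "run (push_ones (b + 2) ?e) ?s2 (2 * ?e) ?s3 []"
    by (rule run_push_ones)
  have 4: "run (Loop (b + 3) (Pop (b + 3))) ?s3 (n * 3 + 1) ?s4 []"
    using N by (intro run_pop_while) (auto simp: fun_eq_iff)
  have 5: "run (Push (b + 5) 1) ?s4 2 ?s5 []"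
    using e1[of "b + 5"] by (intro run_straight) auto
  have "run (init_prog M b) s (init_time M n) ?s5 []"
    unfolding init_prog_def
    by (rule run_SeqI[OF 1 run_SeqI[OF 2 run_SeqI[OF 3 run_SeqI[OF 4 5 order.refl] order.refl] order.refl]])
      (auto simp: init_time_def)
  moreover have "simulates M b s (n + 1) (clock M ws) ?s5 (start M ws)"
    unfolding simulates_def
  proof (intro conjI allI impI)
    show "?s5 i = s i" if "i < b" for i using that oth[of i] by auto
    show "?s5 b = []" "?s5 (b + 1) = []" "?s5 (b + 4) = []" "?s5 (b + 3) = []"
      using e1[of b] e1[of "b + 1"] e1[of "b + 4"] by auto
    show "?s5 (b + 2) = replicate (clock M ws) 1"
      by (auto simp: clock_def Let_def n[symmetric] replicate_add[symmetric] add.commute)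
    show "?s5 (b + 5) = [Suc (fst (start M ws))]" by (simp add: start_def)
    show "length (snd (start M ws)) = tapes M" using k ws by (simp add: start_def)
    fix j assume j: "j < tapes M"
    have L: "?s5 (b + 6 + 2 * j) = []"
    proof -
      have "b + 6 + 2 * j \<noteq> b + 7 + 2 * j'" for j' by presburger
      then show ?thesis using e1[of "b + 6 + 2 * j"] by simp
    qed
    have R': "?s5 (b + 7 + 2 * j) = load_list (W j)" using R[OF j] by simp
    have "snd (start M ws) ! j = tape_of (W j)"
      using j ws by (auto simp: start_def nth_append W_def)
    then show "zipper (snd (start M ws) ! j) (?s5 (b + 6 + 2 * j)) (?s5 (b + 7 + 2 * j))"
      unfolding L R' using zipper_load_list by simp
    show "length (?s5 (b + 6 + 2 * j)) + length (?s5 (b + 7 + 2 * j)) \<le> n + 1"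
      unfolding L R' using length_load_list[of "W j"] len_le[of j] by simp
  next
    show "?s5 i = []" if "b + 6 + 2 * tapes M \<le> i" for i
    proof -
      have "i \<noteq> b + 7 + 2 * j" if "j < tapes M" for j
        using that \<open>b + 6 + 2 * tapes M \<le> i\<close> by presburger
      then show ?thesis using that e1[of i] by auto
    qed
  qed
  ultimately show ?thesis by blast
qed

primrec clear_range :: "nat \<Rightarrow> nat \<Rightarrow> prog"
  where
    "clear_range b 0 = Skip"
  | "clear_range b (Suc m) = clear_range b m ;; Loop (b + m) (Pop (b + m))"

lemma run_clear_range:
  assumes "\<And>i. b \<le> i \<Longrightarrow> i < b + m \<Longrightarrow> 0 \<notin> set (s i) \<and> length (s i) \<le> B"
  shows "run (clear_range b m) s (m * (3 * B + 1)) (\<lambda>i. if b \<le> i \<and> i < b + m then [] else s i) []"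
  using assms
proof (induction m)
  case 0
  have "(\<lambda>i. if b \<le> i \<and> i < b + 0 then [] else s i) = s" by (rule ext) auto
  then show ?case by (simp only: clear_range.simps run.Skip)
next
  case (Suc m)
  let ?s1 = "\<lambda>i. if b \<le> i \<and> i < b + m then [] else s i"
  have 1: "run (clear_range b m) s (m * (3 * B + 1)) ?s1 []" using Suc by auto
  have bm: "0 \<notin> set (s (b + m))" "length (s (b + m)) \<le> B" using Suc.prems[of "b + m"] by auto
  then have W: "dropWhile ((<) 0) (s (b + m)) = []" by (auto intro: gr0I)
  have 2: "run (Loop (b + m) (Pop (b + m))) ?s1 (3 * B + 1)
      (\<lambda>i. if b \<le> i \<and> i < b + Suc m then [] else s i) []"
    using bm by (intro run_pop_while) (auto simp: W fun_eq_iff)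
  show ?case unfolding clear_range.simps by (rule run_SeqI[OF 1 2]) auto
qed

text \<open>With the left half moved over, stack \<open>r\<close> holds the whole window; dropping
  symbols up to the mark discards the cells left of cell 0. The bits arrive on \<open>b + 1\<close>
  in reverse, so leading zeros, coded by 1, are on top and can be popped. The last move restores the
  order.\<close>

definition finish_prog :: "machine \<Rightarrow> nat \<Rightarrow> prog"
  where "finish_prog M b = (let l = b + 6 + 2 * inputs M; r = b + 7 + 2 * inputs M in
    move_prog l r ;;
    While r (\<lambda>a. \<not> marked a) (Pop r) ;;
    While r (\<lambda>a. dec a = 1 \<or> dec a = 2) (Switch r (\<lambda>a. Pop r ;; Push (b + 1) (if dec a = 2 then 2 else 1))) ;;
    While (b + 1) (\<lambda>a. a = 1) (Pop (b + 1)) ;;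
    clear_range (b + 5) (1 + 2 * tapes M) ;;
    move_prog (b + 1) b)"

lemma zipper_contents:
  assumes "zipper \<tau> L R"
  defines "X \<equiv> rev L @ R"
  defines "Y \<equiv> dropWhile (\<lambda>a. \<not> marked a) X"
  shows "\<exists>a\<in>set X. marked a"
    and "map (\<lambda>a. if dec a = 2 then 2 else 1) (takeWhile (\<lambda>a. dec a = 1 \<or> dec a = 2) Y) =
      word_syms (contents \<tau>)"
proof -
  obtain t h where \<tau>: "\<tau> = (t, h)" by (metis surj_pair)
  from assms(1)[unfolded \<tau>] obtain lo hi where *: "lo \<le> 0" "0 \<le> hi" "lo \<le> h" "h \<le> hi + 1"
    "\<forall>i. i < lo \<or> hi < i \<longrightarrow> t i = 0" "L = map (cell t) (rev [lo..h - 1])" "R = map (cell t) [h..hi]"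
    by auto
  have "[lo..hi] = [lo..h - 1] @ [h..hi]"
    using * by (cases "h = hi + 1") (auto intro: upto_split1)
  then have X: "X = map (cell t) [lo..hi]"
    unfolding X_def *(6,7) by (simp add: rev_map)
  have "cell t 0 \<in> set X" "marked (cell t 0)" using * by (auto simp: X) (simp add: cell_def)
  then show "\<exists>a\<in>set X. marked a" by blast
  have "[lo..hi] = [lo..0 - 1] @ [0..hi]" using * by (intro upto_split1) auto
  then have Y: "Y = map (cell t) [0..hi]"
    using * unfolding Y_def X
    by (simp only: map_append) (subst dropWhile_append2; auto simp: cell_def upto_rec1[of 0 hi])
  define m where "m = (LEAST i. t (int i) \<notin> {1, 2})"
  \<comment> \<open>The cell right of the window is blank, so the block of bits ends there at the
    latest and the least index exists.\<close>
  have "t (int (nat (hi + 1))) \<notin> {1, 2}" using * by simp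
  then have m: "t (int m) \<notin> {1, 2}" "m \<le> nat (hi + 1)" "\<And>i. i < m \<Longrightarrow> t (int i) \<in> {1, 2}"
    unfolding m_def by (rule LeastI, rule Least_le, metis not_less_Least)
  have up: "[0..hi] = map int [0..<nat (hi + 1)]"
    by (rule nth_equalityI) (use * in \<open>auto simp: nth_upto\<close>)
  have tw: "takeWhile (\<lambda>i. t (int i) = 1 \<or> t (int i) = 2) [0..<nat (hi + 1)] = [0..<m]"
  proof (cases "m = nat (hi + 1)")
    case True
    then show ?thesis using m(3) by (auto simp: takeWhile_eq_all_conv)
  next
    case False
    then have "[0..<nat (hi + 1)] = [0..<m] @ m # [Suc m..<nat (hi + 1)]"
      using m(2) by (metis le_neq_implies_less le0 upt_add_eq_append upt_conv_Cons le_add_diff_inverse)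
    moreover have "takeWhile (\<lambda>i. t (int i) = 1 \<or> t (int i) = 2) ([0..<m] @ xs) =
        [0..<m] @ takeWhile (\<lambda>i. t (int i) = 1 \<or> t (int i) = 2) xs" for xs
      using m(3) by (intro takeWhile_append2) auto
    ultimately show ?thesis using m(1) by simp
  qed
  have "takeWhile (\<lambda>a. dec a = 1 \<or> dec a = 2) Y = map (cell t \<circ> int) [0..<m]"
    unfolding Y up map_map takeWhile_map using tw by (simp add: o_def cell_def)
  moreover have "contents \<tau> = map (\<lambda>i. t (int i) = 2) [0..<m]"
    unfolding \<tau> contents.simps m_def ..
  ultimately show "map (\<lambda>a. if dec a = 2 then 2 else 1) (takeWhile (\<lambda>a. dec a = 1 \<or> dec a = 2) Y) =
      word_syms (contents \<tau>)"
    by (simp add: word_syms_def bit_sym_def cell_def)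
qed

lemma dropWhile_word_syms: "dropWhile (\<lambda>a. a = 1) (rev (word_syms w)) = rev (word_syms (strip w))"
  by (simp add: word_syms_def strip_def rev_map dropWhile_map o_def)

definition finish_time :: "machine \<Rightarrow> nat \<Rightarrow> nat"
  where "finish_time M B = (1 + 2 * tapes M) * (3 * (B + 1) + 1) + 27 * B + 5"

lemma run_finish_prog:
  assumes "clocked_machine M" and sim: "simulates M b s0 B 0 s C"
  defines "w \<equiv> contents (snd C ! inputs M)"
  shows "run (finish_prog M b) s (finish_time M B)
      (\<lambda>i. if i < b then s0 i else if i = b then word_syms (strip w) else []) []"
    and "length w \<le> B"
proof -
  define l r where "l = b + 6 + 2 * inputs M" and "r = b + 7 + 2 * inputs M"
  have k: "inputs M < tapes M" using assms(1) by (auto simp: clocked_machine_def)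
  have s: "\<And>i. i < b \<Longrightarrow> s i = s0 i" "s b = []" "s (b + 1) = []" "s (b + 2) = []" "s (b + 3) = []"
    "s (b + 4) = []" "s (b + 5) = [Suc (fst C)]" "\<And>i. b + 6 + 2 * tapes M \<le> i \<Longrightarrow> s i = []"
    using sim unfolding simulates_def by auto
  have z: "zipper (snd C ! j) (s (b + 6 + 2 * j)) (s (b + 7 + 2 * j))"
    "length (s (b + 6 + 2 * j)) + length (s (b + 7 + 2 * j)) \<le> B" if "j < tapes M" for j
    using sim that unfolding simulates_def by auto
  note zk = z[OF k, folded l_def r_def]
  let ?X = "rev (s l) @ s r"
  let ?Y = "dropWhile (\<lambda>a. \<not> marked a) ?X"
  let ?Z = "dropWhile (\<lambda>a. dec a = 1 \<or> dec a = 2) ?Y"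
  have neq: "l \<noteq> r" "b + 1 \<noteq> l" "b + 1 \<noteq> r" "Suc b \<noteq> l" "Suc b \<noteq> r" "r \<noteq> l" "r \<noteq> b + 1" by (auto simp: l_def r_def)
  have lens: "length ?X \<le> B" "length ?Y \<le> B" "length ?Z \<le> B"
    using zk(2) length_dropWhile_le[of "\<lambda>a. \<not> marked a" ?X]
      length_dropWhile_le[of "\<lambda>a. dec a = 1 \<or> dec a = 2" ?Y] by auto
  note ct = zipper_contents[OF zk(1), folded w_def]
  have "length (map (\<lambda>a. if dec a = 2 then 2 else (1::nat)) (takeWhile (\<lambda>a. dec a = 1 \<or> dec a = 2) ?Y)) \<le> length ?Y"
    by (simp add: length_takeWhile_le)
  then show lenw: "length w \<le> B" unfolding ct(2) using lens by simp
  let ?s1 = "s(l := [], r := ?X)"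
  let ?s2 = "s(l := [], r := ?Y)"
  let ?s3 = "s(l := [], r := ?Z, b + 1 := rev (word_syms w))"
  let ?s4 = "s(l := [], r := ?Z, b + 1 := rev (word_syms (strip w)))"
  let ?s5 = "\<lambda>i. if b + 5 \<le> i \<and> i < b + 5 + (1 + 2 * tapes M) then [] else ?s4 i"
  have 1: "run (move_prog l r) s (7 * B + 1) ?s1 []"
    using zipper_nonzero[OF zk(1)] zk(2) neq by (intro run_move) auto
  have 2: "run (While r (\<lambda>a. \<not> marked a) (Pop r)) ?s1 (3 * B + 1) ?s2 []"
    using ct(1) lens neq by (intro run_pop_while) (auto simp: fun_eq_iff)
  have 3: "run (While r (\<lambda>a. dec a = 1 \<or> dec a = 2) (Switch r (\<lambda>a. Pop r ;; Push (b + 1) (if dec a = 2 then 2 else 1))))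
      ?s2 (7 * B + 1) ?s3 []"
    using ct(2) lens neq s(3) by (intro run_transfer) (auto simp: fun_eq_iff)
  have 4: "run (While (b + 1) (\<lambda>a. a = 1) (Pop (b + 1))) ?s3 (3 * B + 1) ?s4 []"
    using lenw neq dropWhile_word_syms[of w] by (intro run_pop_while) (auto simp: fun_eq_iff)
  have lstrip: "length (strip w) \<le> B"
    using lenw length_dropWhile_le[of Not "rev w"] unfolding strip_def by simp
  have 5: "run (clear_range (b + 5) (1 + 2 * tapes M)) ?s4 ((1 + 2 * tapes M) * (3 * (B + 1) + 1)) ?s5 []"
  proof (rule run_clear_range)
    fix i assume i: "b + 5 \<le> i" "i < b + 5 + (1 + 2 * tapes M)"
    show "0 \<notin> set (?s4 i) \<and> length (?s4 i) \<le> B + 1"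
    proof (cases "i = b + 5")
      case True
      then show ?thesis using s(7) by (simp add: l_def r_def)
    next
      case False
      define j where "j = (i - (b + 6)) div 2"
      have j: "j < tapes M" "i = b + 6 + 2 * j \<or> i = b + 7 + 2 * j"
        using i False unfolding j_def by presburger+
      have "0 \<notin> set (s i)" "length (s i) \<le> B"
        using z[OF j(1)] zipper_nonzero[OF z(1)[OF j(1)]] j(2) by auto
      moreover have "0 \<notin> set ?Z"
        using zipper_nonzero[OF zk(1)] by (auto dest!: set_dropWhileD)
      ultimately show ?thesis using lens i by auto
    qed
  qed
  have 6: "run (move_prog (b + 1) b) ?s5 (7 * B + 1)
      (\<lambda>i. if i < b then s0 i else if i = b then word_syms (strip w) else []) []"
  proof (rule run_move)
    show "(\<lambda>i. if i < b then s0 i else if i = b then word_syms (strip w) else []) =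
      ?s5(b + 1 := [], b := rev (?s5 (b + 1)) @ ?s5 b)"
    proof
      fix i
      consider "i < b" | "i = b" | "i = b + 1" | "i = b + 2" | "i = b + 3" | "i = b + 4" | "b + 5 \<le> i"
        by linarith
      then show "(if i < b then s0 i else if i = b then word_syms (strip w) else []) =
        (?s5(b + 1 := [], b := rev (?s5 (b + 1)) @ ?s5 b)) i"
        using s k by cases (auto simp: l_def r_def)
    qed
  qed (use lstrip in auto)
  show "run (finish_prog M b) s (finish_time M B)
      (\<lambda>i. if i < b then s0 i else if i = b then word_syms (strip w) else []) []"
    unfolding finish_prog_def Let_def l_def[symmetric] r_def[symmetric]
    by (rule run_SeqI[OF 1 run_SeqI[OF 2 run_SeqI[OF 3 run_SeqI[OF 4 run_SeqI[OF 5 6 order.refl] order.refl] order.refl] order.refl]])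
      (auto simp: finish_time_def)
qed

definition sim_prog :: "machine \<Rightarrow> nat \<Rightarrow> prog"
  where "sim_prog M b = init_prog M b ;; Loop (b + 2) (Pop (b + 2) ;; step_prog M b) ;; finish_prog M b"

lemma poly_bounded_sum: "(\<And>i. i < (m::nat) \<Longrightarrow> poly_bounded (\<lambda>n. f i n)) \<Longrightarrow> poly_bounded (\<lambda>n. \<Sum>i<m. f i n)"
  by (induction m) (auto intro: poly_bounded_intros)

lemma run_sim_prog:
  assumes M: "clocked_machine M"
  obtains \<tau> where "poly_bounded \<tau>" "mono \<tau>"
    "\<And>ws s b. length ws = inputs M \<Longrightarrow>
      (\<And>j. j < inputs M \<Longrightarrow> s (b + 7 + 2 * j) = word_syms (ws ! j)) \<Longrightarrow>
      (\<And>i. b \<le> i \<Longrightarrow> (\<And>j. j < inputs M \<Longrightarrow> i \<noteq> b + 7 + 2 * j) \<Longrightarrow> s i = []) \<Longrightarrow>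
      run (sim_prog M b) s (\<tau> (sum_list (map length ws)))
        (\<lambda>i. if i < b then s i else if i = b then word_syms (strip (out_of M ws)) else []) []"
    "\<And>ws. length ws = inputs M \<Longrightarrow> length (out_of M ws) \<le> \<tau> (sum_list (map length ws))"
proof -
  define cl where "cl n = n ^ clock_exp M + clock_exp M" for n
  define B where "B n = n + 1 + 2 * cl n" for n
  define \<tau>0 where "\<tau>0 n = init_time M n + (cl n * (12 * tapes M + 8) + 1) + finish_time M (B n)" for n
  have "poly_bounded \<tau>0"
    unfolding \<tau>0_def init_time_def finish_time_def B_def cl_def
    by (intro poly_bounded_intros poly_bounded_sum)
  then obtain \<tau> where \<tau>: "poly_bounded \<tau>" "mono \<tau>" "\<And>n. \<tau>0 n \<le> \<tau> n"
    using poly_bounded_mono_bound by blast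
  have main: "run (sim_prog M b) s (\<tau> (sum_list (map length ws)))
        (\<lambda>i. if i < b then s i else if i = b then word_syms (strip (out_of M ws)) else []) [] \<and>
      length (out_of M ws) \<le> \<tau> (sum_list (map length ws))"
    if ws: "length ws = inputs M" and inp: "\<And>j. j < inputs M \<Longrightarrow> s (b + 7 + 2 * j) = word_syms (ws ! j)"
      and emp: "\<And>i. b \<le> i \<Longrightarrow> (\<And>j. j < inputs M \<Longrightarrow> i \<noteq> b + 7 + 2 * j) \<Longrightarrow> s i = []" for ws s b
  proof -
    define n where "n = sum_list (map length ws)"
    have clock: "clock M ws = cl n" by (simp add: clock_def cl_def n_def Let_def)
    obtain s1 where 1: "run (init_prog M b) s (init_time M n) s1 []"
      "simulates M b s (n + 1) (cl n) s1 (start M ws)"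
      using run_init_prog[OF M ws inp emp n_def] unfolding clock by blast
    obtain s2 where 2: "run (Loop (b + 2) (Pop (b + 2) ;; step_prog M b)) s1 (cl n * (12 * tapes M + 8) + 1) s2 []"
      "simulates M b s (B n) 0 s2 ((step M ^^ cl n) (start M ws))"
      using simulates_loop[OF M 1(2)] unfolding B_def by blast
    have out: "out_of M ws = contents (snd ((step M ^^ cl n) (start M ws)) ! inputs M)"
      by (simp add: out_of_def clock)
    note 3 = run_finish_prog[OF M 2(2), folded out]
    have "run (sim_prog M b) s (\<tau> n)
        (\<lambda>i. if i < b then s i else if i = b then word_syms (strip (out_of M ws)) else []) []"
      unfolding sim_prog_def
      by (rule run_SeqI[OF 1(1) run_SeqI[OF 2(1) 3(1) order.refl]])
        (use \<tau>(3)[of n] in \<open>auto simp: \<tau>0_def\<close>)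
    moreover have "length (out_of M ws) \<le> \<tau> n"
      using 3(2) \<tau>(3)[of n] by (auto simp: \<tau>0_def finish_time_def)
    ultimately show ?thesis by (simp add: n_def)
  qed
  show ?thesis
  proof (rule that[OF \<tau>(1,2)])
    \<comment> \<open>The bound for the output length mentions no stacks, so any stacks holding the
      inputs serve to derive it, here with base 0.\<close>
    fix ws :: "bool list list" assume "length ws = inputs M"
    then show "length (out_of M ws) \<le> \<tau> (sum_list (map length ws))"
      by (rule main[THEN conjunct2, where b1 = 0 and
            s1 = "\<lambda>i. if \<exists>j<inputs M. i = 7 + 2 * j then word_syms (ws ! ((i - 7) div 2)) else []"]) auto
  qed (use main in blast)
qed

section \<open>Evaluating terms\<close>

lemma wf_tape_prog:
  assumes "l < K" "r < K" "l \<noteq> k" "r \<noteq> k" "enc (fst x) True < S"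
  shows "wf_prog k K S (tape_prog l r x)"
proof -
  have "enc (fst x) f < S" for f using assms(5) by (cases f) (auto simp: enc_def)
  then show ?thesis
    using assms by (cases "snd x"; cases x) (auto simp: tape_prog_def enc_def)
qed

lemma wf_acts_prog:
  assumes "\<And>x. x \<in> set xs \<Longrightarrow> enc (fst x) True < S" and "k < b" and "b + 6 + 2 * (j + length xs) \<le> K"
  shows "wf_prog k K S (acts_prog b j xs)"
  using assms by (induction xs arbitrary: j) (auto intro!: wf_tape_prog)

lemma wf_read_prog:
  assumes "\<And>ss. wf_prog k K S (f ss)" and "k < b" and "b + 6 + 2 * (j + m) \<le> K"
  shows "wf_prog k K S (read_prog b j m ss f)"
  using assms by (induction m arbitrary: j ss) auto

lemma wf_load_all: "k < b \<Longrightarrow> b + 6 + 2 * m \<le> K \<Longrightarrow> 7 \<le> S \<Longrightarrow> wf_prog k K S (load_all b m)"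
  by (induction m) (auto simp: load_prog_def Let_def enc_def)

lemma wf_pow_prog: "k < b \<Longrightarrow> b + 6 \<le> K \<Longrightarrow> 2 \<le> S \<Longrightarrow> wf_prog k K S (pow_prog b e)"
  by (induction e) (auto simp: mul_prog_def intro!: wf_move_prog)

lemma wf_push_ones: "i < K \<Longrightarrow> i \<noteq> k \<Longrightarrow> 2 \<le> S \<Longrightarrow> wf_prog k K S (push_ones i e)"
  by (induction e) auto

lemma wf_clear_range: "k < b \<Longrightarrow> b + m \<le> K \<Longrightarrow> wf_prog k K S (clear_range b m)"
  by (induction m) auto

text \<open>The alphabet has to contain the encoded symbols and the successors of the states that
  occur in the finite table; 7 makes room for the encoded input symbols, the largest being
  \<open>enc 2 True = 6\<close>.\<close>

lemma wf_sim_prog: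
  assumes M: "clocked_machine M"
  shows "\<exists>S0. \<forall>S\<ge>S0. \<forall>k b K. k < b \<longrightarrow> b + 6 + 2 * tapes M \<le> K \<longrightarrow> wf_prog k K S (sim_prog M b)"
proof -
  let ?X = "(\<lambda>(_, q, xs). Suc q) ` set (table M) \<union>
    (\<Union>(_, q, xs) \<in> set (table M). (\<lambda>x. enc (fst x) True) ` set xs)"
  have "finite ?X" by auto
  then obtain S1 where S1: "\<And>a. a \<in> ?X \<Longrightarrow> a < S1"
    by (meson finite_nat_set_iff_bounded)
  have k: "inputs M < tapes M" using M by (auto simp: clocked_machine_def)
  have "wf_prog k K S (sim_prog M b)" if S: "max S1 7 \<le> S" and b: "k < b" "b + 6 + 2 * tapes M \<le> K" for S k b K
  proof -
    have "wf_prog k K S (case map_of (table M) (c, ss) of None \<Rightarrow> Skip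
        | Some (q', xs) \<Rightarrow> Pop (b + 5) ;; Push (b + 5) (Suc q') ;; acts_prog b 0 xs)" for c ss
    proof (cases "map_of (table M) (c, ss)")
      case (Some y)
      obtain q' xs where y: "y = (q', xs)" by (metis surj_pair)
      have mem: "((c, ss), q', xs) \<in> set (table M)" using Some y map_of_SomeD by fastforce
      then have "Suc q' < S" using S1[of "Suc q'"] S by force
      moreover have "enc (fst x) True < S" if "x \<in> set xs" for x
        using S1[of "enc (fst x) True"] mem that S by fastforce
      moreover have "length xs = tapes M" using M mem by (auto simp: clocked_machine_def)
      ultimately show ?thesis using b by (auto simp: Some y intro!: wf_acts_prog)
    qed auto
    then have "wf_prog k K S (step_prog M b)"
      using b unfolding step_prog_def by (auto intro!: wf_read_prog)
    moreover have "wf_prog k K S (init_prog M b)"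
      using b S unfolding init_prog_def by (auto intro!: wf_load_all wf_pow_prog wf_push_ones)
    moreover have "wf_prog k K S (finish_prog M b)"
      using b S k unfolding finish_prog_def by (auto simp: Let_def intro!: wf_move_prog wf_clear_range)
    ultimately show ?thesis using b by (simp add: sim_prog_def)
  qed
  then show ?thesis by blast
qed

section \<open>Evaluating terms by calls of the simulator\<close>

primrec move_args :: "nat \<Rightarrow> nat \<Rightarrow> nat \<Rightarrow> prog"
  where
    "move_args b m 0 = Skip"
  | "move_args b m (Suc j) = move_args b m j ;; move_prog (b + j) (b + m + 1) ;;
      move_prog (b + m + 1) (b + m + 7 + 2 * j)"

text \<open>The \<open>m\<close> arguments lie on the stacks from \<open>b\<close> on and the
  simulator is called with base \<open>b + m\<close>. Even offsets from \<open>b + m + 7\<close> are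
  the right halves of its tapes, where it expects its inputs; its own scratch stack keeps the
  order.\<close>

lemma run_move_args:
  assumes "\<And>j. j < m \<Longrightarrow> 0 \<notin> set (s (b + j))" and "\<And>i. b + m \<le> i \<Longrightarrow> s i = []" and "p \<le> m"
  shows "run (move_args b m p) s ((\<Sum>j<p. length (s (b + j))) * 14 + 2 * p)
    (\<lambda>i. if b \<le> i \<and> i < b + p then []
      else if b + m + 7 \<le> i \<and> i < b + m + 7 + 2 * p \<and> even (i - (b + m + 7)) then s (b + (i - (b + m + 7)) div 2)
      else s i) []"
  using assms(3)
proof (induction p)
  case 0
  have "(\<lambda>i. if b \<le> i \<and> i < b + 0 then []
      else if b + m + 7 \<le> i \<and> i < b + m + 7 + 2 * 0 \<and> even (i - (b + m + 7)) then s (b + (i - (b + m + 7)) div 2)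
      else s i) = s" by (rule ext) auto
  then show ?case by (simp only: move_args.simps run.Skip)
next
  case (Suc p)
  define st where "st p = (\<lambda>i. if b \<le> i \<and> i < b + p then []
      else if b + m + 7 \<le> i \<and> i < b + m + 7 + 2 * p \<and> even (i - (b + m + 7)) then s (b + (i - (b + m + 7)) div 2)
      else s i)" for p
  have p: "p < m" using Suc.prems by simp
  have 1: "run (move_args b m p) s ((\<Sum>j<p. length (s (b + j))) * 14 + 2 * p) (st p) []"
    using Suc unfolding st_def by simp
  let ?w = "s (b + p)"
  have sp: "st p (b + p) = ?w" "st p (b + m + 1) = []" "st p (b + m + 7 + 2 * p) = []"
    using p assms(2) by (auto simp: st_def)
  let ?s1 = "(st p)(b + p := [], b + m + 1 := rev ?w)"
  have 2: "run (move_prog (b + p) (b + m + 1)) (st p) (length ?w * 7 + 1) ?s1 []"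
    using sp assms(1)[OF p] p by (intro run_move) auto
  have "st (Suc p) = ?s1(b + m + 1 := [], b + m + 7 + 2 * p := ?w)"
  proof
    fix i
    consider "i = b + p" | "i = b + m + 1" | "i = b + m + 7 + 2 * p" | "i = b + m + 8 + 2 * p"
      | "i < b + p" | "b + p < i" "i < b + m + 7 + 2 * p" "i \<noteq> b + m + 1" | "b + m + 8 + 2 * p < i" by linarith
    then show "st (Suc p) i = (?s1(b + m + 1 := [], b + m + 7 + 2 * p := ?w)) i"
      using p assms(2) by cases (auto simp: st_def)
  qed
  then have 3: "run (move_prog (b + m + 1) (b + m + 7 + 2 * p)) ?s1 (length ?w * 7 + 1) (st (Suc p)) []"
    using sp assms(1)[OF p] p by (intro run_move) (auto simp: fun_eq_iff)
  have "run (move_args b m (Suc p)) s ((\<Sum>j<Suc p. length (s (b + j))) * 14 + 2 * Suc p) (st (Suc p)) []"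
    unfolding move_args.simps by (rule run_SeqI[OF 1 run_SeqI[OF 2 3 order.refl]]) auto
  then show ?case unfolding st_def .
qed

lemma wf_move_args: "k < b \<Longrightarrow> b + m + 7 + 2 * p \<le> K \<Longrightarrow> p \<le> m \<Longrightarrow> wf_prog k K S (move_args b m p)"
  by (induction p) (auto intro!: wf_move_prog)

fun eval_prog :: "(nat \<Rightarrow> nat) \<Rightarrow> nat \<Rightarrow> machine trm \<Rightarrow> prog"
  and eval_args :: "(nat \<Rightarrow> nat) \<Rightarrow> nat \<Rightarrow> machine trm list \<Rightarrow> prog"
  where
    "eval_prog \<iota> b (Var x) = move_prog (\<iota> x) (b + 1) ;;
      Loop (b + 1) (Switch (b + 1) (\<lambda>a. if a = 0 then Skip else Pop (b + 1) ;; Push (\<iota> x) a ;; Push b a))"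
  | "eval_prog \<iota> b (Fn M ts) = eval_args \<iota> b ts ;; move_args b (length ts) (length ts) ;;
      sim_prog M (b + length ts) ;; move_prog (b + length ts) (b + length ts + 1) ;;
      move_prog (b + length ts + 1) b"
  | "eval_args \<iota> b [] = Skip"
  | "eval_args \<iota> b (t # ts) = eval_prog \<iota> b t ;; eval_args \<iota> (Suc b) ts"

definition holds_args :: "(nat \<Rightarrow> nat) \<Rightarrow> nat \<Rightarrow> (nat \<Rightarrow> nat list) \<Rightarrow> (nat \<Rightarrow> nat) \<Rightarrow> nat \<Rightarrow> nat set \<Rightarrow> bool"
  where "holds_args \<iota> b s e n V \<longleftrightarrow> (\<forall>i\<ge>b. s i = []) \<and>
    (\<forall>x\<in>V. \<iota> x < b \<and> s (\<iota> x) = word_syms (bits_of (e x)) \<and> len (e x) \<le> n)"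

text \<open>Running time and length of the value are bounded together, because the time for an outer
  symbol depends on the lengths of its arguments. The bound \<open>\<tau>\<close> may depend on the
  term, but not on the stacks or the values.\<close>

definition eval_correct :: "(nat \<Rightarrow> nat) \<Rightarrow> (nat \<Rightarrow> nat) \<Rightarrow> machine trm \<Rightarrow> bool"
  where "eval_correct \<iota> \<tau> t \<longleftrightarrow> (\<forall>b s e n. holds_args \<iota> b s e n (tvars t) \<longrightarrow>
    run (eval_prog \<iota> b t) s (\<tau> n) (s(b := word_syms (bits_of (tval standard_model e t)))) [] \<and>
    len (tval standard_model e t) \<le> \<tau> n)"

lemma eval_correct_Var: "eval_correct \<iota> (\<lambda>n. 16 * n + 2) (Var x)"
  unfolding eval_correct_def
proof (intro allI impI)
  fix b s e n assume "holds_args \<iota> b s e n (tvars (Var x :: machine trm))"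
  then have emp: "\<And>i. b \<le> i \<Longrightarrow> s i = []" and x: "\<iota> x < b" "s (\<iota> x) = word_syms (bits_of (e x))" "len (e x) \<le> n"
    by (auto simp: holds_args_def)
  let ?w = "word_syms (bits_of (e x))"
  let ?\<sigma> = "\<lambda>k. s(\<iota> x := rev (take k (rev ?w)), b + 1 := drop k (rev ?w), b := rev (take k (rev ?w)))"
  let ?body = "Switch (b + 1) (\<lambda>a. if a = 0 then Skip else Pop (b + 1) ;; Push (\<iota> x) a ;; Push b a)"
  have s_eq: "s(\<iota> x := [], b + 1 := rev ?w) = ?\<sigma> 0" using emp[of b] by (auto simp: fun_eq_iff)
  have "run (move_prog (\<iota> x) (b + 1)) s (n * 7 + 1) (s(\<iota> x := [], b + 1 := rev ?w)) []"
    using x emp[of "b + 1"] by (intro run_move) auto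
  note 1 = this[unfolded s_eq]
  have 2: "run (Loop (b + 1) ?body) (?\<sigma> 0) (n * 9 + 1) (?\<sigma> (len (e x))) []"
  proof (rule run_While_iterate[where n = "len (e x)" and c = 7 and out = "\<lambda>_. []" and \<sigma> = ?\<sigma>])
    fix k assume k: "k < len (e x)"
    let ?a = "rev ?w ! k"
    have "drop k (rev ?w) = ?a # drop (Suc k) (rev ?w)" "take (Suc k) (rev ?w) = take k (rev ?w) @ [?a]"
      using k by (auto simp: drop_nth take_Suc_conv_app_nth)
    moreover have "?a \<noteq> 0" using k by (intro nth_neq_0) auto
    ultimately show "peek (?\<sigma> k (b + 1)) \<noteq> 0 \<and> run ?body (?\<sigma> k) 7 (?\<sigma> (Suc k)) []"
      using x(1) by (auto simp: fun_eq_iff intro!: run_straight)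
  qed (use x in auto)
  have "?\<sigma> (len (e x)) = s(b := ?w)" using x emp[of "b + 1"] by (auto simp: fun_eq_iff)
  note 2 = 2[unfolded this]
  have "run (eval_prog \<iota> b (Var x)) s (16 * n + 2) (s(b := ?w)) []"
    unfolding eval_prog.simps by (rule run_SeqI[OF 1 2]) auto
  then show "run (eval_prog \<iota> b (Var x)) s (16 * n + 2) (s(b := word_syms (bits_of (tval standard_model e (Var x))))) [] \<and>
      len (tval standard_model e (Var x :: machine trm)) \<le> 16 * n + 2"
    using x by simp
qed

lemma eval_args_correct:
  assumes "\<And>t. t \<in> set ts \<Longrightarrow> \<exists>\<tau>. poly_bounded \<tau> \<and> eval_correct \<iota> \<tau> t"
  shows "\<exists>\<tau>. poly_bounded \<tau> \<and> (\<forall>b s e n. holds_args \<iota> b s e n (\<Union>t\<in>set ts. tvars t) \<longrightarrow>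
    run (eval_args \<iota> b ts) s (\<tau> n) (\<lambda>i. if b \<le> i \<and> i < b + length ts
      then word_syms (bits_of (tval standard_model e (ts ! (i - b)))) else s i) [] \<and>
    (\<Sum>t\<leftarrow>ts. len (tval standard_model e t)) \<le> \<tau> n)"
  using assms
proof (induction ts)
  case Nil
  have "(\<lambda>i. if b \<le> i \<and> i < b + length ([] :: machine trm list) then w i else s i) = s" for b s and w :: "nat \<Rightarrow> nat list"
    by (rule ext) auto
  then have "run (eval_args \<iota> b []) s 0 (\<lambda>i. if b \<le> i \<and> i < b + length ([] :: machine trm list)
      then word_syms (bits_of (tval standard_model e ([] ! (i - b)))) else s i) []" for b s e
    by (simp only: eval_args.simps run.Skip)
  then show ?case by (intro exI[of _ "\<lambda>_. 0"] conjI poly_bounded_const allI impI) auto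
next
  case (Cons t ts)
  obtain \<tau>1 where \<tau>1: "poly_bounded \<tau>1" "eval_correct \<iota> \<tau>1 t" using Cons.prems by auto
  obtain \<tau>2 where \<tau>2: "poly_bounded \<tau>2" and IH: "\<And>b s e n. holds_args \<iota> b s e n (\<Union>t\<in>set ts. tvars t) \<Longrightarrow>
    run (eval_args \<iota> b ts) s (\<tau>2 n) (\<lambda>i. if b \<le> i \<and> i < b + length ts
      then word_syms (bits_of (tval standard_model e (ts ! (i - b)))) else s i) [] \<and>
    (\<Sum>t\<leftarrow>ts. len (tval standard_model e t)) \<le> \<tau>2 n"
    using Cons.IH[OF Cons.prems[OF list.set_intros(2)]] by blast
  show ?case
  proof (intro exI conjI allI impI)
    show "poly_bounded (\<lambda>n. \<tau>1 n + \<tau>2 n)" by (intro poly_bounded_intros \<tau>1 \<tau>2)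
    fix b s e n assume h: "holds_args \<iota> b s e n (\<Union>t\<in>set (t # ts). tvars t)"
    let ?s1 = "s(b := word_syms (bits_of (tval standard_model e t)))"
    have "holds_args \<iota> b s e n (tvars t)" using h by (auto simp: holds_args_def)
    with \<tau>1(2) have 1: "run (eval_prog \<iota> b t) s (\<tau>1 n) ?s1 []" "len (tval standard_model e t) \<le> \<tau>1 n"
      unfolding eval_correct_def by blast+
    have "holds_args \<iota> (Suc b) ?s1 e n (\<Union>t\<in>set ts. tvars t)"
      using h unfolding holds_args_def by (auto simp: less_Suc_eq)
    from IH[OF this] have
      2: "run (eval_args \<iota> (Suc b) ts) ?s1 (\<tau>2 n) (\<lambda>i. if Suc b \<le> i \<and> i < Suc b + length ts
        then word_syms (bits_of (tval standard_model e (ts ! (i - Suc b)))) else ?s1 i) []"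
        "(\<Sum>t\<leftarrow>ts. len (tval standard_model e t)) \<le> \<tau>2 n" by blast+
    have eq: "(\<lambda>i. if Suc b \<le> i \<and> i < Suc b + length ts
        then word_syms (bits_of (tval standard_model e (ts ! (i - Suc b)))) else ?s1 i) =
      (\<lambda>i. if b \<le> i \<and> i < b + length (t # ts)
        then word_syms (bits_of (tval standard_model e ((t # ts) ! (i - b)))) else s i)"
      by (rule ext) (auto simp: nth_Cons split: nat.split intro!: arg_cong[where f = "\<lambda>i. word_syms (bits_of (tval standard_model e (ts ! i)))"])
    show "run (eval_args \<iota> b (t # ts)) s (\<tau>1 n + \<tau>2 n) (\<lambda>i. if b \<le> i \<and> i < b + length (t # ts)
        then word_syms (bits_of (tval standard_model e ((t # ts) ! (i - b)))) else s i) []"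
      unfolding eval_args.simps by (rule run_SeqI[OF 1(1) 2(1)[unfolded eq]]) auto
    show "(\<Sum>t\<leftarrow>t # ts. len (tval standard_model e t)) \<le> \<tau>1 n + \<tau>2 n"
      using 1(2) 2(2) by simp
  qed
qed

lemma eval_correct_Fn:
  assumes M: "clocked_machine M" and m: "length ts = inputs M"
    and "\<And>t. t \<in> set ts \<Longrightarrow> \<exists>\<tau>. poly_bounded \<tau> \<and> eval_correct \<iota> \<tau> t"
  shows "\<exists>\<tau>. poly_bounded \<tau> \<and> eval_correct \<iota> \<tau> (Fn M ts)"
proof -
  obtain \<tau>1 where \<tau>1: "poly_bounded \<tau>1" and args: "\<And>b s e n. holds_args \<iota> b s e n (\<Union>t\<in>set ts. tvars t) \<Longrightarrow>
    run (eval_args \<iota> b ts) s (\<tau>1 n) (\<lambda>i. if b \<le> i \<and> i < b + length ts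
      then word_syms (bits_of (tval standard_model e (ts ! (i - b)))) else s i) [] \<and>
    (\<Sum>t\<leftarrow>ts. len (tval standard_model e t)) \<le> \<tau>1 n"
    using eval_args_correct[OF assms(3)] by blast
  obtain \<tau>2 where \<tau>2: "poly_bounded \<tau>2" "mono \<tau>2" and sim: "\<And>ws s b. length ws = inputs M \<Longrightarrow>
      (\<And>j. j < inputs M \<Longrightarrow> s (b + 7 + 2 * j) = word_syms (ws ! j)) \<Longrightarrow>
      (\<And>i. b \<le> i \<Longrightarrow> (\<And>j. j < inputs M \<Longrightarrow> i \<noteq> b + 7 + 2 * j) \<Longrightarrow> s i = []) \<Longrightarrow>
      run (sim_prog M b) s (\<tau>2 (sum_list (map length ws)))
        (\<lambda>i. if i < b then s i else if i = b then word_syms (strip (out_of M ws)) else []) []"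
    and out: "\<And>ws. length ws = inputs M \<Longrightarrow> length (out_of M ws) \<le> \<tau>2 (sum_list (map length ws))"
    using run_sim_prog[OF M] by blast
  let ?m = "length ts"
  let ?\<tau> = "\<lambda>n. \<tau>1 n + (\<tau>1 n * 14 + 2 * ?m) + \<tau>2 (\<tau>1 n) + (\<tau>2 (\<tau>1 n) * 7 + 1) + (\<tau>2 (\<tau>1 n) * 7 + 1)"
  have "poly_bounded ?\<tau>"
    by (intro poly_bounded_intros \<tau>1 poly_bounded_compose[OF \<tau>2(1) \<tau>1])
  moreover have "eval_correct \<iota> ?\<tau> (Fn M ts)"
    unfolding eval_correct_def
  proof (intro allI impI)
    fix b s e n assume h: "holds_args \<iota> b s e n (tvars (Fn M ts))"
    define xs where "xs = map (tval standard_model e) ts"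
    define ws where "ws = map bits_of xs"
    define y where "y = fun_of M xs"
    have m1: "1 \<le> ?m" using M m by (auto simp: clocked_machine_def)
    have emp: "\<And>i. b \<le> i \<Longrightarrow> s i = []" using h by (simp add: holds_args_def)
    have y: "word_syms (strip (out_of M ws)) = word_syms (bits_of y)"
      by (simp add: y_def ws_def strip_eq fun_of_def)
    have total: "sum_list (map length ws) \<le> \<tau>1 n"
      using args[of b s e n] h by (simp add: ws_def xs_def o_def)
    have lenw: "length ws = inputs M" by (simp add: ws_def xs_def m)
    have ylen: "len y \<le> \<tau>2 (\<tau>1 n)"
    proof -
      have "len y = length (strip (out_of M ws))" by (simp add: strip_eq y_def ws_def fun_of_def)
      also have "\<dots> \<le> length (out_of M ws)"
        using length_dropWhile_le[of Not "rev (out_of M ws)"] by (simp add: strip_def)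
      also have "\<dots> \<le> \<tau>2 (\<tau>1 n)"
        using out[OF lenw] monoD[OF \<tau>2(2) total] by linarith
      finally show ?thesis .
    qed
    define s1 where "s1 = (\<lambda>i. if b \<le> i \<and> i < b + ?m then word_syms (ws ! (i - b)) else s i)"
    have "s1 = (\<lambda>i. if b \<le> i \<and> i < b + ?m then word_syms (bits_of (tval standard_model e (ts ! (i - b)))) else s i)"
      unfolding s1_def ws_def xs_def by (rule ext) auto
    then have 1: "run (eval_args \<iota> b ts) s (\<tau>1 n) s1 []"
      using args[of b s e n] h by simp
    define s2 where "s2 = (\<lambda>i. if b \<le> i \<and> i < b + ?m then []
      else if b + ?m + 7 \<le> i \<and> i < b + ?m + 7 + 2 * ?m \<and> even (i - (b + ?m + 7)) then s1 (b + (i - (b + ?m + 7)) div 2)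
      else s1 i)"
    have "(\<Sum>j<?m. length (s1 (b + j))) = sum_list (map length ws)"
      using lenw m by (simp add: s1_def sum_list_sum_nth atLeast0LessThan)
    moreover have "run (move_args b ?m ?m) s1 ((\<Sum>j<?m. length (s1 (b + j))) * 14 + 2 * ?m) s2 []"
      unfolding s2_def by (rule run_move_args) (auto simp: s1_def emp)
    ultimately have 2: "run (move_args b ?m ?m) s1 (\<tau>1 n * 14 + 2 * ?m) s2 []"
      using total by (auto elim!: run_mono)
    define s3 where "s3 = (\<lambda>i. if i < b + ?m then s2 i else if i = b + ?m then word_syms (bits_of y) else [])"
    have "run (sim_prog M (b + ?m)) s2 (\<tau>2 (sum_list (map length ws))) s3 []"
      unfolding s3_def y[symmetric]
    proof (rule sim[OF lenw])
      show "s2 (b + ?m + 7 + 2 * j) = word_syms (ws ! j)" if "j < inputs M" for j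
        using that m by (simp add: s2_def s1_def)
      show "s2 i = []" if "b + ?m \<le> i" "\<And>j. j < inputs M \<Longrightarrow> i \<noteq> b + ?m + 7 + 2 * j" for i
      proof (cases "b + ?m + 7 \<le> i \<and> i < b + ?m + 7 + 2 * ?m \<and> even (i - (b + ?m + 7))")
        case True
        then have "2 * ((i - (b + ?m + 7)) div 2) = i - (b + ?m + 7)"
          using dvd_mult_div_cancel[of 2 "i - (b + ?m + 7)"] by blast
        with True have "i = b + ?m + 7 + 2 * ((i - (b + ?m + 7)) div 2)" "(i - (b + ?m + 7)) div 2 < inputs M"
          using m by linarith+
        with that(2) show ?thesis by blast
      next
        case False
        then show ?thesis using that(1) emp[of i] by (simp only: s2_def s1_def if_False) auto
      qed
    qed
    then have 3: "run (sim_prog M (b + ?m)) s2 (\<tau>2 (\<tau>1 n)) s3 []"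
      using monoD[OF \<tau>2(2) total] by (rule run_mono)
    let ?s4 = "s3(b + ?m := [], b + ?m + 1 := rev (word_syms (bits_of y)))"
    have 4: "run (move_prog (b + ?m) (b + ?m + 1)) s3 (\<tau>2 (\<tau>1 n) * 7 + 1) ?s4 []"
      using ylen by (intro run_move) (auto simp: s3_def)
    have "s(b := word_syms (bits_of y)) = ?s4(b + ?m + 1 := [], b := word_syms (bits_of y))"
    proof
      fix i
      show "(s(b := word_syms (bits_of y))) i = (?s4(b + ?m + 1 := [], b := word_syms (bits_of y))) i"
        using emp[of i] m1 by (cases "i < b") (auto simp: s3_def s2_def s1_def)
    qed
    moreover have "s3 b = []"
    proof -
      have "b < b + ?m" using m1 by linarith
      then show ?thesis by (simp only: s3_def s2_def if_True le_refl simp_thms)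
    qed
    ultimately have 5: "run (move_prog (b + ?m + 1) b) ?s4 (\<tau>2 (\<tau>1 n) * 7 + 1) (s(b := word_syms (bits_of y))) []"
      using ylen m1 by (intro run_move) auto
    have "run (eval_prog \<iota> b (Fn M ts)) s (?\<tau> n) (s(b := word_syms (bits_of y))) []"
      unfolding eval_prog.simps
      by (rule run_SeqI[OF 1 run_SeqI[OF 2 run_SeqI[OF 3 run_SeqI[OF 4 5 order.refl] order.refl] order.refl]]) auto
    moreover have "tval standard_model e (Fn M ts) = y"
      by (simp add: y_def xs_def standard_model_def)
    ultimately show "run (eval_prog \<iota> b (Fn M ts)) s (?\<tau> n)
        (s(b := word_syms (bits_of (tval standard_model e (Fn M ts))))) [] \<and>
      len (tval standard_model e (Fn M ts)) \<le> ?\<tau> n"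
      using ylen by simp
  qed
  ultimately show ?thesis by blast
qed

lemma eval_correct_PV_trm: "PV_trm t \<Longrightarrow> \<exists>\<tau>. poly_bounded \<tau> \<and> eval_correct \<iota> \<tau> t"
proof (induction t)
  case (Var x)
  then show ?case
    by (intro exI[of _ "\<lambda>n. 16 * n + 2"] conjI eval_correct_Var poly_bounded_intros)
next
  case (Fn M ts)
  then show ?case by (intro eval_correct_Fn) auto
qed

lemma wf_eval_prog:
  "PV_trm t \<Longrightarrow> k < b \<Longrightarrow> (\<And>x. x \<in> tvars t \<Longrightarrow> \<iota> x < b \<and> \<iota> x \<noteq> k) \<Longrightarrow>
    \<exists>K0 S0. \<forall>K\<ge>K0. \<forall>S\<ge>S0. wf_prog k K S (eval_prog \<iota> b t)"
  "(\<And>t. t \<in> set ts \<Longrightarrow> PV_trm t) \<Longrightarrow> k < b \<Longrightarrow> (\<And>t x. t \<in> set ts \<Longrightarrow> x \<in> tvars t \<Longrightarrow> \<iota> x < b \<and> \<iota> x \<noteq> k) \<Longrightarrow>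
    \<exists>K0 S0. \<forall>K\<ge>K0. \<forall>S\<ge>S0. wf_prog k K S (eval_args \<iota> b ts)"
proof (induction \<iota> b t and \<iota> b ts rule: eval_prog_eval_args.induct)
  case (1 \<iota> b x)
  then show ?case
    by (intro exI[of _ "b + 2"] exI[of _ 0]) (auto intro!: wf_move_prog)
next
  case (2 \<iota> b M ts)
  have "\<exists>K0 S0. \<forall>K\<ge>K0. \<forall>S\<ge>S0. wf_prog k K S (eval_args \<iota> b ts)"
    using 2 by (intro "2.IH") auto
  then obtain K1 S1 where 1: "\<And>K S. K1 \<le> K \<Longrightarrow> S1 \<le> S \<Longrightarrow> wf_prog k K S (eval_args \<iota> b ts)"
    by blast
  have "clocked_machine M" using "2.prems" by simp
  from wf_sim_prog[OF this]
  obtain S2 where 2: "\<And>S b K. S2 \<le> S \<Longrightarrow> k < b \<Longrightarrow> b + 6 + 2 * tapes M \<le> K \<Longrightarrow> wf_prog k K S (sim_prog M b)"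
    by blast
  have "wf_prog k K S (eval_prog \<iota> b (Fn M ts))"
    if "K1 + b + 7 + 3 * length ts + 2 * tapes M \<le> K" "S1 + S2 \<le> S" for K S
    unfolding eval_prog.simps wf_prog.simps
    by (intro conjI 1 2 wf_move_args wf_move_prog) (use that \<open>k < b\<close> in linarith)+
  then show ?case by blast
next
  case (3 \<iota> b)
  then show ?case by simp
next
  case (4 \<iota> b t ts)
  have "\<exists>K0 S0. \<forall>K\<ge>K0. \<forall>S\<ge>S0. wf_prog k K S (eval_prog \<iota> b t)"
    using "4.prems" by (intro "4.IH"(1)) auto
  then obtain K1 S1 where 1: "\<And>K S. K1 \<le> K \<Longrightarrow> S1 \<le> S \<Longrightarrow> wf_prog k K S (eval_prog \<iota> b t)"
    by blast
  have "\<exists>K0 S0. \<forall>K\<ge>K0. \<forall>S\<ge>S0. wf_prog k K S (eval_args \<iota> (Suc b) ts)"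
    using "4.prems" by (intro "4.IH"(2)) (auto simp: less_Suc_eq)
  then obtain K2 S2 where 2: "\<And>K S. K2 \<le> K \<Longrightarrow> S2 \<le> S \<Longrightarrow> wf_prog k K S (eval_args \<iota> (Suc b) ts)"
    by blast
  have "wf_prog k K S (eval_args \<iota> b (t # ts))" if "K1 + K2 \<le> K" "S1 + S2 \<le> S" for K S
    unfolding eval_args.simps wf_prog.simps
    by (intro conjI 1 2) (use that in linarith)+
  then show ?case by blast
qed

lemma run_emit_stack:
  assumes "s i = word_syms w" and "length w * 6 + 1 \<le> t"
  shows "run (Loop i (Switch i (\<lambda>a. Pop i ;; Emit (a = 2)))) s t (s(i := [])) w"
proof (rule run_While_iterate[where n = "length w" and c = 4 and out = "\<lambda>k. [w ! k]"
      and \<sigma> = "\<lambda>k. s(i := drop k (word_syms w))"])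
  fix k assume "k < length w"
  then show "peek ((s(i := drop k (word_syms w))) i) \<noteq> 0 \<and>
    run (Switch i (\<lambda>a. Pop i ;; Emit (a = 2))) (s(i := drop k (word_syms w))) 4
      (s(i := drop (Suc k) (word_syms w))) [w ! k]"
    by (auto simp: drop_nth word_syms_def intro!: run_straight)
next
  show "w = concat (map (\<lambda>k. [w ! k]) [0..<length w])" by (simp add: map_nth)
qed (use assms in auto)

lemma tval_cong: "(\<And>i. i \<in> tvars t \<Longrightarrow> e i = e' i) \<Longrightarrow> tval S e t = tval S e' t"
proof (induction t)
  case (Fn f ts)
  then have "map (tval S e) ts = map (tval S e') ts" by auto
  then show ?case by (simp only: tval.simps)
qed simp

text \<open>Closure of the clocked machines under composition. The claim is made for canonical
  numerals, the only inputs that \<open>fun_of\<close> supplies.\<close>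

lemma computes_term:
  assumes t: "PV_trm t" and vars: "tvars t \<subseteq> {..<k}" and k: "1 \<le> k"
  shows "\<exists>M. computes_num k M (\<lambda>xs. tval standard_model (\<lambda>i. xs ! i) t)"
proof -
  let ?b = "Suc k"
  let ?out = "Loop ?b (Switch ?b (\<lambda>a. Pop ?b ;; Emit (a = 2)))"
  let ?p = "eval_prog id ?b t ;; ?out"
  let ?F = "\<lambda>ws. bits_of (tval standard_model (\<lambda>i. num_of (ws ! i)) t)"
  let ?Q = "\<lambda>ws. \<forall>w\<in>set ws. bits_of (num_of w) = w"
  obtain \<tau> where \<tau>: "poly_bounded \<tau>" "eval_correct id \<tau> t" using eval_correct_PV_trm[OF t] by blast
  obtain K0 S0 where wf: "\<And>K S. K0 \<le> K \<Longrightarrow> S0 \<le> S \<Longrightarrow> wf_prog k K S (eval_prog id ?b t)"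
    using wf_eval_prog(1)[OF t, of k ?b id] vars by (force simp: subset_iff)
  have "\<exists>M. computes k ?Q M ?F"
  proof (rule computes_prog[where K = "K0 + ?b + 1" and S = "S0 + 3" and p = ?p
        and \<tau> = "\<lambda>n. \<tau> n + (\<tau> n * 6 + 1)"])
    show "wf_prog k (K0 + ?b + 1) (S0 + 3) ?p" using wf by simp
    show "poly_bounded (\<lambda>n. \<tau> n + (\<tau> n * 6 + 1))" by (intro poly_bounded_intros \<tau>)
    fix ws :: "bool list list" assume ws: "length ws = k" "?Q ws"
    let ?n = "sum_list (map length ws)" and ?e = "\<lambda>i. num_of (ws ! i)"
    have "len (?e x) \<le> ?n" if "x < k" for x
    proof -
      have "len (?e x) = length (ws ! x)" using ws that by (metis length_bits_of nth_mem)
      also have "\<dots> \<le> ?n" using ws that by (auto intro!: member_le_sum_list)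
      finally show ?thesis .
    qed
    then have "holds_args id ?b (init ws) ?e ?n (tvars t)"
      using ws vars by (auto simp: holds_args_def init_def subset_iff)
    with \<tau>(2) have 1: "run (eval_prog id ?b t) (init ws) (\<tau> ?n) ((init ws)(?b := word_syms (?F ws))) []"
      "len (tval standard_model ?e t) \<le> \<tau> ?n"
      unfolding eval_correct_def by blast+
    have 2: "run ?out ((init ws)(?b := word_syms (?F ws))) (\<tau> ?n * 6 + 1) ((init ws)(?b := word_syms (?F ws), ?b := [])) (?F ws)"
      using 1(2) by (intro run_emit_stack) auto
    show "\<exists>s'. run ?p (init ws) (\<tau> ?n + (\<tau> ?n * 6 + 1)) s' (?F ws)"
      by (rule exI, rule run_SeqI[OF 1(1) 2]) auto
  qed (use k in auto)
  moreover have "tval standard_model (\<lambda>i. num_of (map bits_of xs ! i)) t = tval standard_model (\<lambda>i. xs ! i) t"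
    if "length xs = k" for xs
  proof -
    have "num_of (map bits_of xs ! i) = xs ! i" if "i \<in> tvars t" for i
      using that vars \<open>length xs = k\<close> by auto
    then show ?thesis by (rule tval_cong)
  qed
  ultimately show ?thesis
    by (elim ex_forward, elim computes_num_of_computes) auto
qed

text \<open>All variables have the same value here, so they may share stack 0.\<close>

lemma len_term_poly_bounded:
  assumes "PV_trm t"
  shows "\<exists>\<tau>. poly_bounded \<tau> \<and> (\<forall>n. len (tval standard_model (\<lambda>_. 2 ^ n) t) \<le> \<tau> n)"
proof -
  obtain \<tau> where \<tau>: "poly_bounded \<tau>" "eval_correct (\<lambda>_. 0) \<tau> t" using eval_correct_PV_trm[OF assms] by blast
  have len: "len (2 ^ n) = Suc n" for n
    using arg_cong[OF bits_of_two_power[of n], of length] by simp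
  have "len (tval standard_model (\<lambda>_. 2 ^ n) t) \<le> \<tau> (Suc n)" for n
  proof -
    have "holds_args (\<lambda>_. 0) 1 (\<lambda>i. if i = 0 then word_syms (bits_of (2 ^ n)) else []) (\<lambda>_. 2 ^ n) (Suc n) (tvars t)"
      by (auto simp: holds_args_def len)
    then show ?thesis using \<tau>(2) unfolding eval_correct_def by blast
  qed
  moreover have "poly_bounded (\<lambda>n. \<tau> (Suc n))"
    by (intro poly_bounded_compose[OF \<tau>(1)] poly_bounded_intros)
  ultimately show ?thesis by blast
qed

text \<open>
  Entry \<open>num_of w\<close> of a list is found by keeping, for each bit of \<open>w\<close> in turn, the entries at even
  or at odd positions; counting down from \<open>num_of w\<close> would take exponential time.
\<close>

fun evens :: "'a list \<Rightarrow> 'a list"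
  where
    "evens [] = []"
  | "evens [x] = [x]"
  | "evens (x # y # zs) = x # evens zs"

lemma length_evens: "i < length (evens y) \<longleftrightarrow> 2 * i < length y"
  by (induction y arbitrary: i rule: evens.induct) (auto simp: less_Suc_eq_0_disj, presburger+)

lemma nth_evens: "2 * i < length y \<Longrightarrow> evens y ! i = y ! (2 * i)"
  by (induction y arbitrary: i rule: evens.induct) (auto simp: nth_Cons split: nat.split)

lemma length_evens_le: "length (evens y) \<le> length y"
  by (induction y rule: evens.induct) auto

lemma set_evens: "set (evens y) \<subseteq> set y"
  by (induction y rule: evens.induct) auto

primrec pick :: "bool list \<Rightarrow> 'a list \<Rightarrow> 'a list"
  where
    "pick [] y = y"
  | "pick (b # w) y = pick w (evens (if b then tl y else y))"

lemma pick_correct: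
  "(pick w y \<noteq> [] \<longleftrightarrow> num_of w < length y) \<and> (num_of w < length y \<longrightarrow> hd (pick w y) = y ! num_of w)"
proof (induction w arbitrary: y)
  case Nil
  then show ?case by (cases y) auto
next
  case (Cons b w)
  let ?y = "if b then tl y else y"
  have "num_of w < length (evens ?y) \<longleftrightarrow> num_of (b # w) < length y"
    by (auto simp: length_evens)
  moreover have "evens ?y ! num_of w = y ! num_of (b # w)" if "num_of (b # w) < length y"
  proof -
    have "2 * num_of w < length ?y" using that by auto
    then have "evens ?y ! num_of w = ?y ! (2 * num_of w)" by (rule nth_evens)
    then show ?thesis using that by (cases y) auto
  qed
  ultimately show ?case using Cons.IH[of "evens ?y"] by simp
qed

definition evens_body :: prog
  where "evens_body = Switch 4 (\<lambda>a. if a = 0 then Skip else Pop 4 ;; Push 5 a ;; Pop 4)"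

lemma run_evens_loop:
  "s 4 = y \<Longrightarrow> 0 \<notin> set y \<Longrightarrow> run (Loop 4 evens_body) s (length y * 8 + 1) (s(4 := [], 5 := rev (evens y) @ s 5)) []"
proof (induction y arbitrary: s rule: evens.induct)
  case 1
  then show ?case by (auto simp: fun_upd_idem intro: run.While_False)
next
  case (2 x)
  let ?s1 = "s(4 := [], 5 := x # s 5)"
  have 1: "run evens_body s 6 ?s1 []" using 2 unfolding evens_body_def by (intro run_straight) (auto simp: fun_eq_iff)
  have 2: "run (Loop 4 evens_body) ?s1 1 (s(4 := [], 5 := rev (evens [x]) @ s 5)) []"
    unfolding evens.simps by (simp del: One_nat_def) (rule run.While_False; simp)
  show ?case by (rule run.While_True[OF _ 1 2, unfolded append_Nil]) (use "2.prems" in auto)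
next
  case (3 x z zs)
  let ?s1 = "s(4 := zs, 5 := x # s 5)"
  have 1: "run evens_body s 6 ?s1 []" using 3 unfolding evens_body_def by (intro run_straight) (auto simp: fun_eq_iff)
  have "run (Loop 4 evens_body) ?s1 (length zs * 8 + 1) (?s1(4 := [], 5 := rev (evens zs) @ ?s1 5)) []"
    using 3 by (intro "3.IH") auto
  moreover have "?s1(4 := [], 5 := rev (evens zs) @ ?s1 5) = s(4 := [], 5 := rev (evens (x # z # zs)) @ s 5)"
    by (auto simp: fun_eq_iff)
  ultimately have 2: "run (Loop 4 evens_body) ?s1 (length zs * 8 + 1) (s(4 := [], 5 := rev (evens (x # z # zs)) @ s 5)) []"
    by (simp only:)
  show ?case by (rule run.While_True[OF _ 1 2, unfolded append_Nil]) (use "3.prems" in auto)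
qed

definition pick_body :: prog
  where "pick_body = Switch 0 (\<lambda>a. Pop 0 ;; (if a = 2 then Pop 4 else Skip)) ;; Loop 4 evens_body ;; move_prog 5 4"

lemma run_pick_loop:
  "s 0 = word_syms w \<Longrightarrow> s 4 = y \<Longrightarrow> s 5 = [] \<Longrightarrow> 0 \<notin> set y \<Longrightarrow> length y \<le> m \<Longrightarrow>
    run (Loop 0 pick_body) s (length w * (15 * m + 8) + 1) (s(0 := [], 4 := pick w y)) []"
proof (induction w arbitrary: s y)
  case Nil
  then show ?case by (auto simp: fun_upd_idem intro: run.While_False)
next
  case (Cons b w)
  let ?y = "if b then tl y else y"
  let ?s1 = "s(0 := word_syms w, 4 := ?y)"
  let ?s2 = "s(0 := word_syms w, 4 := evens ?y)"
  have nz: "0 \<notin> set ?y" using Cons.prems(4) by (cases y) auto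
  have ly: "length ?y \<le> m" using Cons.prems(5) by auto
  have 1: "run (Switch 0 (\<lambda>a. Pop 0 ;; (if a = 2 then Pop 4 else Skip))) s 4 ?s1 []"
    using Cons.prems by (intro run_straight) (auto simp: fun_eq_iff)
  have 2: "run (Loop 4 evens_body) ?s1 (m * 8 + 1) (?s1(4 := [], 5 := rev (evens ?y) @ ?s1 5)) []"
    using ly nz by (intro run_mono[OF run_evens_loop]) auto
  have 3: "run (move_prog 5 4) (?s1(4 := [], 5 := rev (evens ?y) @ ?s1 5)) (m * 7 + 1) ?s2 []"
    using Cons.prems(3) nz set_evens[of ?y] length_evens_le[of ?y] ly
    by (intro run_move) (auto simp: fun_eq_iff)
  have body: "run pick_body s (15 * m + 6) ?s2 []"
    unfolding pick_body_def by (rule run_SeqI[OF 1 run_SeqI[OF 2 3 order.refl]]) auto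
  have "run (Loop 0 pick_body) ?s2 (length w * (15 * m + 8) + 1) (?s2(0 := [], 4 := pick w (evens ?y))) []"
    using Cons.prems(3) nz set_evens[of ?y] length_evens_le[of ?y] ly by (intro Cons.IH) auto
  moreover have "?s2(0 := [], 4 := pick w (evens ?y)) = s(0 := [], 4 := pick (b # w) y)"
    by (auto simp: fun_eq_iff)
  ultimately have 4: "run (Loop 0 pick_body) ?s2 (length w * (15 * m + 8) + 1) (s(0 := [], 4 := pick (b # w) y)) []"
    by (simp only:)
  show ?case by (rule run.While_True[OF _ body 4, unfolded append_Nil]) (use Cons.prems in auto)
qed

text \<open>A word carries two data: its length \<open>n\<close> selects the number
  \<open>t(2 ^ n)\<close>, and its value, leading zeros allowed, is a bit position in that
  number.\<close>

definition bit_language :: "machine trm \<Rightarrow> bool list set"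
  where "bit_language t = {w. let y = tval standard_model (\<lambda>_. 2 ^ length w) t in
    num_of w < len y \<and> bits_of y ! num_of w}"

lemma bit_language_in_P:
  assumes t: "PV_trm t" shows "bit_language t \<in> class_P"
proof -
  let ?body = "Switch 0 (\<lambda>a. if a = 0 then Skip else Pop 0 ;; Push 3 a ;; Push 2 1)"
  let ?out = "Switch 4 (\<lambda>a. if a = 2 then Emit True else Skip)"
  \<comment> \<open>The numeral of \<open>2 ^ n\<close> is built on stack 2: its leading bit is
    pushed at the start, and each bit of the input adds a zero on top. Stack 1 is left out, being
    the output tape.\<close>
  let ?p = "Push 2 2 ;; Loop 0 ?body ;; move_prog 3 0 ;; eval_prog (\<lambda>_. 2) 4 t ;; Loop 0 pick_body ;; ?out"
  let ?F = "\<lambda>ws. if hd ws \<in> bit_language t then [True] else []"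
  obtain \<tau> where \<tau>: "poly_bounded \<tau>" "eval_correct (\<lambda>_. 2) \<tau> t" using eval_correct_PV_trm[OF t] by blast
  obtain K0 S0 where wf: "\<And>K S. K0 \<le> K \<Longrightarrow> S0 \<le> S \<Longrightarrow> wf_prog 1 K S (eval_prog (\<lambda>_. 2) 4 t)"
    using wf_eval_prog(1)[OF t, of 1 4 "\<lambda>_. 2"] by force
  let ?\<tau> = "\<lambda>n. 2 + (n * 9 + 1) + (n * 7 + 1) + \<tau> (Suc n) + (n * (15 * \<tau> (Suc n) + 8) + 1) + 3"
  have "\<exists>M. computes 1 (\<lambda>_. True) M ?F"
  proof (rule computes_prog[where K = "K0 + 6" and S = "S0 + 3" and p = ?p and \<tau> = ?\<tau>])
    show "wf_prog 1 (K0 + 6) (S0 + 3) ?p"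
      using wf by (auto simp: pick_body_def evens_body_def intro!: wf_move_prog)
    show "poly_bounded ?\<tau>"
      by (intro poly_bounded_intros poly_bounded_compose[OF \<tau>(1)])
    fix ws :: "bool list list" assume "length ws = 1"
    then obtain w where ws: "ws = [w]" by (cases ws) auto
    let ?n = "length w" and ?W = "word_syms w"
    let ?y = "tval standard_model (\<lambda>_. 2 ^ ?n) t"
    define s0 where "s0 = init ws"
    have s0: "s0 0 = ?W" "\<And>i. 0 < i \<Longrightarrow> s0 i = []" by (auto simp: s0_def init_def ws)
    let ?\<sigma> = "\<lambda>k. s0(0 := drop k ?W, 3 := rev (take k ?W), 2 := replicate k 1 @ [2])"
    have 1: "run (Push 2 2) s0 2 (?\<sigma> 0) []"
      using s0 by (intro run_straight) (auto simp: fun_eq_iff)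
    have 2: "run (Loop 0 ?body) (?\<sigma> 0) (?n * 9 + 1) (?\<sigma> ?n) []"
    proof (rule run_While_iterate[where n = ?n and c = 7 and out = "\<lambda>_. []" and \<sigma> = ?\<sigma>])
      fix k assume k: "k < ?n"
      then have "drop k ?W = ?W ! k # drop (Suc k) ?W" "?W ! k \<noteq> 0" "take (Suc k) ?W = take k ?W @ [?W ! k]"
        by (auto simp: drop_nth nth_neq_0 take_Suc_conv_app_nth)
      then show "peek (?\<sigma> k 0) \<noteq> 0 \<and> run ?body (?\<sigma> k) 7 (?\<sigma> (Suc k)) []"
        by (auto simp: fun_eq_iff intro!: run_straight)
    qed auto
    let ?s3 = "s0(2 := word_syms (bits_of (2 ^ ?n)))"
    have "word_syms (bits_of (2 ^ ?n)) = replicate ?n 1 @ [2]"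
      by (simp add: bits_of_two_power word_syms_def bit_sym_def)
    then have 3: "run (move_prog 3 0) (?\<sigma> ?n) (?n * 7 + 1) ?s3 []"
      using s0 by (intro run_move) (auto simp: fun_eq_iff)
    have "holds_args (\<lambda>_. 2) 4 ?s3 (\<lambda>_. 2 ^ ?n) (Suc ?n) (tvars t)"
      using s0 length_bits_of[of "2 ^ ?n"] by (auto simp: holds_args_def bits_of_two_power simp del: length_bits_of)
    with \<tau>(2) have 4: "run (eval_prog (\<lambda>_. 2) 4 t) ?s3 (\<tau> (Suc ?n)) (?s3(4 := word_syms (bits_of ?y))) []"
      "len ?y \<le> \<tau> (Suc ?n)"
      unfolding eval_correct_def by blast+
    let ?s4 = "?s3(4 := word_syms (bits_of ?y))"
    let ?s5 = "?s4(0 := [], 4 := pick w (word_syms (bits_of ?y)))"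
    have 5: "run (Loop 0 pick_body) ?s4 (?n * (15 * \<tau> (Suc ?n) + 8) + 1) ?s5 []"
      using s0 4(2) by (intro run_pick_loop) auto
    have "peek (pick w (word_syms (bits_of ?y))) = 2 \<longleftrightarrow> w \<in> bit_language t"
    proof (cases "num_of w < len ?y")
      case True
      then have "pick w (word_syms (bits_of ?y)) \<noteq> []"
        "hd (pick w (word_syms (bits_of ?y))) = word_syms (bits_of ?y) ! num_of w"
        using pick_correct[of w "word_syms (bits_of ?y)"] by auto
      then have "peek (pick w (word_syms (bits_of ?y))) = bit_sym (bits_of ?y ! num_of w)"
        using True by (cases "pick w (word_syms (bits_of ?y))") (auto simp: word_syms_def)
      then show ?thesis using True by (simp add: bit_language_def Let_def)
    next
      case False
      then have "pick w (word_syms (bits_of ?y)) = []"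
        using pick_correct[of w "word_syms (bits_of ?y)"] by auto
      then show ?thesis using False by (simp add: bit_language_def Let_def)
    qed
    then have 6: "run ?out ?s5 3 ?s5 (?F ws)"
      by (intro run_straight) (auto simp: ws)
    show "\<exists>s'. run ?p (init ws) (?\<tau> (sum_list (map length ws))) s' (?F ws)"
      unfolding s0_def[symmetric]
      by (rule exI, rule run_SeqI[OF 1 run_SeqI[OF 2 run_SeqI[OF 3 run_SeqI[OF 4(1) run_SeqI[OF 5 6 order.refl] order.refl] order.refl] order.refl]])
        (auto simp: ws)
  qed auto
  then obtain M where "computes 1 (\<lambda>_. True) M ?F" by blast
  then have "clocked_machine M" "inputs M = 1" "\<And>w. out_of M [w] = (if w \<in> bit_language t then [True] else [])"
    by (auto simp: computes_def)
  then have "clocked_machine M \<and> inputs M = 1 \<and> (\<forall>w. w \<in> bit_language t \<longleftrightarrow> out_of M [w] = [True])"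
    by simp
  then show ?thesis unfolding class_P_def by blast
qed

section \<open>The generator\<close>

text \<open>
  An instruction takes three bits, and \<open>OpNone\<close> is coded by ones only.  Hence programs can be padded
  with ones to any length, multiple of three or not; an incomplete last instruction is ignored.
\<close>

datatype oper = OpLeft | OpRight | OpLoad | OpAnd | OpOr | OpNot | OpStore | OpNone

fun decode :: "bool \<Rightarrow> bool \<Rightarrow> bool \<Rightarrow> oper"
  where
    "decode False False False = OpLeft"
  | "decode False False True = OpRight"
  | "decode False True False = OpLoad"
  | "decode False True True = OpAnd"
  | "decode True False False = OpOr"
  | "decode True False True = OpNot"
  | "decode True True False = OpStore"
  | "decode True True True = OpNone"

text \<open>An exhausted list stands for zeros: the memory is infinite in both directions and
  initially zero.\<close>

definition head_bit :: "bool list \<Rightarrow> bool"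
  where "head_bit R \<longleftrightarrow> R \<noteq> [] \<and> hd R"

fun apply_op :: "oper \<Rightarrow> bool list \<times> bool list \<times> bool \<Rightarrow> bool list \<times> bool list \<times> bool"
  where
    "apply_op OpLeft (L, R, a) = (tl L, head_bit L # R, a)"
  | "apply_op OpRight (L, R, a) = (head_bit R # L, tl R, a)"
  | "apply_op OpLoad (L, R, a) = (L, R, head_bit R)"
  | "apply_op OpAnd (L, R, a) = (L, R, a \<and> head_bit R)"
  | "apply_op OpOr (L, R, a) = (L, R, a \<or> head_bit R)"
  | "apply_op OpNot (L, R, a) = (L, R, \<not> a)"
  | "apply_op OpStore (L, R, a) = (L, a # tl R, a)"
  | "apply_op OpNone (L, R, a) = (L, R, a)"

fun exec_word :: "bool list \<Rightarrow> bool list \<times> bool list \<times> bool \<Rightarrow> bool list \<times> bool list \<times> bool"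
  where
    "exec_word (a # b # c # w) \<sigma> = exec_word w (apply_op (decode a b c) \<sigma>)"
  | "exec_word w \<sigma> = \<sigma>"

definition acc_prog :: "(bool \<Rightarrow> bool \<Rightarrow> bool) \<Rightarrow> prog"
  where "acc_prog f = Switch 5 (\<lambda>c. Switch 6 (\<lambda>a. Pop 6 ;; (if f (a = 2) (c = 2) then Push 6 2 else Skip)))"

fun oper_prog :: "oper \<Rightarrow> prog"
  where
    "oper_prog OpLeft = Switch 4 (\<lambda>c. Pop 4 ;; Push 5 (if c = 2 then 2 else 1))"
  | "oper_prog OpRight = Switch 5 (\<lambda>c. Pop 5 ;; Push 4 (if c = 2 then 2 else 1))"
  | "oper_prog OpLoad = acc_prog (\<lambda>a c. c)"
  | "oper_prog OpAnd = acc_prog (\<lambda>a c. a \<and> c)"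
  | "oper_prog OpOr = acc_prog (\<lambda>a c. a \<or> c)"
  | "oper_prog OpNot = acc_prog (\<lambda>a c. \<not> a)"
  | "oper_prog OpStore = Switch 6 (\<lambda>a. Pop 5 ;; Push 5 (if a = 2 then 2 else 1))"
  | "oper_prog OpNone = Skip"

text \<open>
  Stack 0 holds the program, stack 2 its part already read, stack 3 the remaining rounds in unary,
  stacks 4 and 5 the memory left and right of the head, stack 6 the accumulator.
\<close>

fun put :: "(nat \<Rightarrow> nat list) \<Rightarrow> bool list \<times> bool list \<times> bool \<Rightarrow> nat \<Rightarrow> nat list"
  where "put s (L, R, a) = s(4 := word_syms L, 5 := word_syms R, 6 := flag a)"

lemma run_oper_prog: "run (oper_prog x) (put s \<sigma>) 8 (put s (apply_op x \<sigma>)) []"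
proof -
  obtain L R a where \<sigma>: "\<sigma> = (L, R, a)" by (metis prod_cases3)
  show ?thesis
    unfolding \<sigma>
    by (cases x; cases L; cases R; intro run_straight)
      (auto simp: acc_prog_def head_bit_def flag_def fun_eq_iff bit_sym_def)
qed

lemma wf_oper_prog: "7 \<le> K \<Longrightarrow> 3 \<le> S \<Longrightarrow> wf_prog 1 K S (oper_prog x)"
  by (cases x) (auto simp: acc_prog_def)

definition token_prog :: prog
  where "token_prog =
    Switch 0 (\<lambda>a. if a = 0 then Skip else Pop 0 ;; Push 2 a ;;
    Switch 0 (\<lambda>b. if b = 0 then Skip else Pop 0 ;; Push 2 b ;;
    Switch 0 (\<lambda>c. if c = 0 then Skip else Pop 0 ;; Push 2 c ;;
      oper_prog (decode (a = 2) (b = 2) (c = 2)))))"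

lemma run_shift:
  assumes "s 0 = a # w" and "a \<noteq> 0" and "run (p a) (s(0 := w, 2 := a # s 2)) t s' os"
  shows "run (Switch 0 (\<lambda>a. if a = 0 then Skip else Pop 0 ;; Push 2 a ;; p a)) s (t + 5) s' os"
proof -
  have 1: "run (Pop 0) s 1 (s(0 := w)) []" using assms by (intro run_straight) auto
  have 2: "run (Push 2 a) (s(0 := w)) 2 (s(0 := w, 2 := a # s 2)) []" by (intro run_straight) auto
  have "run (Pop 0 ;; Push 2 a ;; p a) s (t + 3) s' os"
    by (rule run_SeqI[OF 1 run_SeqI[OF 2 assms(3) order.refl refl]]) auto
  then show ?thesis using assms(1,2) by (intro run.Switch) auto
qed

lemma put_other: "i \<noteq> 4 \<Longrightarrow> i \<noteq> 5 \<Longrightarrow> i \<noteq> 6 \<Longrightarrow> put s \<sigma> i = s i"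
  by (cases \<sigma>) auto

lemma put_upd: "i \<noteq> 4 \<Longrightarrow> i \<noteq> 5 \<Longrightarrow> i \<noteq> 6 \<Longrightarrow> (put s \<sigma>)(i := w) = put (s(i := w)) \<sigma>"
  by (cases \<sigma>) (auto simp: fun_eq_iff)

lemma run_token_loop:
  "s 0 = word_syms w \<Longrightarrow> run (Loop 0 token_prog) (put s \<sigma>) (length w * 25 + 1)
    (put (s(0 := [], 2 := rev (word_syms w) @ s 2)) (exec_word w \<sigma>)) []"
proof (induction w \<sigma> arbitrary: s rule: exec_word.induct)
  case (1 a b c w \<sigma>)
  let ?\<sigma> = "apply_op (decode a b c) \<sigma>"
  let ?s1 = "s(0 := word_syms w, 2 := bit_sym c # bit_sym b # bit_sym a # s 2)"
  have "run (oper_prog (decode (bit_sym a = 2) (bit_sym b = 2) (bit_sym c = 2))) (put ?s1 \<sigma>) 8 (put ?s1 ?\<sigma>) []"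
    using run_oper_prog by simp
  then have body: "run token_prog (put s \<sigma>) (8 + 5 + 5 + 5) (put ?s1 ?\<sigma>) []"
    unfolding token_prog_def
    by (intro run_shift[where w = "word_syms (b # c # w)"] run_shift[where w = "word_syms (c # w)"] run_shift[where w = "word_syms w"])
      (auto simp: "1.prems" put_other put_upd)
  have "run (Loop 0 token_prog) (put ?s1 ?\<sigma>) (length w * 25 + 1)
      (put (?s1(0 := [], 2 := rev (word_syms w) @ ?s1 2)) (exec_word w ?\<sigma>)) []"
    by (intro "1.IH") auto
  moreover have "?s1(0 := [], 2 := rev (word_syms w) @ ?s1 2) = s(0 := [], 2 := rev (word_syms (a # b # c # w)) @ s 2)"
    by (auto simp: fun_eq_iff)
  ultimately have rest: "run (Loop 0 token_prog) (put ?s1 ?\<sigma>) (length w * 25 + 1)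
      (put (s(0 := [], 2 := rev (word_syms (a # b # c # w)) @ s 2)) (exec_word (a # b # c # w) \<sigma>)) []"
    by (simp only: exec_word.simps)
  show ?case
    by (rule run.While_True[OF _ body rest, unfolded append_Nil]) (use "1.prems" in \<open>auto simp: put_other\<close>)
next
  case ("2_1" \<sigma>)
  then show ?case by (auto simp: fun_upd_idem put_other intro: run.While_False)
next
  case ("2_2" a \<sigma>)
  let ?s1 = "s(0 := [], 2 := rev (word_syms [a]) @ s 2)"
  have "run Skip (put ?s1 \<sigma>) 0 (put ?s1 \<sigma>) []" by (rule run.Skip)
  then have body: "run token_prog (put s \<sigma>) ((0 + 2) + 5) (put ?s1 \<sigma>) []"
    unfolding token_prog_def
    by (intro run_shift[where w = "[]"] run.Switch) (use "2_2" in \<open>auto simp: put_other put_upd\<close>)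
  have rest: "run (Loop 0 token_prog) (put ?s1 \<sigma>) 1 (put ?s1 \<sigma>) []"
    by (rule run.While_False) (auto simp: put_other)
  show ?case
    unfolding exec_word.simps by (rule run.While_True[OF _ body rest, unfolded append_Nil]) (use "2_2" in \<open>auto simp: put_other\<close>)
next
  case ("2_3" a b \<sigma>)
  let ?s1 = "s(0 := [], 2 := rev (word_syms [a, b]) @ s 2)"
  have "run Skip (put ?s1 \<sigma>) 0 (put ?s1 \<sigma>) []" by (rule run.Skip)
  then have body: "run token_prog (put s \<sigma>) ((0 + 2) + 5 + 5) (put ?s1 \<sigma>) []"
    unfolding token_prog_def
    by (intro run_shift[where w = "word_syms [b]"] run_shift[where w = "[]"] run.Switch) (use "2_3" in \<open>auto simp: put_other put_upd\<close>)
  have rest: "run (Loop 0 token_prog) (put ?s1 \<sigma>) 1 (put ?s1 \<sigma>) []"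
    by (rule run.While_False) (auto simp: put_other)
  show ?case
    unfolding exec_word.simps by (rule run.While_True[OF _ body rest, unfolded append_Nil]) (use "2_3" in \<open>auto simp: put_other\<close>)
qed

definition iterate_prog :: prog
  where "iterate_prog = Pop 3 ;; Loop 0 token_prog ;; move_prog 2 0 ;; Switch 6 (\<lambda>a. Emit (a = 2))"

definition gen_out :: "bool list \<Rightarrow> bool list"
  where "gen_out w = map (\<lambda>i. snd (snd ((exec_word w ^^ Suc i) ([], [], False)))) [0..<length w] @ [True]"

text \<open>Every operation acts at the head in constant time, so a round takes time linear in the
  program length whatever the memory holds, and all rounds together take quadratic time. The tokens
  read pile up on stack 2, from where one move restores the program.\<close>

lemma computes_gen_out: "\<exists>g. computes 1 (\<lambda>_. True) g (\<lambda>ws. gen_out (hd ws))"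
proof -
  let ?copy = "Switch 0 (\<lambda>a. if a = 0 then Skip else Pop 0 ;; Push 2 a ;; Push 3 1)"
  let ?p = "Loop 0 ?copy ;; move_prog 2 0 ;; Loop 3 iterate_prog ;; Emit True"
  let ?\<tau> = "\<lambda>n. (n * 9 + 1) + (n * 7 + 1) + (n * (n * 32 + 6 + 2) + 1) + 1"
  show ?thesis
  proof (rule computes_prog[where K = 7 and S = 3 and p = ?p and \<tau> = ?\<tau>])
    show "wf_prog 1 7 3 ?p"
      by (auto simp: iterate_prog_def token_prog_def intro!: wf_move_prog wf_oper_prog[unfolded One_nat_def])
    show "poly_bounded ?\<tau>" by (intro poly_bounded_intros)
    fix ws :: "bool list list" assume "length ws = 1"
    then obtain w where ws: "ws = [w]" by (cases ws) auto
    let ?n = "length w" and ?W = "word_syms w"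
    define s0 where "s0 = init ws"
    have s0: "s0 0 = ?W" "\<And>i. 0 < i \<Longrightarrow> s0 i = []" by (auto simp: s0_def init_def ws)
    let ?\<sigma> = "\<lambda>k. s0(0 := drop k ?W, 2 := rev (take k ?W), 3 := replicate k 1)"
    have 1: "run (Loop 0 ?copy) s0 (?n * 9 + 1) (?\<sigma> ?n) []"
    proof (rule run_While_iterate[where n = ?n and c = 7 and out = "\<lambda>_. []" and \<sigma> = ?\<sigma>])
      fix k assume k: "k < ?n"
      then have "drop k ?W = ?W ! k # drop (Suc k) ?W" "?W ! k \<noteq> 0" "take (Suc k) ?W = take k ?W @ [?W ! k]"
        by (auto simp: drop_nth nth_neq_0 take_Suc_conv_app_nth)
      then show "peek (?\<sigma> k 0) \<noteq> 0 \<and> run ?copy (?\<sigma> k) 7 (?\<sigma> (Suc k)) []"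
        by (auto simp: fun_eq_iff intro!: run_straight)
    qed (use s0 in \<open>auto simp: fun_eq_iff\<close>)
    define st where "st k = (exec_word w ^^ k) ([], [], False)" for k
    define \<rho> where "\<rho> k = put (s0(3 := replicate (?n - k) 1)) (st k)" for k
    have 2: "run (move_prog 2 0) (?\<sigma> ?n) (?n * 7 + 1) (\<rho> 0) []"
      using s0 by (intro run_move) (auto simp: fun_eq_iff \<rho>_def st_def flag_def)
    have body: "run iterate_prog (\<rho> k) (?n * 32 + 6) (\<rho> (Suc k)) [snd (snd (st (Suc k)))]" if k: "k < ?n" for k
    proof -
      let ?r = "s0(3 := replicate (?n - Suc k) 1)"
      have "?n - k = Suc (?n - Suc k)" using k by simp
      then have 1: "run (Pop 3) (\<rho> k) 1 (put ?r (st k)) []"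
        by (intro run_straight) (auto simp: \<rho>_def put_other put_upd)
      have 2: "run (Loop 0 token_prog) (put ?r (st k)) (?n * 25 + 1)
          (put (?r(0 := [], 2 := rev ?W @ ?r 2)) (exec_word w (st k))) []"
        using s0 by (intro run_token_loop) auto
      have "st (Suc k) = exec_word w (st k)" by (simp add: st_def)
      then have "\<rho> (Suc k) = put ?r (exec_word w (st k))" by (simp only: \<rho>_def)
      moreover have "?r = (?r(0 := [], 2 := rev ?W @ ?r 2))(2 := [], 0 := ?W)"
        using s0 by (auto simp: fun_eq_iff)
      ultimately have "\<rho> (Suc k) = put ((?r(0 := [], 2 := rev ?W @ ?r 2))(2 := [], 0 := ?W)) (exec_word w (st k))"
        by metis
      then have 3: "run (move_prog 2 0) (put (?r(0 := [], 2 := rev ?W @ ?r 2)) (exec_word w (st k))) (?n * 7 + 1) (\<rho> (Suc k)) []"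
        using s0 by (intro run_move) (auto simp: put_other put_upd)
      have 4: "run (Switch 6 (\<lambda>a. Emit (a = 2))) (\<rho> (Suc k)) 3 (\<rho> (Suc k)) [snd (snd (st (Suc k)))]"
        by (cases "st (Suc k)"; intro run_straight) (auto simp: \<rho>_def flag_def)
      show ?thesis
        unfolding iterate_prog_def by (rule run_SeqI[OF 1 run_SeqI[OF 2 run_SeqI[OF 3 4 order.refl] order.refl]]) auto
    qed
    have 3: "run (Loop 3 iterate_prog) (\<rho> 0) (?n * (?n * 32 + 6 + 2) + 1) (\<rho> ?n)
        (map (\<lambda>i. snd (snd (st (Suc i)))) [0..<?n])"
    proof (rule run_While_iterate[where n = ?n and c = "?n * 32 + 6" and out = "\<lambda>k. [snd (snd (st (Suc k)))]" and \<sigma> = \<rho>])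
      fix k assume k: "k < ?n"
      have "peek (\<rho> k 3) \<noteq> 0" using k by (cases "?n - k") (auto simp: \<rho>_def put_other)
      with body[OF k] show "peek (\<rho> k 3) \<noteq> 0 \<and> run iterate_prog (\<rho> k) (?n * 32 + 6) (\<rho> (Suc k)) [snd (snd (st (Suc k)))]"
        by blast
    qed (auto simp: \<rho>_def put_other)
    have 4: "run (Emit True) (\<rho> ?n) 1 (\<rho> ?n) [True]" by (rule run.Emit) simp
    have "run ?p s0 (?\<tau> ?n) (\<rho> ?n) (gen_out w)"
      by (rule run_SeqI[OF 1 run_SeqI[OF 2 run_SeqI[OF 3 4 order.refl refl] order.refl refl]])
        (auto simp: gen_out_def st_def)
    then show "\<exists>s'. run ?p (init ws) (?\<tau> (sum_list (map length ws))) s' (gen_out (hd ws))"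
      by (auto simp: ws s0_def)
  qed auto
qed

text \<open>The closing 1 becomes the leading bit, so the value has length exactly
  \<open>Suc (len x)\<close> whatever the program emits; hence \<open>m\<close> is
  \<open>Suc\<close>.\<close>

lemma generator_gen_out:
  obtains g where "generator g" "\<And>x. fun_of g [x] = num_of (gen_out (bits_of x))"
proof -
  obtain g where g: "computes 1 (\<lambda>_. True) g (\<lambda>ws. gen_out (hd ws))"
    using computes_gen_out by blast
  then have f: "fun_of g [x] = num_of (gen_out (bits_of x))" for x
    by (auto simp: computes_def fun_of_def)
  have "len (fun_of g [x]) = Suc (len x)" for x
    unfolding f by (subst len_num_of) (auto simp: gen_out_def)
  then have "generator g"
    using g unfolding generator_def computes_def by (auto intro!: exI[of _ Suc])
  then show ?thesis using f by (rule that)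
qed

section \<open>Straight-line programs for circuits\<close>

primrec encode :: "oper \<Rightarrow> bool list"
  where
    "encode OpLeft = [False, False, False]"
  | "encode OpRight = [False, False, True]"
  | "encode OpLoad = [False, True, False]"
  | "encode OpAnd = [False, True, True]"
  | "encode OpOr = [True, False, False]"
  | "encode OpNot = [True, False, True]"
  | "encode OpStore = [True, True, False]"
  | "encode OpNone = [True, True, True]"

lemma exec_word_encode: "exec_word (concat (map encode xs) @ w) \<sigma> = exec_word w (fold apply_op xs \<sigma>)"
proof (induction xs arbitrary: \<sigma>)
  case (Cons x xs)
  then show ?case by (cases x) auto
qed simp

lemma exec_word_padding: "exec_word (replicate m True) \<sigma> = \<sigma>"
proof (induction m rule: less_induct)
  case (less m)
  obtain L R a where \<sigma>: "\<sigma> = (L, R, a)" by (metis prod_cases3)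
  consider "m = 0" | "m = 1" | "m = 2" | k where "m = Suc (Suc (Suc k))"
    by (metis One_nat_def Suc_1 old.nat.exhaust)
  then show ?case
  proof cases
    case 4
    then show ?thesis using less.IH[of k] by (simp add: \<sigma>)
  qed (auto simp: numeral_2_eq_2)
qed

lemma length_encode: "length (concat (map encode xs)) = 3 * length xs"
proof (induction xs)
  case (Cons x xs)
  then show ?case by (cases x) auto
qed simp

section \<open>Addressable memory on top of a moving head\<close>

datatype macro = Load nat | And nat | Or nat | Not | Store nat

fun exec_macro :: "macro \<Rightarrow> (nat \<Rightarrow> bool) \<times> bool \<Rightarrow> (nat \<Rightarrow> bool) \<times> bool"
  where
    "exec_macro (Load i) (f, a) = (f, f i)"
  | "exec_macro (And i) (f, a) = (f, a \<and> f i)"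
  | "exec_macro (Or i) (f, a) = (f, a \<or> f i)"
  | "exec_macro Not (f, a) = (f, \<not> a)"
  | "exec_macro (Store i) (f, a) = (f(i := a), a)"

text \<open>Between macros the head rests on cell 0, so each access walks there and back. This makes
  the code quadratic in the size of the circuit.\<close>

definition at_cell :: "nat \<Rightarrow> oper \<Rightarrow> oper list"
  where "at_cell i x = replicate i OpRight @ [x] @ replicate i OpLeft"

fun assemble :: "macro \<Rightarrow> oper list"
  where
    "assemble (Load i) = at_cell i OpLoad"
  | "assemble (And i) = at_cell i OpAnd"
  | "assemble (Or i) = at_cell i OpOr"
  | "assemble Not = [OpNot]"
  | "assemble (Store i) = at_cell i OpStore"

definition mem :: "bool list \<Rightarrow> nat \<Rightarrow> bool"
  where "mem R i \<longleftrightarrow> i < length R \<and> R ! i"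

text \<open>Walking over cells beyond the end of the list makes them explicit zeros: the list grows
  while \<open>mem\<close> stays the same.\<close>

definition padded :: "nat \<Rightarrow> bool list \<Rightarrow> bool list"
  where "padded i R = map (mem R) [0..<i]"

lemma head_bit_drop: "head_bit (drop i R) = mem R i"
  by (cases "i < length R") (auto simp: head_bit_def mem_def hd_drop_conv_nth)

lemma fold_right:
  "fold apply_op (replicate i OpRight) (L, R, a) = (rev (padded i R) @ L, drop i R, a)"
proof (induction i)
  case (Suc i)
  have "fold apply_op (replicate (Suc i) OpRight) (L, R, a) =
      apply_op OpRight (fold apply_op (replicate i OpRight) (L, R, a))"
    by (simp add: replicate_append_same[symmetric] del: replicate.simps(2) fold_simps)
  then show ?case unfolding Suc by (simp add: padded_def head_bit_drop tl_drop drop_Suc)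
qed (simp add: padded_def)

lemma fold_left: "fold apply_op (replicate (length P) OpLeft) (rev P @ L, R, a) = (L, P @ R, a)"
proof (induction P arbitrary: R rule: rev_induct)
  case (snoc x P)
  then show ?case by (simp add: head_bit_def)
qed simp

lemma length_padded [simp]: "length (padded i R) = i"
  by (simp add: padded_def)

lemma fold_at_cell:
  assumes "apply_op x (rev (padded i R), drop i R, a) = (rev (padded i R), R', a')"
  shows "fold apply_op (at_cell i x) ([], R, a) = ([], padded i R @ R', a')"
  using fold_right[of i "[]" R a] fold_left[of "padded i R" "[]" R' a'] assms
  by (simp add: at_cell_def)

lemma mem_padded: "mem (padded i R @ drop i R) = mem R"
  by (auto simp: fun_eq_iff mem_def padded_def nth_append)

lemma mem_store: "mem (padded i R @ a # tl (drop i R)) = (mem R)(i := a)"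
proof
  fix j
  consider "j < i" | "j = i" | "i < j" by linarith
  then show "mem (padded i R @ a # tl (drop i R)) j = ((mem R)(i := a)) j"
  proof cases
    case 3
    then obtain k where "j = Suc (i + k)" using less_imp_Suc_add by blast
    then show ?thesis by (auto simp: mem_def nth_append tl_drop[symmetric] nth_tl)
  qed (auto simp: mem_def padded_def nth_append)
qed

lemma fold_assemble:
  "\<exists>R'. fold apply_op (assemble x) ([], R, a) = ([], R', snd (exec_macro x (mem R, a))) \<and>
    mem R' = fst (exec_macro x (mem R, a))"
  by (cases x) (auto simp: fold_at_cell head_bit_drop mem_padded mem_store)

lemma fold_assemble_all:
  "\<exists>R'. fold apply_op (concat (map assemble P)) ([], R, a) = ([], R', snd (fold exec_macro P (mem R, a))) \<and>
    mem R' = fst (fold exec_macro P (mem R, a))"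
proof (induction P arbitrary: R a)
  case (Cons x P)
  obtain R1 where R1: "fold apply_op (assemble x) ([], R, a) = ([], R1, snd (exec_macro x (mem R, a)))"
    "mem R1 = fst (exec_macro x (mem R, a))" using fold_assemble by blast
  from Cons[of R1 "snd (exec_macro x (mem R, a))"] show ?case
    by (simp add: R1 del: fun_upd_apply)
qed simp

lemma length_assemble:
  assumes "\<And>x. x \<in> set P \<Longrightarrow> length (assemble x) \<le> B"
  shows "length (concat (map assemble P)) \<le> length P * B"
  using assms by (induction P) (auto simp: add_mono)

text \<open>
  Memory layout: the counter in cells \<open>0, \<dots>, n - 1\<close>, the carry in cell \<open>n\<close>, scratch in cells \<open>n + 1\<close>
  and \<open>n + 2\<close>, the value of gate \<open>j\<close> in cell \<open>n + 3 + j\<close>.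
\<close>

fun gate_macros :: "nat \<Rightarrow> nat \<Rightarrow> gate \<Rightarrow> macro list"
  where
    "gate_macros n j (In_gate a) = [Load a, Store (n + 3 + j)]"
  | "gate_macros n j (Const_gate b) = [Load n, Not, Or n] @ (if b then [] else [Not]) @ [Store (n + 3 + j)]"
  | "gate_macros n j (Not_gate a) = [Load (n + 3 + a), Not, Store (n + 3 + j)]"
  | "gate_macros n j (And_gate a b) = [Load (n + 3 + a), And (n + 3 + b), Store (n + 3 + j)]"
  | "gate_macros n j (Or_gate a b) = [Load (n + 3 + a), Or (n + 3 + b), Store (n + 3 + j)]"

definition gate_vals :: "circuit \<Rightarrow> bool list \<Rightarrow> bool list"
  where "gate_vals C w = foldl (\<lambda>vs g. vs @ [gate_val w vs g]) [] C"

lemma gate_vals_snoc: "gate_vals (C @ [g]) w = gate_vals C w @ [gate_val w (gate_vals C w) g]"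
  by (simp add: gate_vals_def)

lemma length_gate_vals: "length (gate_vals C w) = length C"
  by (induction C rule: rev_induct) (auto simp: gate_vals_def)

definition circuit_macros :: "nat \<Rightarrow> circuit \<Rightarrow> macro list"
  where "circuit_macros n C = concat (map (\<lambda>j. gate_macros n j (C ! j)) [0..<length C])"

lemma gate_macros_correct:
  assumes "gate_ok n j g" and "\<And>i. i < j \<Longrightarrow> f (n + 3 + i) = vs ! i" and "w = map f [0..<n]"
  shows "\<exists>a'. fold exec_macro (gate_macros n j g) (f, a) = (f(n + 3 + j := gate_val w vs g), a')"
  using assms by (cases g) auto

text \<open>The memory outside the counter is arbitrary, as later rounds find the gate values of
  earlier ones there. No harm is done, because the arguments of a gate are overwritten before they
  are read.\<close>

lemma circuit_macros_correct:
  assumes "\<forall>i<length C. gate_ok n i (C ! i)" and "w = map f [0..<n]"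
  shows "\<exists>f' a'. fold exec_macro (circuit_macros n C) (f, a) = (f', a') \<and>
    (\<forall>i<n. f' i = f i) \<and> (\<forall>j<length C. f' (n + 3 + j) = gate_vals C w ! j)"
  using assms(1)
proof (induction C rule: rev_induct)
  case Nil
  then show ?case by (simp add: circuit_macros_def)
next
  case (snoc g C)
  have "\<forall>i<length C. gate_ok n i (C ! i)"
  proof (intro allI impI)
    fix i assume "i < length C"
    then show "gate_ok n i (C ! i)" using snoc.prems[rule_format, of i] by (simp add: nth_append)
  qed
  with snoc.IH obtain f1 a1 where 1: "fold exec_macro (circuit_macros n C) (f, a) = (f1, a1)"
    "\<forall>i<n. f1 i = f i" "\<forall>j<length C. f1 (n + 3 + j) = gate_vals C w ! j" by blast
  have "circuit_macros n (C @ [g]) = circuit_macros n C @ gate_macros n (length C) g"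
    by (auto simp: circuit_macros_def nth_append intro!: arg_cong[where f = concat])
  moreover have "gate_ok n (length C) g" using snoc.prems[rule_format, of "length C"] by simp
  moreover have "w = map f1 [0..<n]" using 1(2) assms(2) by simp
  ultimately obtain a2 where 2: "fold exec_macro (circuit_macros n (C @ [g])) (f, a) =
      (f1(n + 3 + length C := gate_val w (gate_vals C w) g), a2)"
    using gate_macros_correct[of n "length C" g f1 "gate_vals C w" w a1] 1 by auto
  show ?case
    by (intro exI conjI, rule 2)
      (use 1(2,3) in \<open>auto simp: gate_vals_snoc nth_append length_gate_vals less_Suc_eq\<close>)
qed

text \<open>A half adder: cell \<open>n + 1\<close> receives the new carry, cell
  \<open>n + 2\<close> its negation, and the new bit is the disjunction of old bit and carry
  restricted by that negation, that is, their exclusive or.\<close>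

definition inc_step :: "nat \<Rightarrow> nat \<Rightarrow> macro list"
  where "inc_step n i = [Load i, And n, Store (n + 1), Not, Store (n + 2), Load i, Or n, And (n + 2),
    Store i, Load (n + 1), Store n]"

text \<open>The prefix computes "x or not x" from the unknown contents of cell \<open>n\<close> and
  thereby sets the initial carry to 1.\<close>

definition inc_macros :: "nat \<Rightarrow> nat \<Rightarrow> macro list"
  where "inc_macros n m = [Load n, Not, Or n, Store n] @ concat (map (inc_step n) [0..<m])"

lemma inc_macros_correct:
  assumes "m \<le> n"
  shows "\<exists>f' a'. fold exec_macro (inc_macros n m) (f, a) = (f', a') \<and>
    f' n = (\<forall>k<m. f k) \<and> (\<forall>j<n. f' j = (if j < m then f j \<noteq> (\<forall>k<j. f k) else f j)) \<and>
    (\<forall>j>n + 2. f' j = f j)"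
  using assms
proof (induction m)
  case 0
  then show ?case by (auto simp: inc_macros_def)
next
  case (Suc m)
  then obtain f1 a1 where 1: "fold exec_macro (inc_macros n m) (f, a) = (f1, a1)"
    and n: "f1 n = (\<forall>k<m. f k)" and j: "\<And>j. j < n \<Longrightarrow> f1 j = (if j < m then f j \<noteq> (\<forall>k<j. f k) else f j)"
    and up: "\<And>j. n + 2 < j \<Longrightarrow> f1 j = f j"
    by auto
  have m: "m < n" using Suc.prems by simp
  let ?f = "f1(n + 1 := f1 m \<and> f1 n, n + 2 := \<not> (f1 m \<and> f1 n),
      m := (f1 m \<or> f1 n) \<and> \<not> (f1 m \<and> f1 n), n := f1 m \<and> f1 n)"
  have "fold exec_macro (inc_step n m) (f1, a1) = (?f, f1 m \<and> f1 n)"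
    using m by (simp add: inc_step_def)
  then have 2: "fold exec_macro (inc_macros n (Suc m)) (f, a) = (?f, f1 m \<and> f1 n)"
    using 1 by (simp add: inc_macros_def)
  show ?case
  proof (intro exI conjI, rule 2)
    show "?f n = (\<forall>k<Suc m. f k)" using n j[OF m] by (auto simp: less_Suc_eq)
    show "\<forall>i<n. ?f i = (if i < Suc m then f i \<noteq> (\<forall>k<i. f k) else f i)"
      using n j m by (auto simp: less_Suc_eq)
    show "\<forall>j>n + 2. ?f j = f j" using up m by auto
  qed
qed

text \<open>A carry reaches position \<open>j\<close> iff all lower bits are ones. Halving
  \<open>v\<close> gives the induction, the carry out of bit 0 being \<open>odd v\<close>.\<close>

lemma bit_increment: "bit (v + 1) j \<longleftrightarrow> bit v j \<noteq> (\<forall>k<j. bit v k)" for v :: nat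
proof (induction j arbitrary: v)
  case 0
  then show ?case by (simp add: bit_0)
next
  case (Suc j)
  have all: "(\<forall>k<Suc j. bit v k) \<longleftrightarrow> odd v \<and> (\<forall>k<j. bit (v div 2) k)"
    by (auto simp: bit_0 bit_Suc less_Suc_eq_0_disj all_simps)
  show ?case
  proof (cases "odd v")
    case True
    then have "(v + 1) div 2 = v div 2 + 1" by presburger
    then show ?thesis using Suc[of "v div 2"] True all by (simp only: bit_Suc) auto
  next
    case False
    then have "(v + 1) div 2 = v div 2" by presburger
    then show ?thesis using False all by (simp only: bit_Suc) auto
  qed
qed

text \<open>The generator emits the accumulator at the end of a round, so the output gate is loaded
  last; the increment leaves the cells of the gates untouched.\<close>

definition round_macros :: "nat \<Rightarrow> circuit \<Rightarrow> macro list"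
  where "round_macros n C = circuit_macros n C @ inc_macros n n @ [Load (n + 3 + (length C - 1))]"

lemma round_macros_correct:
  fixes v :: nat
  assumes C: "circuit n C" and f: "\<And>i. i < n \<Longrightarrow> f i = bit v i"
  shows "\<exists>f'. fold exec_macro (round_macros n C) (f, a) = (f', circuit_val C (map (bit v) [0..<n])) \<and>
    (\<forall>i<n. f' i = bit (v + 1) i)"
proof -
  have ok: "\<forall>i<length C. gate_ok n i (C ! i)" "C \<noteq> []" using C by (auto simp: circuit_def)
  have w: "map (bit v) [0..<n] = map f [0..<n]" using f by auto
  obtain f1 a1 where 1: "fold exec_macro (circuit_macros n C) (f, a) = (f1, a1)" "\<forall>i<n. f1 i = f i"
    "\<forall>j<length C. f1 (n + 3 + j) = gate_vals C (map (bit v) [0..<n]) ! j"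
    using circuit_macros_correct[OF ok(1) w] by blast
  obtain f2 a2 where 2: "fold exec_macro (inc_macros n n) (f1, a1) = (f2, a2)"
    "\<forall>j<n. f2 j = (f1 j \<noteq> (\<forall>k<j. f1 k))" "\<forall>j>n + 2. f2 j = f1 j"
    using inc_macros_correct[of n n f1 a1] by auto
  have "f2 (n + 3 + (length C - 1)) = circuit_val C (map (bit v) [0..<n])"
  proof -
    have "gate_vals C w \<noteq> []" for w using ok(2) length_gate_vals[of C w] by auto
    then have "circuit_val C w = gate_vals C w ! (length C - 1)" for w
      unfolding circuit_val_def gate_vals_def[symmetric] by (simp add: last_conv_nth length_gate_vals)
    then show ?thesis using 1(3) 2(3) ok(2) by simp
  qed
  moreover have "\<forall>i<n. f2 i = bit (v + 1) i"
    unfolding bit_increment using 1(2) 2(2) f by auto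
  ultimately show ?thesis
    using 1(1) 2(1) by (intro exI[of _ f2]) (simp add: round_macros_def)
qed

definition circuit_code :: "nat \<Rightarrow> circuit \<Rightarrow> bool list"
  where "circuit_code n C = concat (map encode (concat (map assemble (round_macros n C))))"

text \<open>The invariant is that before round \<open>i\<close> the head is back on cell 0 and the
  counter holds the lowest \<open>n\<close> bits of \<open>i\<close>. The empty memory represents
  counter 0.\<close>

lemma exec_circuit_code:
  assumes C: "circuit n C"
  defines "w m \<equiv> circuit_code n C @ replicate m True"
  shows "snd (snd ((exec_word (w m) ^^ Suc i) ([], [], False))) = circuit_val C (map (bit i) [0..<n])"
proof -
  have step: "\<exists>R' . exec_word (w m) ([], R, a) = ([], R', circuit_val C (map (bit v) [0..<n])) \<and>
      (\<forall>i<n. mem R' i = bit (v + 1) i)" if "\<And>i. i < n \<Longrightarrow> mem R i = bit v i" for R a and v :: nat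
  proof -
    have "exec_word (w m) ([], R, a) = fold apply_op (concat (map assemble (round_macros n C))) ([], R, a)"
      by (simp add: w_def circuit_code_def exec_word_encode exec_word_padding)
    with fold_assemble_all[of "round_macros n C" R a] round_macros_correct[OF C that, of a]
    show ?thesis by auto
  qed
  have "\<exists>R a. (exec_word (w m) ^^ i) ([], [], False) = ([], R, a) \<and> (\<forall>j<n. mem R j = bit i j)" for i
  proof (induction i)
    case 0
    then show ?case by (auto simp: mem_def)
  next
    case (Suc i)
    then obtain R a where "(exec_word (w m) ^^ i) ([], [], False) = ([], R, a)" "\<And>j. j < n \<Longrightarrow> mem R j = bit i j"
      by blast
    with step[of R i a] show ?case by auto
  qed
  then obtain R a where "(exec_word (w m) ^^ i) ([], [], False) = ([], R, a)" "\<And>j. j < n \<Longrightarrow> mem R j = bit i j"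
    by blast
  with step[of R i a] show ?thesis by auto
qed

text \<open>Three bits per operation. A gate takes at most 5 macros (the constant False takes that
  many), a counter bit 11, the initial carry and the final load together 5. The largest address is
  \<open>n + 2 + length C\<close>, and \<open>2 * (n + length C) + 7\<close> exceeds the cost of
  accessing it.\<close>

lemma length_circuit_code:
  assumes "circuit n C"
  shows "length (circuit_code n C) \<le> 3 * ((5 * length C + 11 * n + 5) * (2 * (n + length C) + 7))"
proof -
  let ?B = "2 * (n + length C) + 7"
  have ok: "\<forall>i<length C. gate_ok n i (C ! i)" "C \<noteq> []" using assms by (auto simp: circuit_def)
  have at: "length (at_cell i x) = 2 * i + 1" for i x by (simp add: at_cell_def)
  have g: "length (assemble x) \<le> ?B" if "x \<in> set (gate_macros n j (C ! j))" "j < length C" for x j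
    using that ok(1)[rule_format, OF that(2)] by (cases "C ! j") (auto simp: at split: if_splits)
  have "length (assemble x) \<le> ?B" if "x \<in> set (round_macros n C)" for x
    using that g ok(2)
    by (auto simp: round_macros_def circuit_macros_def inc_macros_def inc_step_def at)
  then have "length (concat (map assemble (round_macros n C))) \<le> length (round_macros n C) * ?B"
    by (rule length_assemble)
  moreover have "length (round_macros n C) \<le> 5 * length C + 11 * n + 5"
  proof -
    have le5: "length (gate_macros n j g) \<le> 5" for j g by (cases g) auto
    have "length (concat (map (\<lambda>j. gate_macros n j (C ! j)) [0..<m])) \<le> 5 * m" for m
    proof (induction m)
      case (Suc m)
      then show ?case using le5[of m "C ! m"] by simp
    qed simp
    moreover have "length (concat (map (inc_step n) [0..<m])) = 11 * m" for m
      by (induction m) (auto simp: inc_step_def)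
    ultimately show ?thesis
      by (simp add: round_macros_def circuit_macros_def inc_macros_def)
  qed
  then have "length (round_macros n C) * ?B \<le> (5 * length C + 11 * n + 5) * ?B"
    by (rule mult_le_mono1)
  ultimately show ?thesis
    unfolding circuit_code_def length_encode by linarith
qed

text \<open>The strict inequality leaves room for at least one padding bit 1, so the padded code
  ends in a 1 and is the binary expansion of a number. The circuit accounts for the lower
  \<open>N\<close> bits of \<open>y\<close>, the closing 1 of \<open>gen_out\<close> for the leading
  one.\<close>

lemma gen_out_hits:
  assumes C: "circuit n C" and len: "len y = Suc N" and short: "length (circuit_code n C) < N"
    and val: "\<And>i. i < N \<Longrightarrow> circuit_val C (map (bit i) [0..<n]) = bits_of y ! i"
  shows "\<exists>x. num_of (gen_out (bits_of x)) = y"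
proof -
  define m where "m = N - length (circuit_code n C)"
  define w where "w = circuit_code n C @ replicate m True"
  have m: "0 < m" "length w = N" using short by (auto simp: m_def w_def)
  have "bits_of (num_of w) = w" using m by (intro bits_of_num_of) (auto simp: w_def)
  moreover have "gen_out w = bits_of y"
  proof (rule nth_equalityI)
    fix i assume "i < length (gen_out w)"
    then consider "i < N" | "i = N" using m by (auto simp: gen_out_def less_Suc_eq)
    then show "gen_out w ! i = bits_of y ! i"
    proof cases
      case 1
      then have "gen_out w ! i = snd (snd ((exec_word w ^^ Suc i) ([], [], False)))"
        using m by (simp add: gen_out_def nth_append)
      also have "\<dots> = bits_of y ! i"
        using exec_circuit_code[OF C, of i m] val[OF 1] unfolding w_def by simp
      finally show ?thesis .
    next
      case 2
      have "bits_of y \<noteq> []" using len length_bits_of[of y] by (metis list.size(3) nat.distinct(1))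
      then have "bits_of y ! N" using last_bits_of[of y] last_conv_nth[of "bits_of y"] len by simp
      then show ?thesis using 2 m by (simp add: gen_out_def nth_append)
    qed
  qed (use m len in \<open>simp add: gen_out_def\<close>)
  ultimately show ?thesis by (metis num_of_bits_of)
qed

section \<open>The model\<close>

text \<open>With \<open>x\<close> the (e + 1)-st root of 2, the quotient n / x^n tends to 0, and so
  does its (e + 1)-st power n^(e + 1) / 2^n.\<close>

lemma eventually_poly_le_two_power: "\<forall>\<^sub>F n in sequentially. n ^ e + e \<le> (2::nat) ^ n"
proof -
  define x where "x = root (Suc e) (2::real)"
  have x: "1 < x" "x ^ Suc e = 2"
    unfolding x_def by simp (rule real_root_pow_pos2; simp)
  then have "(\<lambda>n. of_nat n / x ^ n) \<longlonglongrightarrow> 0"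
    by (intro lim_n_over_pown) auto
  then have "(\<lambda>n. (of_nat n / x ^ n) ^ Suc e) \<longlonglongrightarrow> 0 ^ Suc e"
    by (rule tendsto_power)
  then have "\<forall>\<^sub>F n in sequentially. (of_nat n / x ^ n) ^ Suc e < 1"
    by (intro order_tendstoD(2)[where y = 0]) auto
  then have "\<forall>\<^sub>F n in sequentially. n ^ Suc e \<le> (2::nat) ^ n"
  proof eventually_elim
    case (elim n)
    have "(x ^ n) ^ Suc e = 2 ^ n" using x(2) by (metis power_commutes power_mult mult.commute)
    then have "real n ^ Suc e < 2 ^ n"
      using elim by (simp add: power_divide field_simps del: power_Suc)
    then have "real (n ^ Suc e) < real (2 ^ n)" by simp
    then show ?case by linarith
  qed
  moreover have "\<forall>\<^sub>F n in sequentially. e + 2 \<le> n" by (rule eventually_ge_at_top)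
  ultimately show ?thesis
  proof eventually_elim
    case (elim n)
    have "e \<le> 2 ^ e" by (rule n_le_two_power)
    also have "\<dots> \<le> n ^ e" using elim by (intro power_mono) auto
    finally have "n ^ e + e \<le> 2 * n ^ e" by simp
    also have "\<dots> \<le> n ^ Suc e" using elim by simp
    finally show ?case using elim by linarith
  qed
qed

lemma num_of_map_bit: "i < 2 ^ n \<Longrightarrow> num_of (map (bit i) [0..<n]) = i"
  unfolding num_of_def by (simp add: horner_sum_bit_eq_take_bit take_bit_nat_eq_self)

definition term_at :: "machine trm \<Rightarrow> nat \<Rightarrow> nat"
  where "term_at t n = tval standard_model (\<lambda>_. 2 ^ n) t"

text \<open>(H) is applied to the bit language of this one term. The constant hidden in O(n^d)
  depends on the term and only affects from which \<open>n\<close> on the claim holds; the threshold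
  \<open>n ^ (2 * d + 1)\<close> is common to all terms.\<close>

lemma gen_out_hits_long_values:
  assumes H: "class_P \<subseteq> SIZE_O d" and d: "1 \<le> d" and t: "PV_trm t"
  shows "\<forall>\<^sub>F n in sequentially. n ^ (2 * d + 1) < len (term_at t n) \<longrightarrow>
    (\<exists>x. num_of (gen_out (bits_of x)) = term_at t n)"
proof -
  have "bit_language t \<in> SIZE_O d" using H bit_language_in_P[OF t] by blast
  then obtain C where C: "\<And>n. circuit n (C n)"
    "\<And>n w. length w = n \<Longrightarrow> circuit_val (C n) w \<longleftrightarrow> w \<in> bit_language t"
    and O: "(\<lambda>n. real (length (C n))) \<in> O(\<lambda>n. real n ^ d)"
    unfolding SIZE_O_def by blast
  from O obtain c where "\<forall>\<^sub>F n in sequentially. norm (real (length (C n))) \<le> c * norm (real n ^ d)"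
    by (elim landau_o.bigE)
  then have size: "\<forall>\<^sub>F n in sequentially. length (C n) \<le> nat \<lceil>c\<rceil> * n ^ d"
  proof eventually_elim
    case (elim n)
    have "real (length (C n)) \<le> c * real (n ^ d)" using elim by simp
    also have "\<dots> \<le> real (nat \<lceil>c\<rceil>) * real (n ^ d)" by (intro mult_right_mono) linarith+
    finally have "real (length (C n)) \<le> real (nat \<lceil>c\<rceil> * n ^ d)" by simp
    then show ?case by linarith
  qed
  define c' where "c' = nat \<lceil>c\<rceil>"
  \<comment> \<open>From \<open>1 \<le> n ^ d\<close> and \<open>n \<le> n ^ d\<close>, the terms
    \<open>11 * n + 5\<close> and \<open>2 * n + 7\<close> of the code length are at most 16 and 9
    times \<open>n ^ d\<close>. So the code has at most \<open>K * n ^ (2 * d)\<close> bits, which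
    is below the threshold once \<open>n > K\<close>.\<close>
  define K where "K = 3 * ((5 * c' + 16) * (2 * c' + 9))"
  obtain \<tau> where \<tau>: "poly_bounded \<tau>" "\<And>n. len (term_at t n) \<le> \<tau> n"
    using len_term_poly_bounded[OF t] unfolding term_at_def by blast
  then obtain e where "\<And>n. \<tau> n \<le> n ^ e + e" by (auto simp: poly_bounded_def)
  with \<tau>(2) have e: "len (term_at t n) \<le> n ^ e + e" for n by (meson order.trans)
  from size eventually_poly_le_two_power[of e] eventually_gt_at_top[of K] show ?thesis
  proof eventually_elim
    case (elim n)
    show ?case
    proof
      assume long: "n ^ (2 * d + 1) < len (term_at t n)"
      define y where "y = term_at t n"
      define N where "N = len y - 1"
      have N: "len y = Suc N" "n ^ (2 * d + 1) \<le> N" using long by (auto simp: N_def y_def)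
      have n1: "1 \<le> n" "1 \<le> n ^ d" "n \<le> n ^ d"
        using elim(3) d by (auto simp: self_le_power)
      have "length (circuit_code n (C n)) \<le> 3 * ((5 * length (C n) + 11 * n + 5) * (2 * (n + length (C n)) + 7))"
        by (rule length_circuit_code[OF C(1)])
      also have "\<dots> \<le> 3 * (((5 * c' + 16) * n ^ d) * ((2 * c' + 9) * n ^ d))"
      proof -
        have "length (C n) \<le> c' * n ^ d" using elim(1) by (simp add: c'_def)
        with n1(2,3) have "5 * length (C n) + 11 * n + 5 \<le> 5 * (c' * n ^ d) + 16 * n ^ d"
          "2 * n + 2 * length (C n) + 7 \<le> 2 * (c' * n ^ d) + 9 * n ^ d"
          by linarith+
        then have "5 * length (C n) + 11 * n + 5 \<le> (5 * c' + 16) * n ^ d"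
          "2 * (n + length (C n)) + 7 \<le> (2 * c' + 9) * n ^ d"
          by (simp_all only: add_mult_distrib add_mult_distrib2 mult.assoc)
        then show ?thesis by (intro mult_le_mono) auto
      qed
      also have "\<dots> = K * n ^ (2 * d)"
      proof -
        have "3 * ((a * p) * (b * p)) = 3 * (a * b) * (p * p)" for a b p :: nat
          by (simp add: mult_ac)
        then show ?thesis unfolding K_def mult_2[of d] power_add .
      qed
      also have "\<dots> < n ^ (2 * d + 1)" using elim(3) n1 by simp
      finally have short: "length (circuit_code n (C n)) < N" using N(2) by linarith
      have "circuit_val (C n) (map (bit i) [0..<n]) = bits_of y ! i" if "i < N" for i
      proof -
        \<comment> \<open>The length of \<open>y\<close> is polynomial in \<open>n\<close>, so every
          bit position fits into the \<open>n\<close> inputs of the circuit.\<close>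
        have "i < 2 ^ n" using that N(1) e[of n] elim(2) unfolding y_def[symmetric] by linarith
        then have "num_of (map (bit i) [0..<n]) = i" by (rule num_of_map_bit)
        then show ?thesis
          using C(2)[of "map (bit i) [0..<n]" n] that N(1)
          by (simp add: bit_language_def y_def term_at_def)
      qed
      then show "\<exists>x. num_of (gen_out (bits_of x)) = term_at t n"
        using gen_out_hits[OF C(1) N(1) short] unfolding y_def by blast
    qed
  qed
qed

section \<open>Representing the order and the length bounds in the language\<close>

primrec len_pow_trm :: "machine \<Rightarrow> nat \<Rightarrow> nat \<Rightarrow> machine trm"
  where
    "len_pow_trm m x 0 = Var x"
  | "len_pow_trm m x (Suc c) = Fn m [Var x, len_pow_trm m x c]"

lemma len_ones [simp]: "len (num_of (replicate k True)) = k"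
proof (cases "k = 0")
  case True
  then show ?thesis using length_bits_of[of 0] by (simp del: length_bits_of)
next
  case False
  then show ?thesis by (subst len_num_of) (auto simp: last_replicate)
qed

lemma len_pow_trm:
  assumes m: "computes_num 2 m (\<lambda>xs. num_of (replicate (len (xs ! 0) * len (xs ! 1)) True))"
  shows "PV_trm (len_pow_trm m x c)" "tvars (len_pow_trm m x c) = {x}"
    "len (tval standard_model e (len_pow_trm m x c)) = len (e x) ^ Suc c"
  using m by (induction c) (auto simp: computes_num_def standard_model_def)

definition represents :: "machine \<Rightarrow> nat \<Rightarrow> (nat list \<Rightarrow> bool) \<Rightarrow> bool"
  where "represents M k R \<longleftrightarrow> computes_num k M (\<lambda>xs. of_bool (R xs))"

text \<open>\<open>char_sym\<close> is a choice and means something only if there is a machine to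
  choose; this is what the machines built above are for.\<close>

lemma represents_char_sym:
  assumes "\<exists>M. represents M k R" shows "represents (char_sym k R) k R"
  using someI_ex[OF assms] by (simp add: represents_def computes_num_def char_sym_def)

lemma represents_less: "represents (char_sym 2 (\<lambda>xs. xs ! 0 < xs ! 1)) 2 (\<lambda>xs. xs ! 0 < xs ! 1)"
  using computes_less by (intro represents_char_sym) (auto simp: represents_def)

lemma represents_true: "1 \<le> k \<Longrightarrow> represents (char_sym k (\<lambda>_. True)) k (\<lambda>_. True)"
  using computes_const[of k 1] by (intro represents_char_sym) (auto simp: represents_def)

text \<open>The length of the first argument is compared with that of a number of length
  \<open>|u| ^ c\<close>, obtained by \<open>c - 1\<close> multiplications of lengths;
  \<open>computes_term\<close> turns the composition into one machine.\<close>

lemma represents_len_le_pow: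
  assumes "1 \<le> c"
  defines "R \<equiv> \<lambda>xs. len (xs ! 0) \<le> len (xs ! 1) ^ c"
  shows "represents (char_sym 2 R) 2 R"
proof (rule represents_char_sym)
  obtain l where l: "computes_num 2 l (\<lambda>xs. of_bool (len (xs ! 0) \<le> len (xs ! 1)))"
    using computes_len_le by blast
  obtain m where m: "computes_num 2 m (\<lambda>xs. num_of (replicate (len (xs ! 0) * len (xs ! 1)) True))"
    using computes_len_mult by blast
  let ?t = "Fn l [Var 0, len_pow_trm m 1 (c - 1)]"
  have "PV_trm ?t" "tvars ?t \<subseteq> {..<2}"
    using l len_pow_trm[OF m] by (auto simp: computes_num_def)
  then obtain M where M: "computes_num 2 M (\<lambda>xs. tval standard_model (\<lambda>i. xs ! i) ?t)"
    using computes_term[of ?t 2] by auto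
  have "tval standard_model e ?t = of_bool (len (e 0) \<le> len (e 1) ^ c)" for e
  proof -
    have "tval standard_model e ?t = fun_of l [e 0, tval standard_model e (len_pow_trm m 1 (c - 1))]"
      by (simp add: standard_model_def)
    also have "\<dots> = of_bool (len (e 0) \<le> len (e 1) ^ Suc (c - 1))"
      using l len_pow_trm(3)[OF m, of e 1 "c - 1"] by (simp add: computes_num_def)
    finally show ?thesis using assms(1) by simp
  qed
  with M show "\<exists>M. represents M 2 R" by (auto simp: represents_def R_def)
qed

lemma Rel_2:
  assumes "represents (char_sym 2 R) 2 R" "PV_trm t" "PV_trm u"
  shows "PV_fm (Rel R [t, u])" "open_fm (Rel R [t, u])"
    "sat standard_model e (Rel R [t, u]) \<longleftrightarrow> R [tval standard_model e t, tval standard_model e u]"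
  using assms represents_true[of 2]
  by (auto simp: Rel_def represents_def computes_num_def standard_model_def numeral_2_eq_2)

lemmas Less_simps = Rel_2[OF represents_less, folded Less_def, simplified]

lemma Len_le_pow_simps:
  assumes "1 \<le> c" "PV_trm t" "PV_trm u"
  shows "PV_fm (Len_le_pow c t u)" "open_fm (Len_le_pow c t u)"
    "sat standard_model e (Len_le_pow c t u) \<longleftrightarrow>
      len (tval standard_model e t) \<le> len (tval standard_model e u) ^ c"
  using Rel_2[OF represents_len_le_pow[OF assms(1)] assms(2,3), folded Len_le_pow_def] by simp_all

lemma interp_standard_model: "interp standard_model = fun_of"
  by (simp add: standard_model_def)

section \<open>Substitution and coincidence for open formulas\<close>

lemma tval_tsubst: "tval S e (tsubst \<sigma> t) = tval S (\<lambda>x. tval S e (\<sigma> x)) t"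
proof (induction t)
  case (Fn f ts)
  then have "map (tval S e \<circ> tsubst \<sigma>) ts = map (tval S (\<lambda>x. tval S e (\<sigma> x))) ts" by auto
  then show ?case by (simp only: tsubst.simps tval.simps map_map)
qed simp

lemma sat_subst: "open_fm \<phi> \<Longrightarrow> sat S e (subst \<sigma> \<phi>) \<longleftrightarrow> sat S (\<lambda>x. tval S e (\<sigma> x)) \<phi>"
  by (induction \<phi>) (auto simp: tval_tsubst)

lemma open_subst: "open_fm \<phi> \<Longrightarrow> open_fm (subst \<sigma> \<phi>)"
  by (induction \<phi>) auto

lemma PV_tsubst: "PV_trm t \<Longrightarrow> (\<And>x. PV_trm (\<sigma> x)) \<Longrightarrow> PV_trm (tsubst \<sigma> t)"
  by (induction t) auto

lemma PV_subst: "open_fm \<phi> \<Longrightarrow> PV_fm \<phi> \<Longrightarrow> (\<And>x. PV_trm (\<sigma> x)) \<Longrightarrow> PV_fm (subst \<sigma> \<phi>)"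
  by (induction \<phi>) (auto simp: PV_tsubst)

lemma sat_cong: "open_fm \<phi> \<Longrightarrow> (\<And>x. x \<in> fvars \<phi> \<Longrightarrow> e x = e' x) \<Longrightarrow> sat S e \<phi> \<longleftrightarrow> sat S e' \<phi>"
proof (induction \<phi>)
  case (Eq t u)
  then have "tval S e t = tval S e' t" "tval S e u = tval S e' u" by (auto intro!: tval_cong)
  then show ?case by simp
qed auto

section \<open>Countably many terms, and a subsequence deciding countably many properties\<close>

instance move :: countable
  by countable_datatype

instance machine_ext :: (countable) countable
  by (rule countable_classI[of "\<lambda>m. to_nat (inputs m, tapes m, table m, clock_exp m, machine.more m)"]) auto

instance trm :: (countable) countable
  by countable_datatype

text \<open>At stage \<open>k\<close> one passes to an infinite set on which \<open>P k\<close> is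
  constant. The diagonal sequence is, from position \<open>k + 1\<close> on, a subsequence of the
  one obtained at that stage.\<close>

lemma diagonal_decides:
  fixes P :: "nat \<Rightarrow> nat \<Rightarrow> bool"
  obtains r where "strict_mono (r :: nat \<Rightarrow> nat)"
    "\<And>k. (\<forall>\<^sub>F n in sequentially. P k (r n)) \<or> (\<forall>\<^sub>F n in sequentially. \<not> P k (r n))"
proof -
  define Q where "Q k s \<longleftrightarrow> (\<forall>n. P k (s n)) \<or> (\<forall>n. \<not> P k (s n))" for k and s :: "nat \<Rightarrow> nat"
  interpret subseqs Q
  proof
    fix k and s :: "nat \<Rightarrow> nat" assume "strict_mono s"
    show "\<exists>r'. strict_mono r' \<and> Q k (s \<circ> r')"
    proof (cases "infinite {n. P k (s n)}")
      case True
      then show ?thesis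
        using strict_mono_enumerate[OF True] enumerate_in_set[OF True]
        by (intro exI[of _ "enumerate {n. P k (s n)}"]) (auto simp: Q_def)
    next
      case False
      have "{n. P k (s n)} \<union> {n. \<not> P k (s n)} = UNIV" by auto
      with False have inf: "infinite {n. \<not> P k (s n)}"
        using finite_Un[of "{n. P k (s n)}" "{n. \<not> P k (s n)}"] infinite_UNIV_nat by simp
      then show ?thesis
        using strict_mono_enumerate[OF inf] enumerate_in_set[OF inf]
        by (intro exI[of _ "enumerate {n. \<not> P k (s n)}"]) (auto simp: Q_def)
    qed
  qed
  have Q_diag: "Q k (diagseq \<circ> ((+) (Suc k)))" for k
    by (rule diagseq_holds) (auto simp: Q_def)
  have ev: "\<forall>\<^sub>F n in sequentially. R (diagseq n)" if "\<forall>n. R (diagseq (Suc k + n))" for R k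
    unfolding eventually_sequentially
  proof (intro exI[of _ "Suc k"] allI impI)
    fix n assume "Suc k \<le> n"
    then show "R (diagseq n)" using that[rule_format, of "n - Suc k"] by simp
  qed
  have "(\<forall>\<^sub>F n in sequentially. P k (diagseq n)) \<or> (\<forall>\<^sub>F n in sequentially. \<not> P k (diagseq n))" for k
    using Q_diag[of k] ev[of "P k" k] ev[of "\<lambda>n. \<not> P k n" k] by (auto simp: Q_def)
  then show ?thesis by (rule that[OF subseq_diagseq])
qed

text \<open>
  The universe consists of the least indices of the equivalence classes of terms under eventual
  equality of their values along the subsequence \<open>r\<close>.
\<close>

locale diagonal_model =
  fixes T :: "nat \<Rightarrow> machine trm" and r :: "nat \<Rightarrow> nat"
  assumes range_T: "range T = {t. PV_trm t}"
    and mono_r: "strict_mono r"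
    and decided: "\<And>k l. (\<forall>\<^sub>F n in sequentially. term_at (T k) (r n) = term_at (T l) (r n)) \<or>
      (\<forall>\<^sub>F n in sequentially. term_at (T k) (r n) \<noteq> term_at (T l) (r n))"
begin

definition eqv :: "nat \<Rightarrow> nat \<Rightarrow> bool"
  where "eqv k l \<longleftrightarrow> (\<forall>\<^sub>F n in sequentially. term_at (T k) (r n) = term_at (T l) (r n))"

definition rep :: "nat \<Rightarrow> nat"
  where "rep k = (LEAST l. eqv l k)"

definition index :: "machine trm \<Rightarrow> nat"
  where "index t = (SOME k. T k = t)"

text \<open>A symbol is applied to representatives by forming the compound term and taking the
  representative of its index. For symbols or arities outside the language the index is arbitrary,
  yet the value stays in the universe.\<close>

definition the_model :: "(machine, nat) struct"
  where "the_model = \<lparr>univ = range rep, interp = (\<lambda>M ks. rep (index (Fn M (map T ks))))\<rparr>"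

lemma PV_T: "PV_trm (T k)"
  using range_T by auto

lemma T_index: "PV_trm t \<Longrightarrow> T (index t) = t"
proof -
  assume "PV_trm t"
  then have "t \<in> range T" by (simp add: range_T)
  then have "\<exists>k. T k = t" by auto
  then show ?thesis unfolding index_def by (rule someI_ex)
qed

lemma eqv_refl: "eqv k k" and eqv_sym: "eqv k l \<Longrightarrow> eqv l k"
  by (auto simp: eqv_def eq_commute)

lemma eqv_trans: "eqv k l \<Longrightarrow> eqv l m \<Longrightarrow> eqv k m"
  unfolding eqv_def by (auto elim: eventually_elim2)

lemma eqv_rep: "eqv (rep k) k"
  unfolding rep_def by (rule LeastI, rule eqv_refl)

lemma rep_cong: "eqv k l \<Longrightarrow> rep k = rep l"
proof -
  assume "eqv k l"
  then have "(\<lambda>m. eqv m k) = (\<lambda>m. eqv m l)" by (metis eqv_sym eqv_trans)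
  then show ?thesis by (simp add: rep_def)
qed

lemma eqv_univ: "k \<in> univ the_model \<Longrightarrow> l \<in> univ the_model \<Longrightarrow> eqv k l \<longleftrightarrow> k = l"
  by (auto simp: the_model_def eqv_refl) (metis eqv_rep rep_cong)

definition value_at :: "(nat \<Rightarrow> nat) \<Rightarrow> nat \<Rightarrow> nat \<Rightarrow> nat"
  where "value_at e n x = term_at (T (e x)) (r n)"

lemma tval_in_univ: "range e \<subseteq> univ the_model \<Longrightarrow> tval the_model e t \<in> univ the_model"
  by (cases t) (auto simp: the_model_def)

lemma tval_the_model:
  assumes "PV_trm t"
  shows "\<forall>\<^sub>F n in sequentially. term_at (T (tval the_model e t)) (r n) = tval standard_model (value_at e n) t"
  using assms
proof (induction t)
  case (Var x)
  then show ?case by (simp add: value_at_def)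
next
  case (Fn M ts)
  let ?ks = "map (tval the_model e) ts"
  let ?u = "Fn M (map T ?ks)"
  have "PV_trm ?u" using Fn.prems PV_T by auto
  then have T: "T (index ?u) = ?u" by (rule T_index)
  have "\<forall>\<^sub>F n in sequentially. \<forall>t\<in>set ts.
      term_at (T (tval the_model e t)) (r n) = tval standard_model (value_at e n) t"
    using Fn by (intro eventually_ball_finite) auto
  moreover have "eqv (tval the_model e (Fn M ts)) (index ?u)"
    using eqv_rep by (simp add: the_model_def)
  ultimately show ?case
    unfolding eqv_def
  proof eventually_elim
    case (elim n)
    have "map (\<lambda>t. term_at (T (tval the_model e t)) (r n)) ts = map (tval standard_model (value_at e n)) ts"
      using elim by auto
    moreover have "term_at ?u (r n) = fun_of M (map (\<lambda>t. term_at (T (tval the_model e t)) (r n)) ts)"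
      by (simp add: term_at_def o_def interp_standard_model)
    ultimately have "term_at ?u (r n) = tval standard_model (value_at e n) (Fn M ts)"
      by (simp only: tval.simps interp_standard_model)
    with elim T show ?case by simp
  qed
qed

text \<open>The counterpart of the theorem of Los for open formulas. Truth in the model does not
  depend on \<open>n\<close>, so the equivalence passes through negation and the other connectives;
  a decision is needed for equations only.\<close>

lemma sat_the_model:
  assumes "open_fm \<phi>" "PV_fm \<phi>" and e: "range e \<subseteq> univ the_model"
  shows "\<forall>\<^sub>F n in sequentially. sat the_model e \<phi> \<longleftrightarrow> sat standard_model (value_at e n) \<phi>"
  using assms(1,2)
proof (induction \<phi>)
  case (Eq t u)
  let ?k = "tval the_model e t" and ?l = "tval the_model e u"
  have "\<forall>\<^sub>F n in sequentially. ?k = ?l \<longleftrightarrow> term_at (T ?k) (r n) = term_at (T ?l) (r n)"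
  proof (cases "?k = ?l")
    case False
    then have "\<not> eqv ?k ?l" using eqv_univ tval_in_univ[OF e] by blast
    \<comment> \<open>Failure of eventual equality is turned into eventual inequality by
      \<open>decided\<close>.\<close>
    then have "\<forall>\<^sub>F n in sequentially. term_at (T ?k) (r n) \<noteq> term_at (T ?l) (r n)"
      using decided unfolding eqv_def by blast
    then show ?thesis by eventually_elim (use False in simp)
  qed simp
  moreover have "\<forall>\<^sub>F n in sequentially. term_at (T ?k) (r n) = tval standard_model (value_at e n) t"
    "\<forall>\<^sub>F n in sequentially. term_at (T ?l) (r n) = tval standard_model (value_at e n) u"
    using Eq.prems by (auto intro!: tval_the_model)
  ultimately show ?case by eventually_elim simp
next
  case (Neg \<phi>)
  then have "\<forall>\<^sub>F n in sequentially. sat the_model e \<phi> \<longleftrightarrow> sat standard_model (value_at e n) \<phi>" by simp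
  then show ?case by eventually_elim simp
next
  case (Conj \<phi> \<psi>)
  then have "\<forall>\<^sub>F n in sequentially. sat the_model e \<phi> \<longleftrightarrow> sat standard_model (value_at e n) \<phi>"
    "\<forall>\<^sub>F n in sequentially. sat the_model e \<psi> \<longleftrightarrow> sat standard_model (value_at e n) \<psi>" by simp_all
  then show ?case by eventually_elim simp
next
  case (Disj \<phi> \<psi>)
  then have "\<forall>\<^sub>F n in sequentially. sat the_model e \<phi> \<longleftrightarrow> sat standard_model (value_at e n) \<phi>"
    "\<forall>\<^sub>F n in sequentially. sat the_model e \<psi> \<longleftrightarrow> sat standard_model (value_at e n) \<psi>" by simp_all
  then show ?case by eventually_elim simp
next
  case (Imp \<phi> \<psi>)
  then have "\<forall>\<^sub>F n in sequentially. sat the_model e \<phi> \<longleftrightarrow> sat standard_model (value_at e n) \<phi>"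
    "\<forall>\<^sub>F n in sequentially. sat the_model e \<psi> \<longleftrightarrow> sat standard_model (value_at e n) \<psi>" by simp_all
  then show ?case by eventually_elim simp
qed auto

text \<open>The open matrix of an axiom holds in the standard model under every assignment, in
  particular at every coordinate, and so it holds in the model.\<close>

lemma T_PV_model_the_model: "T_PV_model the_model"
  unfolding T_PV_model_def
proof (intro conjI ballI)
  show "PV_structure the_model" by (auto simp: PV_structure_def the_model_def)
  fix \<phi> assume "\<phi> \<in> T_PV"
  then obtain xs \<psi> where \<psi>: "open_fm \<psi>" "\<phi> = foldr All xs \<psi>" "PV_fm \<phi>" "standard_model \<Turnstile> \<phi>"
    by (auto simp: T_PV_def universal_sentence_def)
  have "PV_fm \<psi>" using \<psi>(3) unfolding \<psi>(2) by (induction xs) auto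
  have "sat standard_model e (foldr All xs \<psi>) \<Longrightarrow> sat standard_model e \<psi>" for e
  proof (induction xs)
    case (Cons x xs)
    then have "\<forall>a. sat standard_model (e(x := a)) (foldr All xs \<psi>)"
      by (simp add: standard_model_def)
    from spec[OF this, of "e x"] show ?case using Cons.IH by simp
  qed simp
  then have std: "sat standard_model e \<psi>" for e
    using \<psi>(2,4) by (auto simp: models_def standard_model_def)
  have open_sat: "sat the_model e \<psi>" if "range e \<subseteq> univ the_model" for e
  proof -
    have "\<forall>\<^sub>F n in sequentially. sat the_model e \<psi>"
      using sat_the_model[OF \<psi>(1) \<open>PV_fm \<psi>\<close> that] by eventually_elim (simp add: std)
    then show ?thesis by simp
  qed
  have "range e \<subseteq> univ the_model \<Longrightarrow> sat the_model e (foldr All xs \<psi>)" for e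
    by (induction xs arbitrary: e) (auto simp: open_sat image_subset_iff)
  then show "the_model \<Turnstile> \<phi>" by (simp add: models_def \<psi>(2))
qed

text \<open>All symbols have positive arity, so a constant is a unary constant function applied to a
  dummy variable.\<close>

lemma const_in_model:
  obtains k where "k \<in> univ the_model" "\<forall>\<^sub>F n in sequentially. term_at (T k) (r n) = c"
proof -
  obtain m where m: "computes_num 1 m (\<lambda>_. c)" using computes_const[of 1 c] by auto
  let ?t = "Fn m [Var 0]"
  have "PV_trm ?t" using m by (auto simp: computes_num_def)
  then have "term_at (T (index ?t)) n = c" for n
    using m by (simp add: T_index term_at_def standard_model_def computes_num_def)
  moreover have "\<forall>\<^sub>F n in sequentially. term_at (T (rep (index ?t))) (r n) = term_at (T (index ?t)) (r n)"
    using eqv_rep[of "index ?t"] unfolding eqv_def .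
  ultimately show ?thesis using that[of "rep (index ?t)"] by (simp add: the_model_def)
qed

text \<open>A long element of \<open>A\<close> in the model is, at almost all coordinates, a value
  of \<open>g\<close> lying in \<open>A\<close>. One coordinate yields standard numbers
  \<open>x0\<close> and \<open>z0\<close> with this property; as constants they belong to the model
  and refute the disjointness assumed there.\<close>

lemma not_Inf_the_model:
  assumes g: "clocked_machine g" "inputs g = 1" and "0 < q"
    and hits: "\<And>t. PV_trm t \<Longrightarrow> \<forall>\<^sub>F n in sequentially. n ^ q < len (term_at t n) \<longrightarrow> (\<exists>x. fun_of g [x] = term_at t n)"
    and A: "NP_set A"
  shows "the_model \<Turnstile> Imp (Rng_disjoint g A) (Neg (Inf_fm A))"
  unfolding models_def sat.simps
proof (intro allI impI notI)
  fix e assume e: "range e \<subseteq> univ the_model" and rng: "sat the_model e (Rng_disjoint g A)"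
    and inf: "sat the_model e (Inf_fm A)"
  obtain c A0 where Ac: "A = (c, A0)" by (cases A)
  then have c: "1 \<le> c" and A0: "PV_fm A0" "open_fm A0" "fvars A0 \<subseteq> {1, 2}" using A by auto
  obtain m where m: "computes_num 2 m (\<lambda>xs. num_of (replicate (len (xs ! 0) * len (xs ! 1)) True))"
    using computes_len_mult by blast
  \<comment> \<open>Its value at \<open>2 ^ n\<close> has length \<open>(n + 1) ^ (q + 1)\<close>,
    because \<open>2 ^ n\<close> has length \<open>n + 1\<close>. Used as \<open>x\<close> in
    \<open>Inf_fm\<close>, it forces \<open>y\<close> to be longer than
    \<open>n ^ q\<close>.\<close>
  let ?u = "len_pow_trm m 0 q"
  define x where "x = rep (index ?u)"
  have x: "x \<in> univ the_model" by (simp add: x_def the_model_def)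
  have "eqv x (index ?u)" using eqv_rep by (simp add: x_def)
  then have x_val: "\<forall>\<^sub>F n in sequentially. term_at (T x) (r n) = term_at ?u (r n)"
    using len_pow_trm(1)[OF m] by (simp add: eqv_def T_index)
  from inf x obtain y z where y: "y \<in> univ the_model" and z: "z \<in> univ the_model"
    and sat: "sat the_model (e(0 := x, 1 := y)) (Less (Var 0) (Var 1))"
      "sat the_model (e(0 := x, 1 := y, 2 := z)) (Len_le_pow c (Var 2) (Var 1))"
      "sat the_model (e(0 := x, 1 := y, 2 := z)) A0"
    unfolding Inf_fm_def Ac by auto
  let ?e1 = "e(0 := x, 1 := y)" and ?e2 = "e(0 := x, 1 := y, 2 := z)"
  have r1: "range ?e1 \<subseteq> univ the_model" and r2: "range ?e2 \<subseteq> univ the_model" using e x y z by auto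
  have "\<forall>\<^sub>F n in sequentially. sat standard_model (value_at ?e1 n) (Less (Var 0) (Var 1))"
    using sat_the_model[OF _ _ r1, of "Less (Var 0) (Var 1)"] sat(1) by (simp add: Less_simps)
  moreover have "\<forall>\<^sub>F n in sequentially. sat standard_model (value_at ?e2 n) (Len_le_pow c (Var 2) (Var 1))"
    using sat_the_model[OF _ _ r2, of "Len_le_pow c (Var 2) (Var 1)"] sat(2) c by (simp add: Len_le_pow_simps)
  moreover have "\<forall>\<^sub>F n in sequentially. sat standard_model (value_at ?e2 n) A0"
    using sat_the_model[OF A0(2,1) r2] sat(3) by simp
  moreover have "\<forall>\<^sub>F n in sequentially. r n ^ q < len (term_at (T y) (r n)) \<longrightarrow> (\<exists>x. fun_of g [x] = term_at (T y) (r n))"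
    using eventually_compose_filterlim[OF hits[OF PV_T[of y]] filterlim_subseq[OF mono_r]] .
  ultimately have "\<forall>\<^sub>F n in sequentially. \<exists>x0 z0. len z0 \<le> len (fun_of g [x0]) ^ c \<and>
      sat standard_model ((\<lambda>_. 0)(1 := fun_of g [x0], 2 := z0)) A0"
    using x_val
  proof eventually_elim
    case (elim n)
    let ?y = "term_at (T y) (r n)" and ?z = "term_at (T z) (r n)"
    have "term_at ?u (r n) < ?y" using elim(1,5) by (simp add: Less_simps value_at_def)
    then have "len (term_at ?u (r n)) \<le> len ?y" by (intro len_mono) simp
    moreover have "r n ^ q < len (term_at ?u (r n))"
    proof -
      have "len (term_at ?u (r n)) = Suc (r n) ^ Suc q"
        using arg_cong[OF bits_of_two_power[of "r n"], of length]
        unfolding term_at_def len_pow_trm(3)[OF m] by simp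
      moreover have "r n ^ q < Suc (r n) ^ Suc q"
      proof (cases "r n = 0")
        case True
        then show ?thesis using \<open>0 < q\<close> by simp
      next
        case False
        have "r n ^ q \<le> Suc (r n) ^ q" by (rule power_mono) auto
        also have "\<dots> < Suc (r n) ^ Suc q" using False by simp
        finally show ?thesis .
      qed
      ultimately show ?thesis by simp
    qed
    ultimately obtain x0 where x0: "fun_of g [x0] = ?y" using elim(4) by (meson order.strict_trans2)
    have "len ?z \<le> len ?y ^ c" using elim(2) c by (simp add: Len_le_pow_simps value_at_def)
    moreover have "sat standard_model ((\<lambda>_. 0)(1 := ?y, 2 := ?z)) A0 \<longleftrightarrow> sat standard_model (value_at ?e2 n) A0"
      using A0(3) by (intro sat_cong A0(2)) (auto simp: value_at_def)
    ultimately show ?case using elim(3) x0 by metis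
  qed
  \<comment> \<open>The preimage \<open>x0\<close> varies with \<open>n\<close> in no uniform way,
    so a single coordinate is fixed.\<close>
  from eventually_happens'[OF sequentially_bot this] obtain x0 z0 where std: "len z0 \<le> len (fun_of g [x0]) ^ c"
    "sat standard_model ((\<lambda>_. 0)(1 := fun_of g [x0], 2 := z0)) A0"
    by blast
  obtain kx where kx: "kx \<in> univ the_model" "\<forall>\<^sub>F n in sequentially. term_at (T kx) (r n) = x0"
    by (rule const_in_model)
  obtain kz where kz: "kz \<in> univ the_model" "\<forall>\<^sub>F n in sequentially. term_at (T kz) (r n) = z0"
    by (rule const_in_model)
  let ?gx = "Fn g [Var 0]"
  let ?\<psi> = "Neg (Conj (Len_le_pow c (Var 2) ?gx) (subst (Var(1 := ?gx)) A0))"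
  let ?e3 = "e(0 := kx, 2 := kz)"
  have gx: "PV_trm ?gx" using g by simp
  have r3: "range ?e3 \<subseteq> univ the_model" using e kx(1) kz(1) by auto
  have "sat the_model ?e3 ?\<psi>"
    using rng kx(1) kz(1) unfolding Ac Rng_disjoint.simps Let_def sat.simps by blast
  moreover have "open_fm ?\<psi>" "PV_fm ?\<psi>"
    using c gx A0 by (auto simp: Len_le_pow_simps open_subst PV_subst)
  ultimately have "\<forall>\<^sub>F n in sequentially. sat standard_model (value_at ?e3 n) ?\<psi>"
    using sat_the_model[OF _ _ r3, of ?\<psi>] by simp
  then have "\<forall>\<^sub>F n in sequentially. False"
    using kx(2) kz(2)
  proof eventually_elim
    case (elim n)
    have v: "value_at ?e3 n 0 = x0" "value_at ?e3 n 2 = z0" using elim(2,3) by (auto simp: value_at_def)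
    have "sat standard_model (value_at ?e3 n) (subst (Var(1 := ?gx)) A0) \<longleftrightarrow>
        sat standard_model ((\<lambda>_. 0)(1 := fun_of g [x0], 2 := z0)) A0"
      unfolding sat_subst[OF A0(2)]
      using A0(3) v by (intro sat_cong A0(2)) (auto simp: standard_model_def)
    moreover have "sat standard_model (value_at ?e3 n) (Len_le_pow c (Var 2) ?gx)"
      using std(1) v Len_le_pow_simps(3)[OF c _ gx] by (simp add: standard_model_def)
    ultimately show ?case using elim(1) std(2) by simp
  qed
  then show False by simp
qed

end

theorem mainTheorem9:
  assumes "hypothesis_H"
  shows "\<exists>g (M :: (machine, nat) struct).
    generator g \<and> T_PV_model M \<and>
    (\<forall>A. NP_set A \<longrightarrow> M \<Turnstile> Imp (Rng_disjoint g A) (Neg (Inf_fm A)))"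
proof -
  obtain d where d: "1 \<le> d" "class_P \<subseteq> SIZE_O d"
    using assms by (auto simp: hypothesis_H_def)
  obtain g where g: "generator g" "\<And>x. fun_of g [x] = num_of (gen_out (bits_of x))"
    by (rule generator_gen_out) (rule that)
  define T where "T = from_nat_into {t. PV_trm t}"
  have range_T: "range T = {t. PV_trm t}"
    unfolding T_def by (intro range_from_nat_into) (auto intro: exI[of _ "Var 0"])
  \<comment> \<open>Pairs of terms are coded by single numbers, so one diagonal sequence decides all
    equations between terms.\<close>
  obtain r where r: "strict_mono (r :: nat \<Rightarrow> nat)"
    "\<And>p. (\<forall>\<^sub>F n in sequentially. term_at (T (fst (prod_decode p))) (r n) = term_at (T (snd (prod_decode p))) (r n)) \<or>
      (\<forall>\<^sub>F n in sequentially. term_at (T (fst (prod_decode p))) (r n) \<noteq> term_at (T (snd (prod_decode p))) (r n))"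
    by (rule diagonal_decides[of "\<lambda>p n. term_at (T (fst (prod_decode p))) n = term_at (T (snd (prod_decode p))) n"]) (rule that)
  interpret diagonal_model T r
  proof
    show "(\<forall>\<^sub>F n in sequentially. term_at (T k) (r n) = term_at (T l) (r n)) \<or>
      (\<forall>\<^sub>F n in sequentially. term_at (T k) (r n) \<noteq> term_at (T l) (r n))" for k l
      using r(2)[of "prod_encode (k, l)"] by simp
  qed (use range_T r(1) in auto)
  have "the_model \<Turnstile> Imp (Rng_disjoint g A) (Neg (Inf_fm A))" if "NP_set A" for A
  proof (rule not_Inf_the_model[OF _ _ _ _ that])
    show "0 < 2 * d + 1" by simp
    show "clocked_machine g" "inputs g = 1" using g(1) by (auto simp: generator_def)
    show "\<forall>\<^sub>F n in sequentially. n ^ (2 * d + 1) < len (term_at t n) \<longrightarrow> (\<exists>x. fun_of g [x] = term_at t n)"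
      if "PV_trm t" for t
      using gen_out_hits_long_values[OF d(2,1) that] by (simp only: g(2))
  qed
  then have "generator g \<and> T_PV_model the_model \<and>
      (\<forall>A. NP_set A \<longrightarrow> the_model \<Turnstile> Imp (Rng_disjoint g A) (Neg (Inf_fm A)))"
    using g(1) T_PV_model_the_model by simp
  then show ?thesis by (intro exI)
qed

end
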